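(* Let $F:(M_1^{m_1},\phi_1,\xi_1,\eta_1,g_1)\to(M_2^{m_2},g_2)$ be a pointwise slant Riemannian submersion with slant function $\theta$ from a generalized Sasakian space form $M_1(c_1,c_2,c_3)$ onto a Riemannian manifold, with horizontal space of dimension $s\ge3$. Then, at every point, $$\rho_{\mathcal H}^{\mathcal H}\le\begin{cases}\delta_C^{\mathcal H}(s-1)+c_1+\dfrac{3c_2}{s}\cos^2\theta-\dfrac2s c_3,&\text{if }\xi_1\in\Gamma((\ker F_* )^\perp),\\[6pt]\delta_C^{\mathcal H}(s-1)+c_1+\dfrac{3c_2}{s-1}\cos^2\theta,&\text{if }\xi_1\in\Gamma(\ker F_* ),\end{cases}$$ and the same inequalities hold with $\delta_C^{\mathcal H}(s-1)$ replaced by $\hat\delta_C^{\mathcal H}(s-1)$. Equality holds (identically on $M_1$, in either version of the inequality) if and only if the tensor $A$ vanishes identically, i.e. $A_XY=0$ for all $X,Y\in\Gamma((\ker F_* )^\perp)$, which is equivalent to the horizontal distribution being completely integrable.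
   Context: All manifolds are smooth, connected, without boundary. A Riemannian submersion $F:(M_1^{m_1},g_1)\to(M_2^{m_2},g_2)$ has vertical distribution $\mathcal V=\ker F_*$ (of dimension $r$) and horizontal distribution $\mathcal H=(\ker F_* )^\perp$; $\mathcal V,\mathcal H$ also denote the orthogonal projections. $\nabla$ is the Levi-Civita connection of $g_1$. O'Neill's tensor $A$ is $A_EG=\mathcal V\nabla_{\mathcal HE}\mathcal HG+\mathcal H\nabla_{\mathcal HE}\mathcal VG$; for horizontal $X,Y$, $A_XY=\frac12\mathcal V[X,Y]$. Almost contact metric manifold $(M,\phi,\xi,\eta,g)$: $\phi^2=-I+\eta\otimes\xi$, $\eta(\xi)=1$, $\phi\xi=0$, with $g$ compatible ($g(\phi X,\phi Y)=g(X,Y)-\eta(X)\eta(Y)$). It is a generalized Sasakian space form $M(c_1,c_2,c_3)$ if for smooth functions $c_1,c_2,c_3$ $$\begin{aligned}R(X,Y)Z={}&c_1\{g(Y,Z)X-g(X,Z)Y\}+c_2\{g(X,\phi Z)\phi Y-g(Y,\phi Z)\phi X+2g(X,\phi Y)\phi Z\}\\&+c_3\{\eta(X)\eta(Z)Y-\eta(Y)\eta(Z)X+g(X,Z)\eta(Y)\xi-g(Y,Z)\eta(X)\xi\}.\end{aligned}$$ Pointwise slant: for vertical $U$ and horizontal $X$ write $\phi_1U=P^{\mathcal V}U+Q^{\mathcal V}U$ and $\phi_1X=P^{\mathcal H}X+Q^{\mathcal H}X$ with $P^{\mathcal V}U$, $Q^{\mathcal H}X$ vertical and $Q^{\mathcal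 V}U$, $P^{\mathcal H}X$ horizontal. The Reeb field $\xi_1$ is either vertical or horizontal. $F$ is pointwise slant with slant function $\theta:M_1\to[0,\pi/2]$ if at each $p$ the angle between $\phi_1U$ and $\mathcal V_p$ equals $\theta(p)$ for every nonzero $U\in\mathcal V_p$ orthogonal to $\xi_1$, i.e. $(P^{\mathcal V})^2=-\cos^2\theta\,I$ on the orthogonal complement of $\xi_1$ in $\mathcal V$. The convention used for the horizontal results is that the analogous identities hold for $P^{\mathcal H}$ with the same $\theta$: $(P^{\mathcal H})^2=-\cos^2\theta\,I$ on $\mathcal H\cap\ker\eta_1$, hence $\|P^{\mathcal H}\|^2=\sum_{i,j=1}^s g_1(X_i,P^{\mathcal H}X_j)^2$ equals $(s-1)\cos^2\theta$ if $\xi_1$ is horizontal and $s\cos^2\theta$ if $\xi_1$ is vertical. Curvature $R^{\mathcal H}$ of the horizontal distribution: it is related to the curvature $R^{M_1}$ of $M_1$, for horizontal $X,Y,Z,W$, by $$g_1(R^{M_1}(X,Y)Z,W)=g_1(R^{\mathcal H}(X,Y)Z,W)-2g_1(A_XY,A_ZW)+g_1(A_YZ,A_XW)-g_1(A_XZ,A_YW),$$ and this relation is taken as the definition of $R^{\mathcal H}$. For an orthonormal basis $\{X_1,\dots,X_s\}$ of $\mathcal H_p$, $\rho_{\mathcal H}^{\mathcal H}=\frac{1}{s(s-1)}\sum_{i,j=1}^s g_1(R^{\mathcal H}(X_i,X_j)X_j,X_i)$. Horizontal Casorati curvatures at $p$: with $\{U_1,\dots,U_r\}$ an orthonormal basis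 of $\mathcal V_p$, put $A_{ij}^k=g_1(A_{X_i}X_j,U_k)$ and $C^{\mathcal H}=\frac1s\sum_{k=1}^r\sum_{i,j=1}^s(A_{ij}^k)^2$. For a $q$-dimensional subspace $L\subset\mathcal H_p$ ($q\ge2$) with orthonormal basis $\{X_1,\dots,X_q\}$, $C(L)=\frac1q\sum_{k=1}^r\sum_{i,j=1}^q(A_{ij}^k)^2$. With $L$ ranging over hyperplanes ($(s-1)$-dimensional subspaces) of $\mathcal H_p$, $$\delta_C^{\mathcal H}(s-1)=\tfrac12C^{\mathcal H}+\tfrac{s+1}{2s}\inf_LC(L),\qquad\hat\delta_C^{\mathcal H}(s-1)=2C^{\mathcal H}-\tfrac{2s-1}{2s}\sup_LC(L).$$ *)

theory Defs
  imports "HOL-Analysis.Analysis"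
begin

section \<open>Smooth maps between Euclidean spaces\<close>

text \<open>Both notions are meant for an open set \<open>S\<close>.  In finite dimension, \<open>C\<^sup>k\<^sup>+\<^sup>1\<close> means
  differentiable with all directional derivatives of class \<open>C\<^sup>k\<close>.\<close>

primrec Ck_on :: "nat \<Rightarrow> 'e::euclidean_space set \<Rightarrow> ('e \<Rightarrow> 'v::real_normed_vector) \<Rightarrow> bool" where
  "Ck_on 0 S f \<longleftrightarrow> continuous_on S f"
| "Ck_on (Suc k) S f \<longleftrightarrow>
     (\<forall>x\<in>S. f differentiable at x) \<and> (\<forall>v. Ck_on k S (\<lambda>x. frechet_derivative f (at x) v))"

definition smooth_on :: "'e::euclidean_space set \<Rightarrow> ('e \<Rightarrow> 'v::real_normed_vector) \<Rightarrow> bool" where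
  "smooth_on S f \<longleftrightarrow> (\<forall>k. Ck_on k S f)"

section \<open>Smooth manifolds\<close>

text \<open>A manifold is a whole type \<open>'a\<close> with a smooth atlas of charts into \<open>'e\<close>; its dimension is
  \<open>DIM('e)\<close>.  The atlas need not be maximal.\<close>

type_synonym ('a, 'e) chart = "'a set \<times> ('a \<Rightarrow> 'e)"

definition chart_inv :: "('a, 'e) chart \<Rightarrow> 'e \<Rightarrow> 'a" where
  "chart_inv c = inv_into (fst c) (snd c)"

definition is_chart :: "('a::topological_space, 'e::euclidean_space) chart \<Rightarrow> bool" where
  "is_chart c \<longleftrightarrow> open (fst c) \<and> open (snd c ` fst c) \<and>
     homeomorphism (fst c) (snd c ` fst c) (snd c) (chart_inv c)"

definition smooth_atlas :: "('a::topological_space, 'e::euclidean_space) chart set \<Rightarrow> bool" where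
  "smooth_atlas A \<longleftrightarrow>
     (\<forall>c\<in>A. is_chart c) \<and> (\<Union>c\<in>A. fst c) = UNIV \<and>
     (\<forall>c\<in>A. \<forall>d\<in>A. smooth_on (snd c ` (fst c \<inter> fst d)) (snd d \<circ> chart_inv c))"

definition smooth_manifold ::
    "('a::{t2_space, second_countable_topology}, 'e::euclidean_space) chart set \<Rightarrow> bool" where
  "smooth_manifold A \<longleftrightarrow> smooth_atlas A \<and> connected (UNIV :: 'a set)"

text \<open>The tangent space at \<open>p\<close> is \<open>'e\<close>, a tangent vector being given by its components in one
  fixed chart \<open>chart_at A p\<close> around \<open>p\<close>.  This chart does not depend continuously on \<open>p\<close>, so
  smoothness of a vector field always has to be tested on its components in the charts of the
  atlas, as in \<open>smooth_field\<close> below.\<close>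

definition chart_at :: "('a, 'e) chart set \<Rightarrow> 'a \<Rightarrow> ('a, 'e) chart" where
  "chart_at A p = (SOME c. c \<in> A \<and> p \<in> fst c)"

definition dir_deriv ::
    "('a, 'e::euclidean_space) chart set \<Rightarrow> ('a \<Rightarrow> 'v::real_normed_vector) \<Rightarrow> 'a \<Rightarrow> 'e \<Rightarrow> 'v" where
  "dir_deriv A f p v =
     frechet_derivative (f \<circ> chart_inv (chart_at A p)) (at (snd (chart_at A p) p)) v"

text \<open>The components of the tangent vector \<open>v\<close> at \<open>p\<close> in an arbitrary chart \<open>c\<close> around \<open>p\<close> are
  \<open>dir_deriv A (snd c) p v\<close>.\<close>

definition field_in_chart ::
    "('a, 'e::euclidean_space) chart set \<Rightarrow> ('a, 'e) chart \<Rightarrow> ('a \<Rightarrow> 'e) \<Rightarrow> 'e \<Rightarrow> 'e" where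
  "field_in_chart A c X = (\<lambda>x. dir_deriv A (snd c) (chart_inv c x) (X (chart_inv c x)))"

definition smooth_fun :: "('a, 'e::euclidean_space) chart set \<Rightarrow> ('a \<Rightarrow> real) \<Rightarrow> bool" where
  "smooth_fun A f \<longleftrightarrow> (\<forall>c\<in>A. smooth_on (snd c ` fst c) (f \<circ> chart_inv c))"

definition smooth_field :: "('a, 'e::euclidean_space) chart set \<Rightarrow> ('a \<Rightarrow> 'e) \<Rightarrow> bool" where
  "smooth_field A X \<longleftrightarrow> (\<forall>c\<in>A. smooth_on (snd c ` fst c) (field_in_chart A c X))"

text \<open>Smooth sections of a family \<open>D\<close> of subspaces of the tangent spaces.\<close>

definition sections :: "('a, 'e::euclidean_space) chart set \<Rightarrow> ('a \<Rightarrow> 'e set) \<Rightarrow> ('a \<Rightarrow> 'e) set" where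
  "sections A D = {X. smooth_field A X \<and> (\<forall>p. X p \<in> D p)}"

definition smooth_map ::
    "('a::topological_space, 'e::euclidean_space) chart set \<Rightarrow>
     ('b::topological_space, 'f::euclidean_space) chart set \<Rightarrow> ('a \<Rightarrow> 'b) \<Rightarrow> bool" where
  "smooth_map A B F \<longleftrightarrow> continuous_on UNIV F \<and>
     (\<forall>c\<in>A. \<forall>d\<in>B. smooth_on (snd c ` (fst c \<inter> F -` fst d)) (snd d \<circ> F \<circ> chart_inv c))"

definition differential ::
    "('a, 'e::euclidean_space) chart set \<Rightarrow> ('b, 'f::euclidean_space) chart set \<Rightarrow>
     ('a \<Rightarrow> 'b) \<Rightarrow> 'a \<Rightarrow> 'e \<Rightarrow> 'f" where
  "differential A B F p v = dir_deriv A (snd (chart_at B (F p)) \<circ> F) p v"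

text \<open>\<open>[X,Y]\<^sup>i = X\<^sup>j \<partial>\<^sub>j Y\<^sup>i - Y\<^sup>j \<partial>\<^sub>j X\<^sup>i\<close>, evaluated at \<open>p\<close> in the chart \<open>chart_at A p\<close>.\<close>

definition lie_bracket ::
    "('a, 'e::euclidean_space) chart set \<Rightarrow> ('a \<Rightarrow> 'e) \<Rightarrow> ('a \<Rightarrow> 'e) \<Rightarrow> 'a \<Rightarrow> 'e" where
  "lie_bracket A X Y p =
     (let c = chart_at A p; x = snd c p in
        frechet_derivative (field_in_chart A c Y) (at x) (X p) -
        frechet_derivative (field_in_chart A c X) (at x) (Y p))"

section \<open>Integrability of distributions\<close>

text \<open>\<open>i : W \<rightarrow> M\<close> is an injective immersion of an open set \<open>W\<close> of the parameter space \<open>'k\<close> whose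
  tangent space at each of its points is the one prescribed by \<open>D\<close>.\<close>

definition integral_manifold ::
    "('a::topological_space, 'e::euclidean_space) chart set \<Rightarrow> ('a \<Rightarrow> 'e set) \<Rightarrow>
     'k::euclidean_space set \<Rightarrow> ('k \<Rightarrow> 'a) \<Rightarrow> bool" where
  "integral_manifold A D W i \<longleftrightarrow>
     open W \<and> inj_on i W \<and> continuous_on W i \<and>
     (\<forall>c\<in>A. smooth_on (W \<inter> i -` fst c) (snd c \<circ> i)) \<and>
     (\<forall>w\<in>W. let di = frechet_derivative (snd (chart_at A (i w)) \<circ> i) (at w)
             in inj di \<and> range di = D (i w))"

text \<open>Through every point passes an integral manifold.  The first argument fixes the parameter
  space, whose dimension has to be the rank of \<open>D\<close>.\<close>

definition completely_integrable ::
    "'k::euclidean_space itself \<Rightarrow> ('a::topological_space, 'e::euclidean_space) chart set \<Rightarrow>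
     ('a \<Rightarrow> 'e set) \<Rightarrow> bool" where
  "completely_integrable (K :: 'k itself) A D \<longleftrightarrow>
     (\<forall>p. \<exists>(W :: 'k set) i. integral_manifold A D W i \<and> p \<in> i ` W)"

section \<open>Riemannian metrics and the Levi-Civita connection\<close>

definition riemannian_metric ::
    "('a, 'e::euclidean_space) chart set \<Rightarrow> ('a \<Rightarrow> 'e \<Rightarrow> 'e \<Rightarrow> real) \<Rightarrow> bool" where
  "riemannian_metric A g \<longleftrightarrow>
     (\<forall>p. bilinear (g p) \<and> (\<forall>x y. g p x y = g p y x) \<and> (\<forall>x. x \<noteq> 0 \<longrightarrow> g p x x > 0)) \<and>
     (\<forall>X Y. smooth_field A X \<longrightarrow> smooth_field A Y \<longrightarrow> smooth_fun A (\<lambda>p. g p (X p) (Y p)))"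

definition riemannian_manifold ::
    "('a::{t2_space, second_countable_topology}, 'e::euclidean_space) chart set \<Rightarrow>
     ('a \<Rightarrow> 'e \<Rightarrow> 'e \<Rightarrow> real) \<Rightarrow> bool" where
  "riemannian_manifold A g \<longleftrightarrow> smooth_manifold A \<and> riemannian_metric A g"

text \<open>\<open>nabla X Y\<close> is the covariant derivative of \<open>Y\<close> along \<open>X\<close>; only its values on smooth fields
  matter.\<close>

definition affine_connection ::
    "('a, 'e::euclidean_space) chart set \<Rightarrow> (('a \<Rightarrow> 'e) \<Rightarrow> ('a \<Rightarrow> 'e) \<Rightarrow> 'a \<Rightarrow> 'e) \<Rightarrow> bool" where
  "affine_connection A nabla \<longleftrightarrow>
     (\<forall>X Y. smooth_field A X \<longrightarrow> smooth_field A Y \<longrightarrow> smooth_field A (nabla X Y)) \<and>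
     (\<forall>X X' Y. smooth_field A X \<longrightarrow> smooth_field A X' \<longrightarrow> smooth_field A Y \<longrightarrow>
        nabla (\<lambda>p. X p + X' p) Y = (\<lambda>p. nabla X Y p + nabla X' Y p)) \<and>
     (\<forall>f X Y. smooth_fun A f \<longrightarrow> smooth_field A X \<longrightarrow> smooth_field A Y \<longrightarrow>
        nabla (\<lambda>p. f p *\<^sub>R X p) Y = (\<lambda>p. f p *\<^sub>R nabla X Y p)) \<and>
     (\<forall>X Y Y'. smooth_field A X \<longrightarrow> smooth_field A Y \<longrightarrow> smooth_field A Y' \<longrightarrow>
        nabla X (\<lambda>p. Y p + Y' p) = (\<lambda>p. nabla X Y p + nabla X Y' p)) \<and>
     (\<forall>f X Y. smooth_fun A f \<longrightarrow> smooth_field A X \<longrightarrow> smooth_field A Y \<longrightarrow>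
        nabla X (\<lambda>p. f p *\<^sub>R Y p) =
          (\<lambda>p. dir_deriv A f p (X p) *\<^sub>R Y p + f p *\<^sub>R nabla X Y p))"

definition levi_civita ::
    "('a, 'e::euclidean_space) chart set \<Rightarrow> ('a \<Rightarrow> 'e \<Rightarrow> 'e \<Rightarrow> real) \<Rightarrow>
     (('a \<Rightarrow> 'e) \<Rightarrow> ('a \<Rightarrow> 'e) \<Rightarrow> 'a \<Rightarrow> 'e) \<Rightarrow> bool" where
  "levi_civita A g nabla \<longleftrightarrow> affine_connection A nabla \<and>
     (\<forall>X Y p. smooth_field A X \<longrightarrow> smooth_field A Y \<longrightarrow>
        nabla X Y p - nabla Y X p = lie_bracket A X Y p) \<and>
     (\<forall>X Y Z p. smooth_field A X \<longrightarrow> smooth_field A Y \<longrightarrow> smooth_field A Z \<longrightarrow>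
        dir_deriv A (\<lambda>q. g q (Y q) (Z q)) p (X p) =
          g p (nabla X Y p) (Z p) + g p (Y p) (nabla X Z p))"

definition curvature ::
    "('a, 'e::euclidean_space) chart set \<Rightarrow> (('a \<Rightarrow> 'e) \<Rightarrow> ('a \<Rightarrow> 'e) \<Rightarrow> 'a \<Rightarrow> 'e) \<Rightarrow>
     ('a \<Rightarrow> 'e) \<Rightarrow> ('a \<Rightarrow> 'e) \<Rightarrow> ('a \<Rightarrow> 'e) \<Rightarrow> 'a \<Rightarrow> 'e" where
  "curvature A nabla X Y Z p =
     nabla X (nabla Y Z) p - nabla Y (nabla X Z) p - nabla (lie_bracket A X Y) Z p"

text \<open>A tensor is evaluated on tangent vectors at \<open>p\<close> by extending them to smooth vector fields;
  by tensoriality the choice of the extensions is irrelevant.\<close>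

definition ext_field :: "('a, 'e::euclidean_space) chart set \<Rightarrow> 'a \<Rightarrow> 'e \<Rightarrow> 'a \<Rightarrow> 'e" where
  "ext_field A p v = (SOME X. smooth_field A X \<and> X p = v)"

definition curvature_at ::
    "('a, 'e::euclidean_space) chart set \<Rightarrow> (('a \<Rightarrow> 'e) \<Rightarrow> ('a \<Rightarrow> 'e) \<Rightarrow> 'a \<Rightarrow> 'e) \<Rightarrow>
     'a \<Rightarrow> 'e \<Rightarrow> 'e \<Rightarrow> 'e \<Rightarrow> 'e" where
  "curvature_at A nabla p x y z =
     curvature A nabla (ext_field A p x) (ext_field A p y) (ext_field A p z) p"

section \<open>Riemannian submersions and O'Neill's tensor\<close>

definition vertical ::
    "('a, 'e::euclidean_space) chart set \<Rightarrow> ('b, 'f::euclidean_space) chart set \<Rightarrow>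
     ('a \<Rightarrow> 'b) \<Rightarrow> 'a \<Rightarrow> 'e set" where
  "vertical A B F p = {u. differential A B F p u = 0}"

definition horizontal ::
    "('a, 'e::euclidean_space) chart set \<Rightarrow> ('b, 'f::euclidean_space) chart set \<Rightarrow>
     ('a \<Rightarrow> 'e \<Rightarrow> 'e \<Rightarrow> real) \<Rightarrow> ('a \<Rightarrow> 'b) \<Rightarrow> 'a \<Rightarrow> 'e set" where
  "horizontal A B g F p = {x. \<forall>u\<in>vertical A B F p. g p x u = 0}"

definition hproj ::
    "('a, 'e::euclidean_space) chart set \<Rightarrow> ('b, 'f::euclidean_space) chart set \<Rightarrow>
     ('a \<Rightarrow> 'e \<Rightarrow> 'e \<Rightarrow> real) \<Rightarrow> ('a \<Rightarrow> 'b) \<Rightarrow> 'a \<Rightarrow> 'e \<Rightarrow> 'e" where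
  "hproj A B g F p v = (THE h. h \<in> horizontal A B g F p \<and> v - h \<in> vertical A B F p)"

definition vproj ::
    "('a, 'e::euclidean_space) chart set \<Rightarrow> ('b, 'f::euclidean_space) chart set \<Rightarrow>
     ('a \<Rightarrow> 'e \<Rightarrow> 'e \<Rightarrow> real) \<Rightarrow> ('a \<Rightarrow> 'b) \<Rightarrow> 'a \<Rightarrow> 'e \<Rightarrow> 'e" where
  "vproj A B g F p v = (THE u. u \<in> vertical A B F p \<and> v - u \<in> horizontal A B g F p)"

definition riemannian_submersion ::
    "('a::topological_space, 'e::euclidean_space) chart set \<Rightarrow>
     ('b::topological_space, 'f::euclidean_space) chart set \<Rightarrow>
     ('a \<Rightarrow> 'e \<Rightarrow> 'e \<Rightarrow> real) \<Rightarrow> ('b \<Rightarrow> 'f \<Rightarrow> 'f \<Rightarrow> real) \<Rightarrow> ('a \<Rightarrow> 'b) \<Rightarrow> bool" where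
  "riemannian_submersion A B g g' F \<longleftrightarrow>
     smooth_map A B F \<and> surj F \<and> (\<forall>p. surj (differential A B F p)) \<and>
     (\<forall>p. \<forall>x\<in>horizontal A B g F p. \<forall>y\<in>horizontal A B g F p.
        g' (F p) (differential A B F p x) (differential A B F p y) = g p x y)"

definition oneill_A ::
    "('a, 'e::euclidean_space) chart set \<Rightarrow> ('b, 'f::euclidean_space) chart set \<Rightarrow>
     ('a \<Rightarrow> 'e \<Rightarrow> 'e \<Rightarrow> real) \<Rightarrow> ('a \<Rightarrow> 'b) \<Rightarrow>
     (('a \<Rightarrow> 'e) \<Rightarrow> ('a \<Rightarrow> 'e) \<Rightarrow> 'a \<Rightarrow> 'e) \<Rightarrow> ('a \<Rightarrow> 'e) \<Rightarrow> ('a \<Rightarrow> 'e) \<Rightarrow> 'a \<Rightarrow> 'e" where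
  "oneill_A A B g F nabla E G p =
     (let h = (\<lambda>Z q. hproj A B g F q (Z q)); v = (\<lambda>Z q. vproj A B g F q (Z q))
      in v (nabla (h E) (h G)) p + h (nabla (h E) (v G)) p)"

definition oneill_A_at ::
    "('a, 'e::euclidean_space) chart set \<Rightarrow> ('b, 'f::euclidean_space) chart set \<Rightarrow>
     ('a \<Rightarrow> 'e \<Rightarrow> 'e \<Rightarrow> real) \<Rightarrow> ('a \<Rightarrow> 'b) \<Rightarrow>
     (('a \<Rightarrow> 'e) \<Rightarrow> ('a \<Rightarrow> 'e) \<Rightarrow> 'a \<Rightarrow> 'e) \<Rightarrow> 'a \<Rightarrow> 'e \<Rightarrow> 'e \<Rightarrow> 'e" where
  "oneill_A_at A B g F nabla p x y =
     oneill_A A B g F nabla (ext_field A p x) (ext_field A p y) p"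

section \<open>Almost contact metric structures\<close>

definition almost_contact_metric ::
    "('a, 'e::euclidean_space) chart set \<Rightarrow> ('a \<Rightarrow> 'e \<Rightarrow> 'e) \<Rightarrow> ('a \<Rightarrow> 'e) \<Rightarrow> ('a \<Rightarrow> 'e \<Rightarrow> real) \<Rightarrow>
     ('a \<Rightarrow> 'e \<Rightarrow> 'e \<Rightarrow> real) \<Rightarrow> bool" where
  "almost_contact_metric A phi xi eta g \<longleftrightarrow>
     smooth_field A xi \<and>
     (\<forall>p. linear (phi p) \<and> linear (eta p)) \<and>
     (\<forall>X. smooth_field A X \<longrightarrow>
        smooth_field A (\<lambda>p. phi p (X p)) \<and> smooth_fun A (\<lambda>p. eta p (X p))) \<and>
     (\<forall>p x. phi p (phi p x) = - x + eta p x *\<^sub>R xi p) \<and>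
     (\<forall>p. eta p (xi p) = 1) \<and> (\<forall>p. phi p (xi p) = 0) \<and>
     (\<forall>p x y. g p (phi p x) (phi p y) = g p x y - eta p x * eta p y)"

definition generalized_sasakian_space_form ::
    "('a, 'e::euclidean_space) chart set \<Rightarrow> ('a \<Rightarrow> 'e \<Rightarrow> 'e) \<Rightarrow> ('a \<Rightarrow> 'e) \<Rightarrow> ('a \<Rightarrow> 'e \<Rightarrow> real) \<Rightarrow>
     ('a \<Rightarrow> 'e \<Rightarrow> 'e \<Rightarrow> real) \<Rightarrow> (('a \<Rightarrow> 'e) \<Rightarrow> ('a \<Rightarrow> 'e) \<Rightarrow> 'a \<Rightarrow> 'e) \<Rightarrow>
     ('a \<Rightarrow> real) \<Rightarrow> ('a \<Rightarrow> real) \<Rightarrow> ('a \<Rightarrow> real) \<Rightarrow> bool" where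
  "generalized_sasakian_space_form A phi xi eta g nabla c1 c2 c3 \<longleftrightarrow>
     almost_contact_metric A phi xi eta g \<and>
     smooth_fun A c1 \<and> smooth_fun A c2 \<and> smooth_fun A c3 \<and>
     (\<forall>X Y Z p. smooth_field A X \<longrightarrow> smooth_field A Y \<longrightarrow> smooth_field A Z \<longrightarrow>
        curvature A nabla X Y Z p =
          c1 p *\<^sub>R (g p (Y p) (Z p) *\<^sub>R X p - g p (X p) (Z p) *\<^sub>R Y p)
        + c2 p *\<^sub>R (g p (X p) (phi p (Z p)) *\<^sub>R phi p (Y p)
                  - g p (Y p) (phi p (Z p)) *\<^sub>R phi p (X p)
                  + (2 * g p (X p) (phi p (Y p))) *\<^sub>R phi p (Z p))
        + c3 p *\<^sub>R ((eta p (X p) * eta p (Z p)) *\<^sub>R Y p - (eta p (Y p) * eta p (Z p)) *\<^sub>R X p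
                  + (g p (X p) (Z p) * eta p (Y p)) *\<^sub>R xi p
                  - (g p (Y p) (Z p) * eta p (X p)) *\<^sub>R xi p))"

section \<open>Pointwise slant submersions\<close>

text \<open>The angle between a vector \<open>w \<noteq> 0\<close> and the vertical space is the angle between \<open>w\<close> and its
  orthogonal projection, \<open>\<pi>/2\<close> if the latter vanishes.\<close>

definition vertical_angle ::
    "('a, 'e::euclidean_space) chart set \<Rightarrow> ('b, 'f::euclidean_space) chart set \<Rightarrow>
     ('a \<Rightarrow> 'e \<Rightarrow> 'e \<Rightarrow> real) \<Rightarrow> ('a \<Rightarrow> 'b) \<Rightarrow> 'a \<Rightarrow> 'e \<Rightarrow> real" where
  "vertical_angle A B g F p w =
     (let w' = vproj A B g F p w in arccos (sqrt (g p w' w') / sqrt (g p w w)))"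

definition pointwise_slant ::
    "('a, 'e::euclidean_space) chart set \<Rightarrow> ('b, 'f::euclidean_space) chart set \<Rightarrow>
     ('a \<Rightarrow> 'e \<Rightarrow> 'e \<Rightarrow> real) \<Rightarrow> ('a \<Rightarrow> 'b) \<Rightarrow> ('a \<Rightarrow> 'e \<Rightarrow> 'e) \<Rightarrow> ('a \<Rightarrow> 'e) \<Rightarrow>
     ('a \<Rightarrow> real) \<Rightarrow> bool" where
  "pointwise_slant A B g F phi xi \<theta> \<longleftrightarrow>
     ((\<forall>p. xi p \<in> vertical A B F p) \<or> (\<forall>p. xi p \<in> horizontal A B g F p)) \<and>
     (\<forall>p. 0 \<le> \<theta> p \<and> \<theta> p \<le> pi / 2) \<and>
     (\<forall>p. \<forall>u\<in>vertical A B F p. u \<noteq> 0 \<longrightarrow> g p u (xi p) = 0 \<longrightarrow>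
        vertical_angle A B g F p (phi p u) = \<theta> p)"

text \<open>The convention \<open>(P\<^sup>H)\<^sup>2 = - cos\<^sup>2 \<theta> I\<close> on the horizontal vectors in the kernel of \<open>\<eta>\<close>, where
  \<open>P\<^sup>H x\<close> is the horizontal part of \<open>\<phi> x\<close>.\<close>

definition horizontally_slant ::
    "('a, 'e::euclidean_space) chart set \<Rightarrow> ('b, 'f::euclidean_space) chart set \<Rightarrow>
     ('a \<Rightarrow> 'e \<Rightarrow> 'e \<Rightarrow> real) \<Rightarrow> ('a \<Rightarrow> 'b) \<Rightarrow> ('a \<Rightarrow> 'e \<Rightarrow> 'e) \<Rightarrow> ('a \<Rightarrow> 'e \<Rightarrow> real) \<Rightarrow>
     ('a \<Rightarrow> real) \<Rightarrow> bool" where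
  "horizontally_slant A B g F phi eta \<theta> \<longleftrightarrow>
     (\<forall>p. \<forall>x\<in>horizontal A B g F p. eta p x = 0 \<longrightarrow>
        hproj A B g F p (phi p (hproj A B g F p (phi p x))) = - (cos (\<theta> p))\<^sup>2 *\<^sub>R x)"

section \<open>Horizontal scalar curvature and Casorati curvatures\<close>

text \<open>\<open>some_onb b L\<close> is an orthonormal basis of the subspace \<open>L\<close> for the inner product \<open>b\<close>.  The
  quantities defined below do not depend on its choice.\<close>

definition orthonormal_basis ::
    "('e::euclidean_space \<Rightarrow> 'e \<Rightarrow> real) \<Rightarrow> 'e set \<Rightarrow> 'e set \<Rightarrow> bool" where
  "orthonormal_basis b L E \<longleftrightarrow> finite E \<and> E \<subseteq> L \<and> span E = L \<and>
     (\<forall>x\<in>E. \<forall>y\<in>E. b x y = (if x = y then 1 else 0))"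

definition some_onb :: "('e::euclidean_space \<Rightarrow> 'e \<Rightarrow> real) \<Rightarrow> 'e set \<Rightarrow> 'e set" where
  "some_onb b L = (SOME E. orthonormal_basis b L E)"

text \<open>\<open>g(R\<^sup>H(x,y)z,w)\<close>, defined by O'Neill's horizontal curvature relation.\<close>

definition horizontal_curvature ::
    "('a, 'e::euclidean_space) chart set \<Rightarrow> ('b, 'f::euclidean_space) chart set \<Rightarrow>
     ('a \<Rightarrow> 'e \<Rightarrow> 'e \<Rightarrow> real) \<Rightarrow> ('a \<Rightarrow> 'b) \<Rightarrow>
     (('a \<Rightarrow> 'e) \<Rightarrow> ('a \<Rightarrow> 'e) \<Rightarrow> 'a \<Rightarrow> 'e) \<Rightarrow> 'a \<Rightarrow> 'e \<Rightarrow> 'e \<Rightarrow> 'e \<Rightarrow> 'e \<Rightarrow> real" where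
  "horizontal_curvature A B g F nabla p x y z w =
     (let a = oneill_A_at A B g F nabla p in
        g p (curvature_at A nabla p x y z) w
        + 2 * g p (a x y) (a z w) - g p (a y z) (a x w) + g p (a x z) (a y w))"

definition horizontal_scalar_curvature ::
    "('a, 'e::euclidean_space) chart set \<Rightarrow> ('b, 'f::euclidean_space) chart set \<Rightarrow>
     ('a \<Rightarrow> 'e \<Rightarrow> 'e \<Rightarrow> real) \<Rightarrow> ('a \<Rightarrow> 'b) \<Rightarrow>
     (('a \<Rightarrow> 'e) \<Rightarrow> ('a \<Rightarrow> 'e) \<Rightarrow> 'a \<Rightarrow> 'e) \<Rightarrow> 'a \<Rightarrow> real" where
  "horizontal_scalar_curvature A B g F nabla p =
     (let H = horizontal A B g F p; s = real (dim H); E = some_onb (g p) H in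
        1 / (s * (s - 1)) * (\<Sum>x\<in>E. \<Sum>y\<in>E. horizontal_curvature A B g F nabla p x y y x))"

text \<open>\<open>C(L)\<close> for a subspace \<open>L\<close> of the horizontal space at \<open>p\<close>; the Casorati curvature \<open>C\<^sup>H\<close> is
  the case where \<open>L\<close> is the whole horizontal space.\<close>

definition casorati ::
    "('a, 'e::euclidean_space) chart set \<Rightarrow> ('b, 'f::euclidean_space) chart set \<Rightarrow>
     ('a \<Rightarrow> 'e \<Rightarrow> 'e \<Rightarrow> real) \<Rightarrow> ('a \<Rightarrow> 'b) \<Rightarrow>
     (('a \<Rightarrow> 'e) \<Rightarrow> ('a \<Rightarrow> 'e) \<Rightarrow> 'a \<Rightarrow> 'e) \<Rightarrow> 'a \<Rightarrow> 'e set \<Rightarrow> real" where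
  "casorati A B g F nabla p L =
     (let E = some_onb (g p) L; U = some_onb (g p) (vertical A B F p) in
        1 / real (dim L) *
        (\<Sum>u\<in>U. \<Sum>x\<in>E. \<Sum>y\<in>E. (g p (oneill_A_at A B g F nabla p x y) u)\<^sup>2))"

definition hyperplanes :: "'e::euclidean_space set \<Rightarrow> 'e set set" where
  "hyperplanes H = {L. subspace L \<and> L \<subseteq> H \<and> dim L = dim H - 1}"

definition casorati_delta ::
    "('a, 'e::euclidean_space) chart set \<Rightarrow> ('b, 'f::euclidean_space) chart set \<Rightarrow>
     ('a \<Rightarrow> 'e \<Rightarrow> 'e \<Rightarrow> real) \<Rightarrow> ('a \<Rightarrow> 'b) \<Rightarrow>
     (('a \<Rightarrow> 'e) \<Rightarrow> ('a \<Rightarrow> 'e) \<Rightarrow> 'a \<Rightarrow> 'e) \<Rightarrow> 'a \<Rightarrow> real" where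
  "casorati_delta A B g F nabla p =
     (let H = horizontal A B g F p; s = real (dim H); C = casorati A B g F nabla p in
        1 / 2 * C H + (s + 1) / (2 * s) * (INF L\<in>hyperplanes H. C L))"

definition casorati_delta_hat ::
    "('a, 'e::euclidean_space) chart set \<Rightarrow> ('b, 'f::euclidean_space) chart set \<Rightarrow>
     ('a \<Rightarrow> 'e \<Rightarrow> 'e \<Rightarrow> real) \<Rightarrow> ('a \<Rightarrow> 'b) \<Rightarrow>
     (('a \<Rightarrow> 'e) \<Rightarrow> ('a \<Rightarrow> 'e) \<Rightarrow> 'a \<Rightarrow> 'e) \<Rightarrow> 'a \<Rightarrow> real" where
  "casorati_delta_hat A B g F nabla p =
     (let H = horizontal A B g F p; s = real (dim H); C = casorati A B g F nabla p in
        2 * C H - (2 * s - 1) / (2 * s) * (SUP L\<in>hyperplanes H. C L))"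

end

theory Submission
  imports Defs
begin

text \<open>Let \<open>a\<close> denote O'Neill's tensor \<open>A\<close> on the horizontal space at a point and \<open>T\<close> its squared norm.
  The curvature relation defining \<open>R\<^sup>H\<close> and the skew-symmetry of \<open>a\<close> show that the normalised horizontal
  scalar curvature is the mean of the sectional curvatures of the total space over horizontal planes
  minus \<open>3 T / (s (s - 1))\<close> (\<open>horizontal_scalar_curvature_eq\<close>).  For a generalized Sasakian space form
  with the slant condition the mean is exactly the bound of the theorem without the Casorati term
  (\<open>mean_curvature_horizontal\<close>, \<open>mean_curvature_vertical\<close>).  Moreover \<open>0 \<le> C(L) \<le> T / (s - 1)\<close> for every
  hyperplane \<open>L\<close>, because restriction to a subspace decreases the Hilbert--Schmidt norm.  Hence either
  Casorati curvature exceeds \<open>- 3 T / (s (s - 1))\<close> by at least \<open>T / (2 s)\<close>, and both inequalities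
  follow, with equality precisely where \<open>T = 0\<close> (\<open>casorati_inequalities\<close>).

  This uses that \<open>a\<close> is a skew-symmetric tensor.  Both properties come from one fact
  (\<open>lie_derivative_vertical\<close>): on horizontal vectors \<open>g\<close> agrees with the metric pulled back from the base,
  whose Lie derivative along vertical fields vanishes.  With the Koszul argument this makes the
  vertical part of \<open>\<nabla>\<^sub>X Y\<close> skew-symmetric in horizontal \<open>X\<close>, \<open>Y\<close>, hence equal to half the vertical part
  of \<open>[X, Y]\<close>; and it depends on \<open>Y\<close>, therefore also on \<open>X\<close>, only through the value at the point.

  For integrability let \<open>\<omega>(x) k\<close> be the horizontal lift of a tangent vector \<open>k\<close> of the base, written in
  charts.  Brackets of lifts of coordinate fields are vertical, so \<open>a = 0\<close> if and only if these lifts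
  commute (\<open>tensor_zero_iff_clifts_commute\<close>).  Commuting lifts are integrated directly, without a straightening
  of \<open>F\<close> and without smooth dependence of flows on parameters (\<open>commuting_lifts_integrable\<close>): the
  equation \<open>du(y) = \<omega>(u(y))\<close> is solved along rays by a contraction, and commutativity implies that the result
  satisfies it in all directions.  Its solution parametrises an integral manifold.  Conversely,
  differentiating the equation of an integral manifold shows that the lifts commute.

  The calculus of \<open>C\<^sup>k\<close> maps needed for this is developed first.  Its main points are the regularity of
  solutions of linear systems (\<open>Ck_on_solve\<close>), from which the smoothness of horizontal lifts and
  projections follows, the symmetry of second derivatives (\<open>D2_symmetric\<close>), and cut-off functions
  (\<open>plateau_exists\<close>), which extend tangent vectors and local fields to global fields.\<close>

section \<open>Calculus of \<open>C\<^sup>k\<close> maps\<close>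

abbreviation D :: "('e::euclidean_space \<Rightarrow> 'v::real_normed_vector) \<Rightarrow> 'e \<Rightarrow> 'e \<Rightarrow> 'v" where
  "D f x \<equiv> frechet_derivative f (at x)"

lemma D_eq: "(f has_derivative f') (at x) \<Longrightarrow> D f x = f'"
  by (metis frechet_derivative_at)

lemma D_cong:
  assumes "open S" "x \<in> S" "\<And>y. y \<in> S \<Longrightarrow> f y = g y"
  shows "D f x = D g x"
proof -
  have "(f has_derivative f') (at x) = (g has_derivative f') (at x)" for f'
    using assms by (metis has_derivative_transform_within_open)
  then show ?thesis unfolding frechet_derivative_def by simp
qed

lemma differentiable_cong:
  assumes "open S" "x \<in> S" "\<And>y. y \<in> S \<Longrightarrow> f y = g y" "f differentiable at x"
  shows "g differentiable at x"
  using assms unfolding differentiable_def by (metis has_derivative_transform_within_open)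

lemma Ck_on_Suc_D: "Ck_on (Suc k) S f \<Longrightarrow> Ck_on k S f"
proof (induction k arbitrary: f)
  case 0
  then show ?case
    by (simp add: continuous_at_imp_continuous_on differentiable_imp_continuous_within)
next
  case (Suc k)
  then show ?case by (auto simp del: Ck_on.simps(2) simp: Ck_on.simps(2)[of "Suc k"] Ck_on.simps(2)[of k])
qed

lemma Ck_on_continuous: "Ck_on k S f \<Longrightarrow> continuous_on S f"
  by (induction k) (use Ck_on_Suc_D in \<open>auto simp del: Ck_on.simps(2)\<close>)

lemma Ck_on_subset: "Ck_on k S f \<Longrightarrow> T \<subseteq> S \<Longrightarrow> Ck_on k T f"
  by (induction k arbitrary: f) (auto intro: continuous_on_subset)

lemma Ck_on_cong:
  assumes "open S" "\<And>x. x \<in> S \<Longrightarrow> f x = g x"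
  shows "Ck_on k S f = Ck_on k S g"
  using assms(2)
proof (induction k arbitrary: f g)
  case 0
  then show ?case by (simp cong: continuous_on_cong)
next
  case (Suc k)
  have "D f x = D g x" if "x \<in> S" for x using D_cong[OF assms(1) that] Suc.prems by blast
  then have *: "Ck_on k S (\<lambda>x. D f x v) = Ck_on k S (\<lambda>x. D g x v)" for v
    by (intro Suc.IH) simp
  have "f differentiable at x \<longleftrightarrow> g differentiable at x" if "x \<in> S" for x
    using differentiable_cong[OF assms(1) that, of f g] differentiable_cong[OF assms(1) that, of g f]
      Suc.prems by auto
  with * show ?case by simp
qed

lemma Ck_on_local:
  assumes "\<And>x. x \<in> S \<Longrightarrow> \<exists>T. open T \<and> x \<in> T \<and> Ck_on k T f"
  shows "Ck_on k S f"
  using assms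
proof (induction k arbitrary: f)
  case 0
  have "isCont f x" if "x \<in> S" for x
    using 0[OF that] by (auto simp: continuous_on_eq_continuous_at)
  then show ?case by (simp add: continuous_at_imp_continuous_on)
next
  case (Suc k)
  have "f differentiable at x" if "x \<in> S" for x using Suc.prems[OF that] by auto
  moreover have "Ck_on k S (\<lambda>x. D f x v)" for v
  proof (rule Suc.IH)
    fix x assume "x \<in> S"
    then obtain T where "open T" "x \<in> T" "Ck_on (Suc k) T f" using Suc.prems by blast
    then show "\<exists>T. open T \<and> x \<in> T \<and> Ck_on k T (\<lambda>x. D f x v)" by auto
  qed
  ultimately show ?case by simp
qed

lemma Ck_on_congI:
  assumes "Ck_on k S f" "open S" "\<And>x. x \<in> S \<Longrightarrow> f x = g x"
  shows "Ck_on k S g"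
  using assms(1) Ck_on_cong[OF assms(2), of f g k] assms(3) by simp

lemma Ck_onI:
  assumes "open S" "\<And>x. x \<in> S \<Longrightarrow> (f has_derivative f' x) (at x)"
    and "\<And>v. Ck_on k S (\<lambda>x. f' x v)"
  shows "Ck_on (Suc k) S f"
proof -
  have "D f x = f' x" if "x \<in> S" for x using assms(2) that D_eq by blast
  then have "Ck_on k S (\<lambda>x. D f x v)" for v
    by (intro Ck_on_congI[OF assms(3) assms(1)]) simp
  then show ?thesis using assms(2) by (auto simp: differentiable_def)
qed

lemma Ck_on_has_derivative:
  "Ck_on (Suc k) S f \<Longrightarrow> x \<in> S \<Longrightarrow> (f has_derivative D f x) (at x)"
  by (simp add: frechet_derivative_works)

lemma Ck_on_D: "Ck_on (Suc k) S f \<Longrightarrow> Ck_on k S (\<lambda>x. D f x v)"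
  by simp

lemma Ck_on_const: "Ck_on k S (\<lambda>x. c)"
  by (induction k arbitrary: c) auto

lemma Ck_on_linear:
  assumes "bounded_linear l" shows "Ck_on k S l"
proof (cases k)
  case (Suc j)
  have "(l has_derivative l) (at x)" for x using assms by (rule bounded_linear_imp_has_derivative)
  then have "D l x = l" for x by (rule D_eq)
  moreover have "l differentiable at x" for x using \<open>(l has_derivative l) (at x)\<close> by (rule differentiableI)
  ultimately show ?thesis using Suc by (simp add: Ck_on_const)
qed (use assms in \<open>auto intro: linear_continuous_on\<close>)

lemma Ck_on_add:
  assumes "open S" "Ck_on k S f" "Ck_on k S g" shows "Ck_on k S (\<lambda>x. f x + g x)"
  using assms(2,3)
proof (induction k arbitrary: f g)
  case (Suc k)
  show ?case
    by (rule Ck_onI[OF assms(1), where f' = "\<lambda>x v. D f x v + D g x v"])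
      (use Suc in \<open>auto intro!: has_derivative_add Ck_on_has_derivative[OF Suc.prems(1)]
        Ck_on_has_derivative[OF Suc.prems(2)]\<close>)
qed (auto intro: continuous_on_add)

lemma Ck_on_sum:
  assumes "open S" "\<And>i. i \<in> I \<Longrightarrow> Ck_on k S (f i)" shows "Ck_on k S (\<lambda>x. \<Sum>i\<in>I. f i x)"
  using assms(2)
  by (induction I rule: infinite_finite_induct) (auto intro: Ck_on_add[OF assms(1)] Ck_on_const)

lemma (in bounded_bilinear) Ck_on_bilinear:
  fixes f :: "'e::euclidean_space \<Rightarrow> 'a"
  assumes "open S" "Ck_on k S f" "Ck_on k S g" shows "Ck_on k S (\<lambda>x. prod (f x) (g x))"
  using assms(2,3)
proof (induction k arbitrary: f g)
  case 0
  then show ?case by (auto intro: continuous_on)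
next
  case (Suc k)
  have "Ck_on k S (\<lambda>x. prod (f x) (D g x v))" "Ck_on k S (\<lambda>x. prod (D f x v) (g x))" for v
    by (intro Suc.IH Ck_on_D Ck_on_Suc_D[OF Suc.prems(1)] Ck_on_Suc_D[OF Suc.prems(2)] Suc.prems)+
  then show ?case
    by (intro Ck_onI[OF assms(1), where f' = "\<lambda>x v. prod (f x) (D g x v) + prod (D f x v) (g x)"]
        FDERIV Ck_on_has_derivative[OF Suc.prems(1)] Ck_on_has_derivative[OF Suc.prems(2)] Ck_on_add[OF assms(1)])
qed

lemmas Ck_on_scaleR = bounded_bilinear.Ck_on_bilinear[OF bounded_bilinear_scaleR]
lemmas Ck_on_mult = bounded_bilinear.Ck_on_bilinear[OF bounded_bilinear_mult]
lemmas Ck_on_inner = bounded_bilinear.Ck_on_bilinear[OF bounded_bilinear_inner]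

lemma linear_eq_sum_Basis:
  assumes "linear f" shows "f (v::'a::euclidean_space) = (\<Sum>b\<in>Basis. (v \<bullet> b) *\<^sub>R f b)"
proof -
  have "f v = f (\<Sum>b\<in>Basis. (v \<bullet> b) *\<^sub>R b)" by (simp add: euclidean_representation)
  also have "\<dots> = (\<Sum>b\<in>Basis. (v \<bullet> b) *\<^sub>R f b)"
    using assms by (simp add: linear_sum linear_cmul)
  finally show ?thesis .
qed

text \<open>Expanding \<open>w\<close> in a basis reduces the claim to the values of \<open>L\<close> on constant vectors.\<close>

lemma Ck_on_apply:
  fixes L :: "'e::euclidean_space \<Rightarrow> 'm::euclidean_space \<Rightarrow> 'v::real_normed_vector"
  assumes "open S" "\<And>x. x \<in> S \<Longrightarrow> linear (L x)" "\<And>v. Ck_on k S (\<lambda>x. L x v)" "Ck_on k S w"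
  shows "Ck_on k S (\<lambda>x. L x (w x))"
proof -
  have "Ck_on k S (\<lambda>x. \<Sum>b\<in>Basis. (w x \<bullet> b) *\<^sub>R L x b)"
    by (intro Ck_on_sum Ck_on_scaleR Ck_on_inner assms Ck_on_const)
  then show ?thesis
    by (rule Ck_on_congI[OF _ assms(1)]) (simp add: linear_eq_sum_Basis[OF assms(2), symmetric])
qed

lemma linear_D: "Ck_on (Suc k) S f \<Longrightarrow> x \<in> S \<Longrightarrow> linear (D f x)"
  by (simp add: linear_frechet_derivative)

lemma D_compose:
  assumes "f differentiable at x" "g differentiable at (f x)"
  shows "D (\<lambda>y. g (f y)) x v = D g (f x) (D f x v)"
  using frechet_derivative_compose[OF assms] by (simp add: o_def)

text \<open>The chain rule expresses the derivative of \<open>g \<circ> f\<close> through \<open>Dg \<circ> f\<close>, of class \<open>C\<^sup>k\<close> by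
  the induction hypothesis, applied to the \<open>C\<^sup>k\<close> map \<open>Df v\<close>.\<close>

lemma Ck_on_compose:
  fixes f :: "'e::euclidean_space \<Rightarrow> 'f::euclidean_space" and g :: "'f \<Rightarrow> 'v::real_normed_vector"
  assumes "open S" "open T" "Ck_on k S f" "Ck_on k T g" "f ` S \<subseteq> T"
  shows "Ck_on k S (\<lambda>x. g (f x))"
  using assms(3,4)
proof (induction k arbitrary: g)
  case 0
  then show ?case using assms(5) by (auto intro: continuous_on_compose2)
next
  case (Suc k)
  have fx: "f x \<in> T" if "x \<in> S" for x using that assms(5) by auto
  have "Ck_on k S (\<lambda>x. D g (f x) (D f x v))" for v
  proof (rule Ck_on_apply[OF assms(1)])
    show "linear (D g (f x))" if "x \<in> S" for x using linear_D[OF Suc.prems(2) fx[OF that]] .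
    show "Ck_on k S (\<lambda>x. D g (f x) v)" for v
      by (rule Suc.IH[OF Ck_on_Suc_D[OF Suc.prems(1)] Ck_on_D[OF Suc.prems(2)]])
    show "Ck_on k S (\<lambda>x. D f x v)" by (rule Ck_on_D[OF Suc.prems(1)])
  qed
  moreover have "((\<lambda>x. g (f x)) has_derivative (\<lambda>v. D g (f x) (D f x v))) (at x)" if "x \<in> S" for x
    using has_derivative_compose[OF Ck_on_has_derivative[OF Suc.prems(1) that]
        Ck_on_has_derivative[OF Suc.prems(2) fx[OF that]]] .
  ultimately show ?case by (intro Ck_onI[OF assms(1)])
qed

subsection \<open>Solutions of linear systems\<close>

lemma linear_inj_lower_bound:
  fixes L :: "'m::euclidean_space \<Rightarrow> 'm"
  assumes "linear L" "inj L" obtains B where "B > 0" "\<And>v. B * norm v \<le> norm (L v)"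
  using linear_inj_bounded_below_pos[OF assms] by (metis mult.commute)

text \<open>By continuity the linear maps near an invertible one are invertible with a common bound for
  the inverses.\<close>

lemma linear_family_lower_bound:
  fixes L :: "'e::euclidean_space \<Rightarrow> 'm::euclidean_space \<Rightarrow> 'm"
  assumes "open S" "x0 \<in> S" "\<And>x. x \<in> S \<Longrightarrow> linear (L x)" "inj (L x0)"
    and "\<And>v. continuous_on S (\<lambda>x. L x v)"
  shows "\<exists>B>0. \<forall>\<^sub>F x in at x0. \<forall>v. B * norm v \<le> norm (L x v)"
proof -
  obtain B where B: "B > 0" "\<And>v. B * norm v \<le> norm (L x0 v)"
    using linear_inj_lower_bound[OF assms(3)[OF assms(2)] assms(4)] by blast
  have "((\<lambda>x. \<Sum>b\<in>Basis. norm (L x b - L x0 b)) \<longlongrightarrow> (\<Sum>b\<in>(Basis::'m set). norm (L x0 b - L x0 b))) (at x0)"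
    using assms(1,2,5) by (intro tendsto_intros) (auto simp: continuous_on_eq_continuous_at isCont_def)
  then have "\<forall>\<^sub>F x in at x0. (\<Sum>b\<in>Basis. norm (L x b - L x0 b)) < B / 2"
    by (rule order_tendstoD) (use B in simp)
  moreover have "\<forall>\<^sub>F x in at x0. x \<in> S" using assms(1,2) by (simp add: eventually_at_in_open')
  ultimately have "\<forall>\<^sub>F x in at x0. \<forall>v. B / 2 * norm v \<le> norm (L x v)"
  proof eventually_elim
    case (elim x)
    show ?case
    proof
      fix v
      have "norm (L x v - L x0 v) = norm (\<Sum>b\<in>Basis. (v \<bullet> b) *\<^sub>R (L x b - L x0 b))"
        by (subst linear_eq_sum_Basis[OF assms(3)[OF elim(2)]],
            subst linear_eq_sum_Basis[OF assms(3)[OF assms(2)]])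
          (simp add: sum_subtractf scaleR_diff_right)
      also have "\<dots> \<le> (\<Sum>b\<in>Basis. norm v * norm (L x b - L x0 b))"
        by (rule sum_norm_le) (auto intro!: mult_right_mono simp: Basis_le_norm)
      also have "\<dots> \<le> norm v * (B / 2)"
        unfolding sum_distrib_left[symmetric] using elim(1) by (intro mult_left_mono) auto
      finally have "norm (L x v - L x0 v) \<le> norm v * (B / 2)" .
      moreover have "norm (L x0 v) \<le> norm (L x v) + norm (L x v - L x0 v)"
        by (metis norm_minus_commute norm_triangle_sub add.commute)
      ultimately show "B / 2 * norm v \<le> norm (L x v)" using B(2)[of v] by (simp add: field_simps)
    qed
  qed
  then show ?thesis using B(1) by (intro exI[of _ "B/2"]) simp
qed

text \<open>A solution of \<open>L x (Y x) = w x\<close> inherits the regularity of \<open>L\<close> and \<open>w\<close>: its derivative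
  solves the differentiated system, whose right-hand side involves only \<open>Y\<close> and the
  derivatives of \<open>L\<close> and \<open>w\<close>, so the claim follows by induction.\<close>

lemma Ck_on_solve:
  fixes L :: "'e::euclidean_space \<Rightarrow> 'm::euclidean_space \<Rightarrow> 'm"
  assumes S: "open S" and lin: "\<And>x. x \<in> S \<Longrightarrow> linear (L x)" and inj: "\<And>x. x \<in> S \<Longrightarrow> inj (L x)"
    and L: "\<And>v. Ck_on k S (\<lambda>x. L x v)" and w: "Ck_on k S w"
    and Y: "\<And>x. x \<in> S \<Longrightarrow> L x (Y x) = w x"
  shows "Ck_on k S Y"
  using L w Y
proof (induction k arbitrary: w Y)
  case 0
  have "(Y \<longlongrightarrow> Y x0) (at x0)" if x0: "x0 \<in> S" for x0
  proof -
    obtain B where B: "B > 0" "\<forall>\<^sub>F x in at x0. \<forall>v. B * norm v \<le> norm (L x v)"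
      using linear_family_lower_bound[of S x0 L, OF S x0 lin inj[OF x0]] 0(1) by auto
    have inS: "\<forall>\<^sub>F x in at x0. x \<in> S" using S x0 by (simp add: eventually_at_in_open')
    have "((\<lambda>x. w x - L x (Y x0)) \<longlongrightarrow> w x0 - L x0 (Y x0)) (at x0)"
      using 0(1,2) S x0 by (intro tendsto_intros) (auto simp: continuous_on_eq_continuous_at isCont_def)
    then have "((\<lambda>x. norm (w x - L x (Y x0)) / B) \<longlongrightarrow> norm (w x0 - L x0 (Y x0)) / B) (at x0)"
      using B(1) by (intro tendsto_divide tendsto_norm tendsto_const) simp_all
    then have lim: "((\<lambda>x. norm (w x - L x (Y x0)) / B) \<longlongrightarrow> 0) (at x0)"
      using 0(3)[OF x0] by simp
    have "\<forall>\<^sub>F x in at x0. norm (Y x - Y x0) \<le> norm (w x - L x (Y x0)) / B"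
      using B(2) inS
    proof eventually_elim
      case (elim x)
      have "B * norm (Y x - Y x0) \<le> norm (w x - L x (Y x0))"
        using elim(1)[rule_format, of "Y x - Y x0"] 0(3)[OF elim(2)] linear_diff[OF lin[OF elim(2)]] by simp
      then show ?case using B(1) by (simp add: field_simps)
    qed
    then have "((\<lambda>x. Y x - Y x0) \<longlongrightarrow> 0) (at x0)"
      by (rule Lim_null_comparison) (rule lim)
    then show ?thesis by (simp add: Lim_null[symmetric])
  qed
  then show ?case using S by (simp add: continuous_on_eq_continuous_at isCont_def)
next
  case (Suc k)
  have Yk: "Ck_on k S Y"
    by (rule Suc.IH[OF _ Ck_on_Suc_D[OF Suc.prems(2)] Suc.prems(3)]) (rule Ck_on_Suc_D[OF Suc.prems(1)])
  define L' where "L' x v u = (\<Sum>b\<in>Basis. (u \<bullet> b) *\<^sub>R D (\<lambda>x. L x b) x v)" for x v u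
  define Y' where "Y' x v = inv (L x) (D w x v - L' x v (Y x))" for x v
  have bij: "bij (L x)" if "x \<in> S" for x
    using lin[OF that] inj[OF that] by (simp add: bij_def linear_inj_imp_surj)
  have Y'eq: "L x (Y' x v) = D w x v - L' x v (Y x)" if "x \<in> S" for x v
    using bij[OF that] by (simp add: Y'_def bij_is_surj surj_f_inv_f)
  have Y'k: "Ck_on k S (\<lambda>x. Y' x v)" for v
  proof (rule Suc.IH[OF _ _ Y'eq])
    show "Ck_on k S (\<lambda>x. L x v)" for v by (rule Ck_on_Suc_D[OF Suc.prems(1)])
    have "Ck_on k S (\<lambda>x. L' x v (Y x))" unfolding L'_def
      by (intro Ck_on_sum Ck_on_scaleR Ck_on_inner Yk S Ck_on_const Ck_on_D Suc.prems)
    then have "Ck_on k S (\<lambda>x. D w x v + (-1) *\<^sub>R L' x v (Y x))"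
      by (intro Ck_on_add Ck_on_scaleR S Ck_on_D Suc.prems Ck_on_const)
    then show "Ck_on k S (\<lambda>x. D w x v - L' x v (Y x))" by simp
  qed
  have "(Y has_derivative Y' x0) (at x0)" if x0: "x0 \<in> S" for x0
  proof -
    have linw: "linear (D w x0)" using linear_D[OF Suc.prems(2) x0] .
    have linL': "linear (D (\<lambda>x. L x u) x0)" for u using linear_D[OF Suc.prems(1) x0] .
    have "linear (\<lambda>v. D w x0 v - L' x0 v (Y x0))"
      unfolding L'_def
      by (intro linear_compose_sub linw linear_compose_sum ballI linear_compose_scale_right linL')
    moreover have "linear (inv (L x0))" using inj_linear_imp_inv_linear lin inj x0 by blast
    ultimately have linY': "linear (Y' x0)"
      unfolding Y'_def[abs_def] using linear_compose[of _ "inv (L x0)"] by (simp add: o_def)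
    obtain B where B: "B > 0" "\<forall>\<^sub>F x in at x0. \<forall>v. B * norm v \<le> norm (L x v)"
      using linear_family_lower_bound[of S x0 L, OF S x0 lin inj[OF x0] Ck_on_continuous[OF Suc.prems(1)]] by blast
    have inS: "\<forall>\<^sub>F x in at x0. x \<in> S" using S x0 by (simp add: eventually_at_in_open')
    define R where "R x = w x - (\<Sum>b\<in>Basis. ((Y x0 + Y' x0 (x - x0)) \<bullet> b) *\<^sub>R L x b)" for x
    have Req: "R x = w x - L x (Y x0 + Y' x0 (x - x0))" if "x \<in> S" for x
      unfolding R_def linear_eq_sum_Basis[OF lin[OF that], symmetric] ..
    have dY': "(Y' x0 has_derivative Y' x0) (at z)" for z
      using linY' by (simp add: linear_imp_has_derivative)
    have dY'2: "((\<lambda>x. Y' x0 (x - x0)) has_derivative Y' x0) (at x0)"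
      using has_derivative_compose[OF has_derivative_diff[OF has_derivative_ident has_derivative_const] dY']
      by simp
    have "(R has_derivative (\<lambda>v. D w x0 v - (\<Sum>b\<in>Basis. ((Y x0 + Y' x0 (x0 - x0)) \<bullet> b) *\<^sub>R D (\<lambda>x. L x b) x0 v
          + ((0 + Y' x0 v) \<bullet> b) *\<^sub>R L x0 b))) (at x0)"
      unfolding R_def
      by (intro has_derivative_diff has_derivative_sum has_derivative_scaleR has_derivative_inner_left
          has_derivative_add has_derivative_const dY'2 Ck_on_has_derivative[OF Suc.prems(2) x0]
          Ck_on_has_derivative[OF Suc.prems(1) x0])
    moreover have "D w x0 v - (\<Sum>b\<in>Basis. ((Y x0 + Y' x0 (x0 - x0)) \<bullet> b) *\<^sub>R D (\<lambda>x. L x b) x0 v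
          + ((0 + Y' x0 v) \<bullet> b) *\<^sub>R L x0 b) = 0" for v
      using Y'eq[OF x0, of v] linear_0[OF linY'] linear_eq_sum_Basis[OF lin[OF x0], of "Y' x0 v"]
      by (simp add: L'_def sum.distrib)
    ultimately have dR: "(R has_derivative (\<lambda>v. 0)) (at x0)" by simp
    have R0: "R x0 = 0" using Req[OF x0] Suc.prems(3)[OF x0] linear_0[OF linY'] by simp
    have limR: "((\<lambda>x. norm (R x) / norm (x - x0) / B) \<longlongrightarrow> 0) (at x0)"
      using tendsto_divide[OF _ tendsto_const[of B], of "\<lambda>x. norm (R x) / norm (x - x0)" 0] B(1) dR R0
      unfolding has_derivative_iff_norm by simp
    have "\<forall>\<^sub>F x in at x0. norm (norm (Y x - Y x0 - Y' x0 (x - x0)) / norm (x - x0))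
        \<le> norm (R x) / norm (x - x0) / B"
      using B(2) inS
    proof eventually_elim
      case (elim x)
      have "B * norm (Y x - Y x0 - Y' x0 (x - x0)) \<le> norm (R x)"
        using elim(1)[rule_format, of "Y x - (Y x0 + Y' x0 (x - x0))"] Suc.prems(3)[OF elim(2)]
          linear_diff[OF lin[OF elim(2)], of "Y x" "Y x0 + Y' x0 (x - x0)"] Req[OF elim(2)]
        by (metis diff_diff_eq)
      then have "norm (Y x - Y x0 - Y' x0 (x - x0)) \<le> norm (R x) / B"
        using B(1) by (simp add: field_simps)
      from divide_right_mono[OF this norm_ge_zero[of "x - x0"]]
      show ?case by (simp add: divide_divide_eq_left mult.commute[of B])
    qed
    then have "((\<lambda>x. norm (Y x - Y x0 - Y' x0 (x - x0)) / norm (x - x0)) \<longlongrightarrow> 0) (at x0)"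
      by (rule Lim_null_comparison) (rule limR)
    then show ?thesis using linY' unfolding has_derivative_iff_norm
      by (simp add: linear_conv_bounded_linear)
  qed
  then show ?case using Y'k by (intro Ck_onI[OF S])
qed

subsection \<open>Symmetry of second derivatives\<close>

lemma has_derivative_line:
  assumes "(f has_derivative f') (at (a + t *\<^sub>R h))"
  shows "((\<lambda>s. f (a + s *\<^sub>R h)) has_derivative (\<lambda>s. f' (s *\<^sub>R h))) (at t)"
proof -
  have "((\<lambda>s. a + s *\<^sub>R h) has_derivative (\<lambda>s. 0 + s *\<^sub>R h)) (at t)"
    by (intro has_derivative_add has_derivative_const has_derivative_scaleR_left has_derivative_ident)
  then show ?thesis using has_derivative_compose assms by fastforce
qed

text \<open>Both mixed derivatives are limits of the same second difference quotient, by applying the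
  mean value theorem twice, in either order.\<close>

lemma second_difference_eq_D2:
  fixes f :: "'e::euclidean_space \<Rightarrow> real"
  assumes f: "Ck_on 2 S f" and t: "t > 0"
    and S: "\<And>a b. 0 \<le> a \<Longrightarrow> a \<le> t \<Longrightarrow> 0 \<le> b \<Longrightarrow> b \<le> t \<Longrightarrow> x + a *\<^sub>R h + b *\<^sub>R k \<in> S"
  shows "\<exists>a b. 0 \<le> a \<and> a \<le> t \<and> 0 \<le> b \<and> b \<le> t \<and>
    f (x + t *\<^sub>R h + t *\<^sub>R k) - f (x + t *\<^sub>R h) - f (x + t *\<^sub>R k) + f x
      = t * t * D (\<lambda>z. D f z h) (x + a *\<^sub>R h + b *\<^sub>R k) k"
proof -
  have f1: "Ck_on (Suc 1) S f" using f by (simp add: numeral_2_eq_2)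
  have f2: "Ck_on (Suc 0) S (\<lambda>z. D f z h)" using Ck_on_D[OF f1] by simp
  define G where "G a = f (x + t *\<^sub>R k + a *\<^sub>R h) - f (x + a *\<^sub>R h)" for a
  have dG: "(G has_derivative (\<lambda>s. D f (x + t *\<^sub>R k + a *\<^sub>R h) (s *\<^sub>R h) - D f (x + a *\<^sub>R h) (s *\<^sub>R h))) (at a)"
    if "0 \<le> a" "a \<le> t" for a
    unfolding G_def using S[of a 0] S[of a t] that t
    by (intro has_derivative_diff has_derivative_line Ck_on_has_derivative[OF f1]) (auto simp: algebra_simps)
  have "\<exists>a\<in>{0<..<t}. G t - G 0
      = D f (x + t *\<^sub>R k + a *\<^sub>R h) ((t - 0) *\<^sub>R h) - D f (x + a *\<^sub>R h) ((t - 0) *\<^sub>R h)"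
    by (rule mvt_simple[OF t]) (rule has_derivative_at_withinI, rule dG)
  then obtain a where a: "0 < a" "a < t"
    and Ga: "G t - G 0 = D f (x + t *\<^sub>R k + a *\<^sub>R h) (t *\<^sub>R h) - D f (x + a *\<^sub>R h) (t *\<^sub>R h)"
    by auto
  have "x + a *\<^sub>R h + 0 *\<^sub>R k \<in> S" "x + a *\<^sub>R h + t *\<^sub>R k \<in> S" using S a t by (simp_all add: less_imp_le del: scaleR_zero_left)
  then have lin: "linear (D f (x + a *\<^sub>R h))" "linear (D f (x + t *\<^sub>R k + a *\<^sub>R h))"
    using linear_D[OF f1] by (simp_all add: algebra_simps)
  have Ga': "G t - G 0 = t * (D f (x + a *\<^sub>R h + t *\<^sub>R k) h - D f (x + a *\<^sub>R h) h)"
    unfolding Ga using lin by (simp add: linear_cmul algebra_simps)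
  have dL: "((\<lambda>b. D f (x + a *\<^sub>R h + b *\<^sub>R k) h) has_derivative
      (\<lambda>s. D (\<lambda>z. D f z h) (x + a *\<^sub>R h + b *\<^sub>R k) (s *\<^sub>R k))) (at b)" if "0 \<le> b" "b \<le> t" for b
    using S[of a b] that a by (intro has_derivative_line[of "\<lambda>z. D f z h"] Ck_on_has_derivative[OF f2]) auto
  have "\<exists>b\<in>{0<..<t}. D f (x + a *\<^sub>R h + t *\<^sub>R k) h - D f (x + a *\<^sub>R h + 0 *\<^sub>R k) h
        = D (\<lambda>z. D f z h) (x + a *\<^sub>R h + b *\<^sub>R k) ((t - 0) *\<^sub>R k)"
    by (rule mvt_simple[OF t]) (rule has_derivative_at_withinI, rule dL)
  then obtain b where b: "0 < b" "b < t"
    and Lb: "D f (x + a *\<^sub>R h + t *\<^sub>R k) h - D f (x + a *\<^sub>R h) h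
        = D (\<lambda>z. D f z h) (x + a *\<^sub>R h + b *\<^sub>R k) (t *\<^sub>R k)"
    by auto
  have "x + a *\<^sub>R h + b *\<^sub>R k \<in> S" using S a b by simp
  then have "linear (D (\<lambda>z. D f z h) (x + a *\<^sub>R h + b *\<^sub>R k))" using linear_D[OF f2] by blast
  then have "G t - G 0 = t * (t * D (\<lambda>z. D f z h) (x + a *\<^sub>R h + b *\<^sub>R k) k)"
    using Ga' Lb by (simp add: linear_cmul)
  moreover have "G t - G 0 = f (x + t *\<^sub>R h + t *\<^sub>R k) - f (x + t *\<^sub>R h) - f (x + t *\<^sub>R k) + f x"
    by (simp add: G_def algebra_simps)
  ultimately show ?thesis using a b
    by (intro exI[of _ a] exI[of _ b]) simp
qed

lemma second_difference_tendsto: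
  fixes f :: "'e::euclidean_space \<Rightarrow> real"
  assumes f: "Ck_on 2 S f" and S: "open S" "x \<in> S"
  shows "((\<lambda>t. (f (x + t *\<^sub>R h + t *\<^sub>R k) - f (x + t *\<^sub>R h) - f (x + t *\<^sub>R k) + f x) / (t * t))
    \<longlongrightarrow> D (\<lambda>z. D f z h) x k) (at_right 0)"
proof (rule tendstoI)
  fix e :: real assume "e > 0"
  have "continuous_on S (\<lambda>z. D (\<lambda>z. D f z h) z k)" using f by (simp add: numeral_2_eq_2)
  then obtain d1 where d1: "d1 > 0"
      "\<And>z. z \<in> S \<Longrightarrow> dist z x < d1 \<Longrightarrow> dist (D (\<lambda>z. D f z h) z k) (D (\<lambda>z. D f z h) x k) < e"
    using S(2) \<open>e > 0\<close> unfolding continuous_on_iff by metis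
  obtain d2 where d2: "d2 > 0" "ball x d2 \<subseteq> S" using S by (meson openE)
  define d where "d = min d1 d2 / (norm h + norm k + 1)"
  have hk: "norm h + norm k + 1 > 0" by (simp add: add_nonneg_pos)
  have d0: "d > 0" using d1 d2 hk by (simp add: d_def)
  have near: "dist (x + a *\<^sub>R h + b *\<^sub>R k) x < min d1 d2"
    if "0 \<le> a" "a \<le> t" "0 \<le> b" "b \<le> t" "t < d" for a b t
  proof -
    have "dist (x + a *\<^sub>R h + b *\<^sub>R k) x \<le> norm (a *\<^sub>R h) + norm (b *\<^sub>R k)"
      using norm_triangle_ineq[of "a *\<^sub>R h" "b *\<^sub>R k"] by (simp add: dist_norm)
    also have "\<dots> \<le> d * norm h + d * norm k"
      using that by (simp add: add_mono mult_right_mono)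
    also have "\<dots> < d * (norm h + norm k + 1)" using d0 by (simp add: algebra_simps)
    also have "\<dots> = min d1 d2" using hk by (simp add: d_def)
    finally show ?thesis .
  qed
  have lim: "dist ((f (x + t *\<^sub>R h + t *\<^sub>R k) - f (x + t *\<^sub>R h) - f (x + t *\<^sub>R k) + f x) / (t * t))
      (D (\<lambda>z. D f z h) x k) < e" if t: "0 < t" "t < d" for t
  proof -
    have "x + a *\<^sub>R h + b *\<^sub>R k \<in> S" if "0 \<le> a" "a \<le> t" "0 \<le> b" "b \<le> t" for a b
      using near[OF that t(2)] d2(2) by (auto simp: dist_commute)
    from second_difference_eq_D2[OF f t(1) this]
    obtain a b where ab: "0 \<le> a" "a \<le> t" "0 \<le> b" "b \<le> t"
      and eq: "f (x + t *\<^sub>R h + t *\<^sub>R k) - f (x + t *\<^sub>R h) - f (x + t *\<^sub>R k) + f x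
        = t * t * D (\<lambda>z. D f z h) (x + a *\<^sub>R h + b *\<^sub>R k) k" by blast
    have "x + a *\<^sub>R h + b *\<^sub>R k \<in> S" "dist (x + a *\<^sub>R h + b *\<^sub>R k) x < d1"
      using d2(2) near[OF ab t(2)] by (auto simp: dist_commute)
    then show ?thesis unfolding eq using d1(2) t(1) by simp
  qed
  then show "\<forall>\<^sub>F t in at_right 0. dist ((f (x + t *\<^sub>R h + t *\<^sub>R k) - f (x + t *\<^sub>R h) - f (x + t *\<^sub>R k) + f x) / (t * t))
      (D (\<lambda>z. D f z h) x k) < e"
    unfolding eventually_at_right_field using d0 lim by blast
qed

lemma D_inner:
  assumes "f differentiable at x" shows "D (\<lambda>z. f z \<bullet> b) x h = D f x h \<bullet> b"
  using D_eq[OF has_derivative_inner_left[OF assms[unfolded frechet_derivative_works], of b]] by simp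

lemma D2_symmetric:
  fixes f :: "'e::euclidean_space \<Rightarrow> 'v::euclidean_space"
  assumes f: "Ck_on 2 S f" and S: "open S" "x \<in> S"
  shows "D (\<lambda>z. D f z h) x k = D (\<lambda>z. D f z k) x h"
proof (rule euclidean_eqI)
  fix b :: 'v assume "b \<in> Basis"
  have fd: "f differentiable at z" if "z \<in> S" for z using f that by (simp add: numeral_2_eq_2)
  have fd2: "(\<lambda>z. D f z h) differentiable at x" for h using f S by (simp add: numeral_2_eq_2)
  have fb: "Ck_on 2 S (\<lambda>z. f z \<bullet> b)" using Ck_on_inner[OF S(1) f Ck_on_const] .
  have *: "D (\<lambda>z. D (\<lambda>z. f z \<bullet> b) z h) x k = D (\<lambda>z. D f z h) x k \<bullet> b" for h k
  proof -
    have "D (\<lambda>z. D (\<lambda>z. f z \<bullet> b) z h) x = D (\<lambda>z. D f z h \<bullet> b) x"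
      by (rule D_cong[OF S]) (simp add: D_inner fd)
    then show ?thesis by (simp add: D_inner[OF fd2])
  qed
  have "D (\<lambda>z. D (\<lambda>z. f z \<bullet> b) z h) x k = D (\<lambda>z. D (\<lambda>z. f z \<bullet> b) z k) x h"
    using tendsto_unique[OF _ second_difference_tendsto[OF fb S, of h k], of "D (\<lambda>z. D (\<lambda>z. f z \<bullet> b) z k) x h"]
      second_difference_tendsto[OF fb S, of k h]
    by (simp add: algebra_simps)
  then show "D (\<lambda>z. D f z h) x k \<bullet> b = D (\<lambda>z. D f z k) x h \<bullet> b" by (simp add: *)
qed

subsection \<open>Smooth cut-off functions\<close>

text \<open>The derivatives of the flat function \<open>exp(-1/t)\<close> are linear combinations of the functions
  \<open>t\<^sup>-\<^sup>n exp(-1/t)\<close>; this family is closed under differentiation, which makes the induction on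
  the order of differentiability work.\<close>

definition flat_exp :: "nat \<Rightarrow> real \<Rightarrow> real" where
  "flat_exp n t = (if t > 0 then inverse t ^ n * exp (- inverse t) else 0)"

lemma flat_exp_tendsto_0: "(flat_exp n \<longlongrightarrow> 0) (at 0)"
proof -
  have "((\<lambda>t. inverse t ^ n / exp (inverse t)) \<longlongrightarrow> (0::real)) (at_right 0)"
    by (rule filterlim_compose[OF tendsto_power_div_exp_0 filterlim_inverse_at_top_right])
  then have "(flat_exp n \<longlongrightarrow> 0) (at_right 0)"
    by (rule Lim_transform_eventually)
      (auto simp: eventually_at_right_field flat_exp_def exp_minus field_simps intro!: exI[of _ 1])
  moreover have "(flat_exp n \<longlongrightarrow> 0) (at_left 0)"
    by (rule Lim_transform_eventually[OF tendsto_const])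
      (auto simp: eventually_at_left_field flat_exp_def intro!: exI[of _ "-1"])
  ultimately show ?thesis by (simp add: filterlim_split_at)
qed

lemma flat_exp_has_real_derivative:
  "(flat_exp n has_real_derivative flat_exp (n + 2) t - real n * flat_exp (n + 1) t) (at t)"
proof -
  consider "t > 0" | "t < 0" | "t = 0" by linarith
  then show ?thesis
  proof cases
    case 1
    have inv: "(inverse has_real_derivative - (inverse t)\<^sup>2) (at t)"
      using DERIV_inverse[of t] 1 by (simp add: power2_eq_square power_inverse)
    have d: "((\<lambda>t. inverse t ^ n * exp (- inverse t)) has_real_derivative
        (real n * (- (inverse t)\<^sup>2 * inverse t ^ (n - Suc 0))) * exp (- inverse t)
          + (exp (- inverse t) * - (- (inverse t)\<^sup>2)) * inverse t ^ n) (at t)"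
      by (intro DERIV_mult DERIV_power inv DERIV_chain2[OF DERIV_exp] DERIV_minus)
    have e: "real n * (- (inverse t)\<^sup>2 * inverse t ^ (n - Suc 0)) = - real n * inverse t ^ (n + 1)"
      by (cases n) (simp_all add: power2_eq_square algebra_simps)
    have "((\<lambda>t. inverse t ^ n * exp (- inverse t)) has_real_derivative
        flat_exp (n + 2) t - real n * flat_exp (n + 1) t) (at t)"
      using d[unfolded e] 1 by (simp add: flat_exp_def power2_eq_square mult_ac)
    then show ?thesis
      by (rule has_field_derivative_transform_within_open[of _ _ _ "{0<..}"])
        (use 1 in \<open>auto simp: flat_exp_def\<close>)
  next
    case 2
    have "((\<lambda>t. 0) has_real_derivative flat_exp (n + 2) t - real n * flat_exp (n + 1) t) (at t)"
      using 2 by (simp add: flat_exp_def)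
    then show ?thesis
      by (rule has_field_derivative_transform_within_open[of _ _ _ "{..<0}"])
        (use 2 in \<open>auto simp: flat_exp_def\<close>)
  next
    case 3
    have "(\<lambda>h. (flat_exp n (0 + h) - flat_exp n 0) / h) = flat_exp (n + 1)"
      by (auto simp: flat_exp_def fun_eq_iff field_simps)
    then show ?thesis using 3 flat_exp_tendsto_0[of "n + 1"]
      by (simp add: DERIV_def flat_exp_def)
  qed
qed

lemma Ck_on_flat_exp: "Ck_on k S (flat_exp n)"
proof (rule Ck_on_subset[OF _ subset_UNIV], induction k arbitrary: n)
  case 0
  show ?case using DERIV_isCont[OF flat_exp_has_real_derivative]
    by (simp add: continuous_on_eq_continuous_at)
next
  case (Suc k)
  have "Ck_on k UNIV (\<lambda>x. (flat_exp (n + 2) x + (- real n) * flat_exp (n + 1) x) * v)" for v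
    by (intro Ck_on_mult Ck_on_add Suc.IH Ck_on_const) auto
  then show ?case using flat_exp_has_real_derivative[of n]
    by (intro Ck_onI[where f' = "\<lambda>x v. (flat_exp (n + 2) x + (- real n) * flat_exp (n + 1) x) * v"])
      (simp_all add: has_field_derivative_def)
qed

text \<open>The quotient \<open>\<psi>(2 - u) / (\<psi>(2 - u) + \<psi>(u - 1))\<close> for \<open>\<psi>(t) = exp(-1/t)\<close>, \<open>t > 0\<close>, and
  \<open>u = \<parallel>x - a\<parallel>\<^sup>2 / r\<^sup>2\<close>: it is \<open>1\<close> where \<open>u \<le> 1\<close> and \<open>0\<close> where \<open>u \<ge> 2\<close>.\<close>

lemma plateau_exists:
  fixes a :: "'e::euclidean_space"
  assumes "r > 0"
  obtains \<beta> :: "'e \<Rightarrow> real" where "smooth_on UNIV \<beta>" "\<And>x. x \<in> ball a r \<Longrightarrow> \<beta> x = 1"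
    "\<And>x. x \<notin> cball a (2 * r) \<Longrightarrow> \<beta> x = 0"
proof -
  define u where "u x = ((x - a) \<bullet> (x - a)) / r\<^sup>2" for x
  define \<beta> where "\<beta> x = flat_exp 0 (2 - u x) / (flat_exp 0 (2 - u x) + flat_exp 0 (u x - 1))" for x
  have pos: "flat_exp 0 (2 - u x) + flat_exp 0 (u x - 1) > 0" for x
    by (auto simp: flat_exp_def add_pos_pos)
  have lin: "Ck_on k UNIV (\<lambda>x::'e. x + (- a))" for k
    by (intro Ck_on_add Ck_on_const Ck_on_linear[OF bounded_linear_ident]) auto
  have u: "Ck_on k UNIV u" for k
    unfolding u_def divide_inverse using lin
    by (intro Ck_on_mult Ck_on_inner Ck_on_const) auto
  have "Ck_on k UNIV (\<lambda>x. 2 + (-1) * u x)" "Ck_on k UNIV (\<lambda>x. u x + (-1))" for k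
    by (intro Ck_on_mult Ck_on_add u Ck_on_const; simp)+
  then have w: "Ck_on k UNIV (\<lambda>x. flat_exp 0 (2 - u x))" "Ck_on k UNIV (\<lambda>x. flat_exp 0 (u x - 1))" for k
    using Ck_on_compose[OF open_UNIV open_UNIV _ Ck_on_flat_exp, of k _ 0] by (force, force)
  have "Ck_on k UNIV \<beta>" for k
  proof (rule Ck_on_solve[where L = "\<lambda>x v. (flat_exp 0 (2 - u x) + flat_exp 0 (u x - 1)) * v"])
    show "inj (\<lambda>v. (flat_exp 0 (2 - u x) + flat_exp 0 (u x - 1)) * v)" for x
      using pos[of x] by (auto intro!: injI)
    show "Ck_on k UNIV (\<lambda>x. flat_exp 0 (2 - u x))" by (rule w)
    show "(flat_exp 0 (2 - u x) + flat_exp 0 (u x - 1)) * \<beta> x = flat_exp 0 (2 - u x)" for x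
      using pos[of x] by (simp add: \<beta>_def)
    show "Ck_on k UNIV (\<lambda>x. (flat_exp 0 (2 - u x) + flat_exp 0 (u x - 1)) * v)" for v
      by (intro Ck_on_mult Ck_on_add w Ck_on_const) auto
  qed (auto simp: linear_iff algebra_simps)
  then have "smooth_on UNIV \<beta>" by (simp add: smooth_on_def)
  moreover have "\<beta> x = 1" if "x \<in> ball a r" for x
  proof -
    have "norm (x - a) \<le> r" using that by (simp add: dist_norm norm_minus_commute)
    then have "(norm (x - a))\<^sup>2 \<le> r\<^sup>2" by (simp add: power_mono)
    then have "u x \<le> 1" using assms by (simp add: u_def power2_norm_eq_inner)
    then show ?thesis using pos[of x] by (simp add: \<beta>_def flat_exp_def)
  qed
  moreover have "\<beta> x = 0" if "x \<notin> cball a (2 * r)" for x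
  proof -
    have "norm (x - a) \<ge> 2 * r" using that by (simp add: dist_norm norm_minus_commute)
    then have "(2 * r)\<^sup>2 \<le> (norm (x - a))\<^sup>2" using assms by (intro power_mono) auto
    moreover have "2 * r\<^sup>2 \<le> (2 * r)\<^sup>2" by (simp add: power_mult_distrib)
    ultimately have "2 * r\<^sup>2 \<le> (x - a) \<bullet> (x - a)" using zero_le_power2[of r] by (simp only: power2_norm_eq_inner)
    then have "u x \<ge> 2" using assms by (simp add: u_def field_simps)
    then show ?thesis by (simp add: \<beta>_def flat_exp_def)
  qed
  ultimately show ?thesis using that by blast
qed

section \<open>Integration of commuting lifts\<close>

lemma onorm_le_sum_Basis:
  fixes f :: "'e::euclidean_space \<Rightarrow> 'v::real_normed_vector"
  assumes "linear f" shows "onorm f \<le> (\<Sum>b\<in>Basis. norm (f b))"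
proof (rule onorm_le)
  fix x
  have "norm (f x) \<le> (\<Sum>b\<in>Basis. norm (f b) * norm x)"
    unfolding linear_eq_sum_Basis[OF assms, of x]
    by (rule sum_norm_le) (simp add: Basis_le_norm mult.commute[of "norm (f _)"] mult_right_mono)
  then show "norm (f x) \<le> (\<Sum>b\<in>Basis. norm (f b)) * norm x" by (simp add: sum_distrib_right)
qed

lemma compact_continuous_bound:
  assumes "compact B" "continuous_on B (f :: 'a::topological_space \<Rightarrow> 'v::real_normed_vector)"
  obtains M where "M \<ge> 0" "\<And>x. x \<in> B \<Longrightarrow> norm (f x) \<le> M"
proof -
  have "bounded (f ` B)" using assms by (simp add: compact_continuous_image compact_imp_bounded)
  then obtain M where "\<And>x. x \<in> B \<Longrightarrow> norm (f x) \<le> M" by (auto simp: bounded_iff)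
  then show ?thesis using that[of "max M 0"] by (simp add: le_max_iff_disj)
qed

lemma C1_lipschitz:
  assumes f: "Ck_on (Suc 0) S f" and B: "compact B" "convex B" "B \<subseteq> S"
  obtains K where "K \<ge> 0" "\<And>x y. x \<in> B \<Longrightarrow> y \<in> B \<Longrightarrow> norm (f x - f y) \<le> K * norm (x - y)"
proof -
  have "continuous_on B (\<lambda>x. \<Sum>b\<in>Basis. norm (D f x b))"
    using f B(3) by (intro continuous_intros) (auto intro: continuous_on_subset)
  then obtain K where K: "K \<ge> 0" "\<And>x. x \<in> B \<Longrightarrow> norm (\<Sum>b\<in>Basis. norm (D f x b)) \<le> K"
    using compact_continuous_bound[OF B(1)] by blast
  have "norm (f x - f y) \<le> K * norm (x - y)" if "x \<in> B" "y \<in> B" for x y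
  proof (rule differentiable_bound[OF B(2)])
    fix z assume "z \<in> B"
    then have z: "z \<in> S" using B by auto
    show "(f has_derivative D f z) (at z within B)"
      using Ck_on_has_derivative[OF f z] by (rule has_derivative_at_withinI)
    show "onorm (D f z) \<le> K"
      using onorm_le_sum_Basis[OF linear_D[OF f z]] K(2)[OF \<open>z \<in> B\<close>] by simp
  qed (use that in auto)
  with K(1) that show ?thesis by blast
qed

lemma C2_taylor:
  assumes f: "Ck_on 2 S f" and B: "compact B" "convex B" "B \<subseteq> S"
  obtains K where "K \<ge> 0"
    "\<And>x y. x \<in> B \<Longrightarrow> y \<in> B \<Longrightarrow> norm (f y - f x - D f x (y - x)) \<le> K * (norm (y - x))\<^sup>2"
proof -
  have f1: "Ck_on (Suc 0) S f" using f unfolding numeral_2_eq_2 by (rule Ck_on_Suc_D)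
  have "\<exists>K\<ge>0. \<forall>x\<in>B. \<forall>y\<in>B. norm (D f x b - D f y b) \<le> K * norm (x - y)" for b
    by (rule C1_lipschitz[OF Ck_on_D[OF f[unfolded numeral_2_eq_2]] B, of b]) blast
  then have "\<exists>k. \<forall>b. k b \<ge> 0 \<and> (\<forall>x\<in>B. \<forall>y\<in>B. norm (D f x b - D f y b) \<le> k b * norm (x - y))"
    by (intro choice allI)
  then obtain k where k: "\<And>b. k b \<ge> 0"
    "\<And>b x y. x \<in> B \<Longrightarrow> y \<in> B \<Longrightarrow> norm (D f x b - D f y b) \<le> k b * norm (x - y)" by blast
  define K where "K = (\<Sum>b\<in>Basis. k b)"
  have "norm (f y - f x - D f x (y - x)) \<le> norm (y - x) * (K * norm (y - x))" if x: "x \<in> B" and y: "y \<in> B" for x y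
  proof (rule differentiable_bound_linearization[where f' = "D f" and S = "closed_segment x y"])
    have sub: "closed_segment x y \<subseteq> B" by (rule closed_segment_subset[OF x y B(2)])
    show "x + t *\<^sub>R (y - x) \<in> closed_segment x y" if "t \<in> {0..1}" for t
      unfolding in_segment using that by (intro exI[of _ t]) (simp add: algebra_simps)
    show "(f has_derivative D f z) (at z within closed_segment x y)" if "z \<in> closed_segment x y" for z
      by (rule has_derivative_at_withinI[OF Ck_on_has_derivative[OF f1]]) (use sub B(3) that in blast)
    show "onorm (D f z - D f x) \<le> K * norm (y - x)" if z: "z \<in> closed_segment x y" for z
    proof -
      have zB: "z \<in> B" using z sub by auto
      have "linear (D f z - D f x)"
        unfolding fun_diff_def
        by (rule linear_compose_sub[OF linear_D[OF f1, of z] linear_D[OF f1, of x]]) (use zB x B(3) in auto)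
      from onorm_le_sum_Basis[OF this]
      have "onorm (D f z - D f x) \<le> (\<Sum>b\<in>Basis. norm (D f z b - D f x b))" by simp
      also have "\<dots> \<le> (\<Sum>b\<in>Basis. k b * norm (z - x))" by (intro sum_mono k zB x)
      also have "\<dots> = K * norm (z - x)" by (simp add: K_def sum_distrib_right)
      also have "\<dots> \<le> K * norm (y - x)"
        using k(1) segment_bound1[OF z] by (intro mult_left_mono) (auto simp: K_def sum_nonneg)
      finally show ?thesis .
    qed
  qed simp
  then have "norm (f y - f x - D f x (y - x)) \<le> K * (norm (y - x))\<^sup>2" if "x \<in> B" "y \<in> B" for x y
    using that by (simp add: power2_eq_square mult_ac)
  moreover have "K \<ge> 0" by (simp add: K_def k(1) sum_nonneg)
  ultimately show ?thesis using that by blast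
qed

text \<open>The differential equation is \<open>d/dt u(t y) = W(u(t y)) y\<close>, \<open>u(0) = x0\<close>, for all \<open>y\<close> in a small
  ball at once, and \<open>u\<close> is the fixed point of \<open>u \<mapsto> (y \<mapsto> x0 + \<integral>\<^sub>0\<^sup>1 W(u(t y)) y dt)\<close>, which contracts
  the bounded continuous functions.  Retracting the argument \<open>y\<close> to the ball makes the operator
  act on functions of the whole space.\<close>

lemma radial_solution:
  fixes W :: "'e::euclidean_space \<Rightarrow> 'f::euclidean_space \<Rightarrow> 'e"
  assumes lin: "\<And>x. linear (W x)"
    and M: "\<And>x v. norm (W x v) \<le> M * norm v"
    and K: "\<And>x y v. norm (W x v - W y v) \<le> K * norm (x - y) * norm v" "K \<ge> 0"
    and r: "r > 0" "K * r \<le> 1 / 2"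
  obtains u where "continuous_on UNIV u" "u 0 = x0" "\<And>y. norm (u y - x0) \<le> M * r"
    "\<And>y t. y \<in> cball 0 r \<Longrightarrow> t \<in> {0..1} \<Longrightarrow>
       ((\<lambda>t. u (t *\<^sub>R y)) has_vector_derivative W (u (t *\<^sub>R y)) y) (at t within {0..1})"
proof -
  have M0: "M \<ge> 0"
    using order_trans[OF norm_ge_zero M[of x0 "SOME b. b \<in> Basis"]] by (simp add: some_in_eq)
  have contW: "continuous_on UNIV (\<lambda>x. W x v)" for v
  proof (rule lipschitz_on_continuous_on)
    show "(K * norm v)-lipschitz_on UNIV (\<lambda>x. W x v)"
      using K by (intro lipschitz_onI) (auto simp: dist_norm mult_ac)
  qed
  have contW2: "continuous_on A (\<lambda>a. W (p a) (q a))"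
    if p: "continuous_on A p" and q: "continuous_on A q" for A and p :: "'g::topological_space \<Rightarrow> 'e" and q
    unfolding linear_eq_sum_Basis[OF lin, of _ "q _"]
    by (intro continuous_intros p q continuous_on_compose2[OF contW]) auto
  define \<rho> where "\<rho> = closest_point (cball (0::'f) r)"
  have cb: "convex (cball (0::'f) r)" "closed (cball (0::'f) r)" "cball (0::'f) r \<noteq> {}" using r by auto
  have \<rho>c: "continuous_on UNIV \<rho>" unfolding \<rho>_def using cb by (rule continuous_on_closest_point)
  have \<rho>in: "norm (\<rho> y) \<le> r" for y
    using closest_point_in_set[OF cb(2,3), of y] by (simp add: \<rho>_def)
  have \<rho>id: "\<rho> y = y" if "y \<in> cball 0 r" for y using that by (simp add: \<rho>_def closest_point_self)
  define \<Phi> where "\<Phi> u y = x0 + integral {0..1} (\<lambda>t. W (u (t *\<^sub>R \<rho> y)) (\<rho> y))" for u y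
  have cont1: "continuous_on {0..1} (\<lambda>t. W (u (t *\<^sub>R z)) z)" if "continuous_on UNIV u" for u z
    by (intro contW2 continuous_on_compose2[OF that] continuous_intros) auto
  have \<Phi>c: "continuous_on UNIV (\<Phi> u)" if "continuous_on UNIV u" for u
  proof -
    have "continuous_on (UNIV \<times> cbox 0 1) (\<lambda>(y, t::real). W (u (t *\<^sub>R \<rho> y)) (\<rho> y))"
      unfolding case_prod_beta
      by (intro contW2 continuous_on_compose2[OF that] continuous_on_compose2[OF \<rho>c] continuous_intros) auto
    from integral_continuous_on_param[OF this]
    show ?thesis unfolding \<Phi>_def by (intro continuous_intros) simp
  qed
  have \<Phi>b: "norm (\<Phi> u y - x0) \<le> M * r" if "continuous_on UNIV u" for u y
  proof -
    have "norm (integral {0..1} (\<lambda>t. W (u (t *\<^sub>R \<rho> y)) (\<rho> y))) \<le> (M * r) * (1 - 0)"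
      using M M0 \<rho>in[of y] by (intro integral_bound cont1 that) (auto intro: order_trans[OF M] mult_left_mono)
    then show ?thesis by (simp add: \<Phi>_def)
  qed
  have \<Phi>B: "\<Phi> u \<in> bcontfun" if "continuous_on UNIV u" for u
  proof (rule bcontfun_normI[OF \<Phi>c[OF that]])
    fix y show "norm (\<Phi> u y) \<le> M * r + norm x0"
      using \<Phi>b[OF that, of y] norm_triangle_sub[of "\<Phi> u y" x0] by simp
  qed
  define \<Psi> where "\<Psi> U = Bcontfun (\<Phi> (apply_bcontfun U))" for U
  have Uc: "continuous_on UNIV (apply_bcontfun U)" for U :: "'f \<Rightarrow>\<^sub>C 'e" by simp
  have \<Psi>: "apply_bcontfun (\<Psi> U) = \<Phi> (apply_bcontfun U)" for U
    unfolding \<Psi>_def by (rule Bcontfun_inverse[OF \<Phi>B[OF Uc]])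
  have "dist (\<Psi> U) (\<Psi> V) \<le> 1 / 2 * dist U V" for U V
  proof (rule dist_bound)
    fix y
    have "norm (\<Phi> (apply_bcontfun U) y - \<Phi> (apply_bcontfun V) y)
      = norm (integral {0..1} (\<lambda>t. W (apply_bcontfun U (t *\<^sub>R \<rho> y)) (\<rho> y) - W (apply_bcontfun V (t *\<^sub>R \<rho> y)) (\<rho> y)))"
      unfolding \<Phi>_def
      by (subst integral_diff) (auto intro!: integrable_continuous_real cont1[OF Uc])
    also have "\<dots> \<le> (1 / 2 * dist U V) * (1 - 0)"
    proof (intro integral_bound continuous_on_diff cont1[OF Uc])
      fix t :: real
      have "norm (W (apply_bcontfun U (t *\<^sub>R \<rho> y)) (\<rho> y) - W (apply_bcontfun V (t *\<^sub>R \<rho> y)) (\<rho> y))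
        \<le> K * norm (apply_bcontfun U (t *\<^sub>R \<rho> y) - apply_bcontfun V (t *\<^sub>R \<rho> y)) * norm (\<rho> y)" by (rule K)
      also have "\<dots> \<le> K * dist U V * r"
        using \<rho>in[of y] K(2) dist_bounded[of U "t *\<^sub>R \<rho> y" V]
        by (intro mult_mono) (auto simp: dist_norm[symmetric])
      also have "\<dots> \<le> 1 / 2 * dist U V" using mult_right_mono[OF r(2), of "dist U V"] by (simp add: mult_ac)
      finally show "norm (W (apply_bcontfun U (t *\<^sub>R \<rho> y)) (\<rho> y) - W (apply_bcontfun V (t *\<^sub>R \<rho> y)) (\<rho> y))
        \<le> 1 / 2 * dist U V" .
    qed simp
    finally show "dist (apply_bcontfun (\<Psi> U) y) (apply_bcontfun (\<Psi> V) y) \<le> 1 / 2 * dist U V"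
      by (simp add: \<Psi> dist_norm)
  qed
  then have "\<exists>!U. \<Psi> U = U" by (intro banach_fix_type[of "1/2"]) auto
  then obtain U where U: "\<Psi> U = U" by blast
  define u where "u = apply_bcontfun U"
  have uc: "continuous_on UNIV u" by (simp add: u_def)
  have u: "\<Phi> u y = u y" for y using \<Psi>[of U] U by (simp add: u_def)
  have "\<Phi> u 0 = x0" using \<rho>id[of 0] r linear_0[OF lin] unfolding \<Phi>_def by simp
  then have 1: "u 0 = x0" by (simp only: u)
  have 2: "norm (u y - x0) \<le> M * r" for y using \<Phi>b[OF uc, of y] by (simp only: u)
  have 3: "((\<lambda>t. u (t *\<^sub>R y)) has_vector_derivative W (u (t *\<^sub>R y)) y) (at t within {0..1})"
    if y: "y \<in> cball 0 r" and t: "t \<in> {0..1}" for y t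
  proof -
    define G where "G s = integral {0..s} (\<lambda>t. W (u (t *\<^sub>R y)) y)" for s
    have G: "(G has_vector_derivative W (u (s *\<^sub>R y)) y) (at s within {0..1})" if "s \<in> {0..1}" for s
      unfolding G_def by (rule integral_has_vector_derivative[OF cont1[OF uc] that])
    have eq: "u (s *\<^sub>R y) = x0 + G s" if s: "s \<in> {0..1}" for s
    proof -
      have "norm (s *\<^sub>R y) \<le> r" using s y mult_mono[of "\<bar>s\<bar>" 1 "norm y" r] by auto
      then have "\<Phi> u (s *\<^sub>R y) = x0 + integral {0..1} (\<lambda>t. W (u (t *\<^sub>R s *\<^sub>R y)) (s *\<^sub>R y))"
        using \<rho>id[of "s *\<^sub>R y"] unfolding \<Phi>_def by simp
      then have "u (s *\<^sub>R y) = x0 + integral {0..1} (\<lambda>t. W (u (t *\<^sub>R s *\<^sub>R y)) (s *\<^sub>R y))"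
        by (simp only: u)
      also have "integral {0..1} (\<lambda>t. W (u (t *\<^sub>R s *\<^sub>R y)) (s *\<^sub>R y)) = G (1 * s) - G (0 * s)"
      proof (rule integral_unique, rule fundamental_theorem_of_calculus)
        fix \<tau> :: real assume \<tau>: "\<tau> \<in> {0..1}"
        have im: "(\<lambda>\<tau>. \<tau> * s) ` {0..1} \<subseteq> {0..1}" using s by (auto simp: mult_le_one)
        have "\<tau> * s \<in> {0..1}" using im \<tau> by blast
        then have "(G has_vector_derivative W (u ((\<tau> * s) *\<^sub>R y)) y) (at (\<tau> * s) within (\<lambda>\<tau>. \<tau> * s) ` {0..1})"
          by (rule has_vector_derivative_within_subset[OF G im])
        moreover have "((\<lambda>\<tau>. \<tau> * s) has_vector_derivative s) (at \<tau> within {0..1})"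
          by (auto intro!: derivative_eq_intros)
        ultimately have "((G \<circ> (\<lambda>\<tau>. \<tau> * s)) has_vector_derivative s *\<^sub>R W (u ((\<tau> * s) *\<^sub>R y)) y) (at \<tau> within {0..1})"
          by (intro vector_diff_chain_within)
        then show "((\<lambda>\<tau>. G (\<tau> * s)) has_vector_derivative W (u (\<tau> *\<^sub>R s *\<^sub>R y)) (s *\<^sub>R y)) (at \<tau> within {0..1})"
          by (simp add: o_def linear_cmul[OF lin])
      qed simp
      finally show ?thesis by (simp add: G_def)
    qed
    have "((\<lambda>s. x0 + G s) has_vector_derivative 0 + W (u (t *\<^sub>R y)) y) (at t within {0..1})"
      by (intro has_vector_derivative_add has_vector_derivative_const G t)
    then show ?thesis
      by (intro has_vector_derivative_transform[OF t, of "\<lambda>t. u (t *\<^sub>R y)" "\<lambda>s. x0 + G s"]) (simp_all add: eq)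
  qed
  show ?thesis by (rule that[OF uc 1 2 3])
qed

text \<open>Bounds on basis vectors give bounds on all vectors, uniformly in the parameter \<open>i\<close>.\<close>

lemma linear_family_bound:
  fixes L :: "'i \<Rightarrow> 'f::euclidean_space \<Rightarrow> 'v::real_normed_vector"
  assumes "\<And>i. i \<in> I \<Longrightarrow> linear (L i)" "\<And>i b. i \<in> I \<Longrightarrow> b \<in> Basis \<Longrightarrow> norm (L i b) \<le> k b * c i"
    and "i \<in> I"
  shows "norm (L i v) \<le> (\<Sum>b\<in>Basis. k b) * c i * norm v"
proof -
  have "norm (L i v) \<le> (\<Sum>b\<in>Basis. norm v * (k b * c i))"
    unfolding linear_eq_sum_Basis[OF assms(1)[OF assms(3)], of v]
    by (rule sum_norm_le) (auto intro!: mult_mono assms simp: Basis_le_norm)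
  then show ?thesis by (simp add: sum_distrib_left sum_distrib_right mult_ac)
qed

lemma has_derivative_quadratic_bound:
  fixes u :: "'f::euclidean_space \<Rightarrow> 'v::euclidean_space"
  assumes "linear u'" "open B" "y \<in> B" "C \<ge> 0"
    and bd: "\<And>z. z \<in> B \<Longrightarrow> norm (u z - u y - u' (z - y)) \<le> C * (norm (z - y))\<^sup>2"
  shows "(u has_derivative u') (at y)"
  unfolding has_derivative_at_alt
proof (intro conjI allI impI)
  show "bounded_linear u'" using assms(1) by (simp add: linear_conv_bounded_linear)
  fix e :: real assume "e > 0"
  obtain d where d: "d > 0" "ball y d \<subseteq> B" using assms(2,3) by (meson openE)
  show "\<exists>d>0. \<forall>z. norm (z - y) < d \<longrightarrow> norm (u z - u y - u' (z - y)) \<le> e * norm (z - y)"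
  proof (intro exI[of _ "min d (e / (C + 1))"] conjI allI impI)
    show "min d (e / (C + 1)) > 0" using d \<open>e > 0\<close> assms(4) by simp
    fix z assume z: "norm (z - y) < min d (e / (C + 1))"
    then have "z \<in> B" using d(2) by (auto simp: dist_norm norm_minus_commute)
    have "norm (z - y) * (C + 1) \<le> e" using z assms(4) by (simp add: field_simps)
    moreover have "C * norm (z - y) \<le> norm (z - y) * (C + 1)" by (simp add: algebra_simps)
    ultimately have "C * norm (z - y) \<le> e" by simp
    then have "C * (norm (z - y))\<^sup>2 \<le> e * norm (z - y)"
      using mult_right_mono[of "C * norm (z - y)" e "norm (z - y)"] by (simp add: power2_eq_square mult_ac)
    then show "norm (u z - u y - u' (z - y)) \<le> e * norm (z - y)" using bd[OF \<open>z \<in> B\<close>] by linarith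
  qed
qed

text \<open>A contraction argument in place of Gronwall's inequality: at a maximum of \<open>\<parallel>w\<parallel>\<close> the mean value
  inequality bounds \<open>\<parallel>w\<parallel>\<close> by half of itself plus \<open>c\<close>.\<close>

lemma vanishing_start_bound:
  fixes w :: "real \<Rightarrow> 'v::euclidean_space"
  assumes w: "\<And>t. t \<in> {0..1} \<Longrightarrow> (w has_vector_derivative w' t) (at t within {0..1})" "w 0 = 0"
    and bd: "\<And>t. t \<in> {0..1} \<Longrightarrow> norm (w' t) \<le> 1 / 2 * norm (w t) + c"
  shows "norm (w 1) \<le> 2 * c"
proof -
  have "continuous_on {0..1} w" 
    using has_vector_derivative_continuous[OF w(1)] by (simp add: continuous_on_eq_continuous_within)
  then have "continuous_on {0..1} (\<lambda>t. norm (w t))" by (intro continuous_intros)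
  then obtain t0 where t0: "t0 \<in> {0..1}" "\<And>t. t \<in> {0..1} \<Longrightarrow> norm (w t) \<le> norm (w t0)"
    using continuous_attains_sup[of "{0..1::real}" "\<lambda>t. norm (w t)"] by auto
  have c: "0 \<le> 1 / 2 * norm (w t0) + c" using order_trans[OF norm_ge_zero bd[OF t0(1)]] .
  have "norm (w t0 - w 0) \<le> (1 / 2 * norm (w t0) + c) * norm (t0 - 0)"
  proof (rule differentiable_bound[of "{0..1}" w "\<lambda>t s. s *\<^sub>R w' t"])
    show "(w has_derivative (\<lambda>s. s *\<^sub>R w' t)) (at t within {0..1})" if "t \<in> {0..1}" for t
      using w(1)[OF that] by (simp add: has_vector_derivative_def)
    show "onorm (\<lambda>s. s *\<^sub>R w' t) \<le> 1 / 2 * norm (w t0) + c" if "t \<in> {0..1}" for t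
    proof (rule onorm_le)
      fix s :: real
      have "norm (w' t) \<le> 1 / 2 * norm (w t0) + c" using bd[OF that] t0(2)[OF that] by linarith
      then show "norm (s *\<^sub>R w' t) \<le> (1 / 2 * norm (w t0) + c) * norm s"
        using mult_right_mono[of _ _ "norm s"] by (simp only: norm_scaleR real_norm_def mult.commute[of "\<bar>s\<bar>"] abs_ge_zero)
    qed
  qed (use t0 in auto)
  also have "\<dots> \<le> (1 / 2 * norm (w t0) + c) * 1" using t0(1) c by (intro mult_left_mono) auto
  finally have "norm (w t0) \<le> 2 * c" using w(2) by simp
  then show ?thesis using t0(2)[of 1] by simp
qed

text \<open>If the \<open>\<omega>(\<cdot>) a\<close> commute pairwise, then through each point there is a map \<open>u\<close> with
  \<open>du(y) = \<omega>(u(y))\<close>.  Take for \<open>u\<close> the solution along rays.  For its derivative at \<open>y\<close> compare,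
  along the ray through \<open>y + h\<close>, the solution \<open>u(t(y + h))\<close> with the curve
  \<open>u(t y) + t \<omega>(u(t y)) h\<close>: by the symmetry of \<open>D\<omega>(\<omega> a) b\<close> in \<open>a\<close> and \<open>b\<close> the latter satisfies
  the same differential equation up to an error \<open>O(\<parallel>h\<parallel>\<^sup>2)\<close>.\<close>

theorem commuting_lifts_integrable:
  fixes \<omega> :: "'e::euclidean_space \<Rightarrow> 'f::euclidean_space \<Rightarrow> 'e"
  assumes S: "open S" "x0 \<in> S" and lin: "\<And>x. x \<in> S \<Longrightarrow> linear (\<omega> x)"
    and sm: "\<And>k v. Ck_on k S (\<lambda>x. \<omega> x v)"
    and comm: "\<And>x a b. x \<in> S \<Longrightarrow> D (\<lambda>x. \<omega> x b) x (\<omega> x a) = D (\<lambda>x. \<omega> x a) x (\<omega> x b)"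
  obtains r u where "r > 0" "u 0 = x0" "u ` ball 0 r \<subseteq> S" "smooth_on (ball 0 r) u"
    "\<And>y. y \<in> ball 0 r \<Longrightarrow> (u has_derivative \<omega> (u y)) (at y)"
proof -
  obtain R where R: "R > 0" "cball x0 R \<subseteq> S" using S by (meson open_contains_cball)
  define B where "B = cball x0 R"
  have B: "compact B" "convex B" "B \<subseteq> S" "closed B" "B \<noteq> {}" using R by (auto simp: B_def)
  have linB: "linear (\<omega> x)" if "x \<in> B" for x using lin B that by auto
  have \<omega>1: "Ck_on (Suc 0) S (\<lambda>x. \<omega> x v)" for v by (rule sm)
  have "\<exists>m\<ge>0. \<forall>x\<in>B. norm (\<omega> x b) \<le> m" for b
    by (rule compact_continuous_bound[OF B(1) continuous_on_subset[OF Ck_on_continuous[OF sm] B(3)], of b]) blast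
  then have "\<exists>m. \<forall>b. m b \<ge> 0 \<and> (\<forall>x\<in>B. norm (\<omega> x b) \<le> m b)" by (intro choice allI)
  then obtain m where m: "\<And>b. m b \<ge> 0" "\<And>b x. x \<in> B \<Longrightarrow> norm (\<omega> x b) \<le> m b" by blast
  have "\<exists>k\<ge>0. \<forall>x\<in>B. \<forall>y\<in>B. norm (\<omega> x b - \<omega> y b) \<le> k * norm (x - y)" for b
    by (rule C1_lipschitz[OF \<omega>1 B(1-3), of b]) blast
  then have "\<exists>k. \<forall>b. k b \<ge> 0 \<and> (\<forall>x\<in>B. \<forall>y\<in>B. norm (\<omega> x b - \<omega> y b) \<le> k b * norm (x - y))"
    by (intro choice allI)
  then obtain k where k: "\<And>b. k b \<ge> 0" "\<And>b x y. x \<in> B \<Longrightarrow> y \<in> B \<Longrightarrow> norm (\<omega> x b - \<omega> y b) \<le> k b * norm (x - y)"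
    by blast
  have "\<exists>k\<ge>0. \<forall>x\<in>B. \<forall>y\<in>B. norm (\<omega> y b - \<omega> x b - D (\<lambda>x. \<omega> x b) x (y - x)) \<le> k * (norm (y - x))\<^sup>2" for b
    by (rule C2_taylor[OF sm B(1-3), of b]) blast
  then have "\<exists>l. \<forall>b. l b \<ge> 0 \<and> (\<forall>x\<in>B. \<forall>y\<in>B. norm (\<omega> y b - \<omega> x b - D (\<lambda>x. \<omega> x b) x (y - x)) \<le> l b * (norm (y - x))\<^sup>2)"
    by (intro choice allI)
  then obtain l where l: "\<And>b. l b \<ge> 0"
    "\<And>b x y. x \<in> B \<Longrightarrow> y \<in> B \<Longrightarrow> norm (\<omega> y b - \<omega> x b - D (\<lambda>x. \<omega> x b) x (y - x)) \<le> l b * (norm (y - x))\<^sup>2"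
    by blast
  define M K Q where "M = (\<Sum>b\<in>Basis. m b)" "K = (\<Sum>b\<in>Basis. k b)" "Q = (\<Sum>b\<in>Basis. l b)"
  note MKQ = M_K_Q_def
  have M0: "M \<ge> 0" and K0: "K \<ge> 0" and Q0: "Q \<ge> 0" using m k l by (auto simp: MKQ sum_nonneg)
  have M: "norm (\<omega> x v) \<le> M * norm v" if "x \<in> B" for x v
    using linear_family_bound[of B \<omega> m "\<lambda>_. 1" x v] linB m that by (simp add: MKQ)
  have K: "norm (\<omega> x v - \<omega> y v) \<le> K * norm (x - y) * norm v" if "x \<in> B" "y \<in> B" for x y v
    using linear_family_bound[of "B \<times> B" "\<lambda>(x, y) v. \<omega> x v - \<omega> y v" k "\<lambda>(x, y). norm (x - y)" "(x, y)" v]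
      linear_compose_sub[OF linB linB] k that by (auto simp: MKQ)
  have linD: "linear (\<lambda>v. D (\<lambda>x. \<omega> x v) x a)" if "x \<in> B" for x a
  proof (rule linearI)
    have xS: "x \<in> S" using that B by auto
    note d = Ck_on_has_derivative[OF \<omega>1 xS]
    fix v w c
    have "((\<lambda>x. \<omega> x (v + w)) has_derivative (\<lambda>a. D (\<lambda>x. \<omega> x v) x a + D (\<lambda>x. \<omega> x w) x a)) (at x)"
      by (rule has_derivative_transform_within_open[OF has_derivative_add[OF d d] S(1) xS])
        (simp add: linear_add[OF lin])
    then show "D (\<lambda>x. \<omega> x (v + w)) x a = D (\<lambda>x. \<omega> x v) x a + D (\<lambda>x. \<omega> x w) x a" by (simp add: D_eq)
    have "((\<lambda>x. \<omega> x (c *\<^sub>R v)) has_derivative (\<lambda>a. c *\<^sub>R D (\<lambda>x. \<omega> x v) x a)) (at x)"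
      by (rule has_derivative_transform_within_open[OF has_derivative_scaleR_right[OF d] S(1) xS])
        (simp add: linear_cmul[OF lin])
    then show "D (\<lambda>x. \<omega> x (c *\<^sub>R v)) x a = c *\<^sub>R D (\<lambda>x. \<omega> x v) x a" by (simp add: D_eq)
  qed
  have Q: "norm (\<omega> y v - \<omega> x v - D (\<lambda>x. \<omega> x v) x (y - x)) \<le> Q * (norm (y - x))\<^sup>2 * norm v"
    if "x \<in> B" "y \<in> B" for x y v
    using linear_family_bound[of "B \<times> B" "\<lambda>(x, y) v. \<omega> y v - \<omega> x v - D (\<lambda>x. \<omega> x v) x (y - x)" l
        "\<lambda>(x, y). (norm (y - x))\<^sup>2" "(x, y)" v]
      linear_compose_sub[OF linear_compose_sub[OF linB linB] linD] l that by (auto simp: MKQ)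
  define r where "r = min (R / (3 * M + 1)) (1 / (2 * K + 1))"
  have r0: "r > 0" using R M0 K0 by (simp add: r_def)
  have rM: "3 * (M * r) \<le> R"
  proof -
    have "r \<le> R / (3 * M + 1)" by (simp add: r_def)
    then have "r * (3 * M + 1) \<le> R" using M0 by (simp add: field_simps)
    then show ?thesis using r0 by (simp add: algebra_simps)
  qed
  have rK: "K * r \<le> 1 / 2"
  proof -
    have "r \<le> 1 / (2 * K + 1)" by (simp add: r_def)
    then have "r * (2 * K + 1) \<le> 1" using K0 by (simp add: field_simps)
    then show ?thesis using r0 by (simp add: algebra_simps)
  qed
  define \<pi> where "\<pi> = closest_point B"
  have \<pi>B: "\<pi> x \<in> B" for x unfolding \<pi>_def by (rule closest_point_in_set[OF B(4,5)])
  have \<pi>l: "norm (\<pi> x - \<pi> y) \<le> norm (x - y)" for x y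
    using closest_point_lipschitz[OF B(2,4,5), of x y] by (simp add: \<pi>_def dist_norm)
  have \<pi>id: "\<pi> x = x" if "x \<in> B" for x using that by (simp add: \<pi>_def closest_point_self)
  have KW: "norm (\<omega> (\<pi> x) v - \<omega> (\<pi> y) v) \<le> K * norm (x - y) * norm v" for x y v
    using K[OF \<pi>B \<pi>B, of x v y] mult_right_mono[OF mult_left_mono[OF \<pi>l K0, of x y] norm_ge_zero[of v]]
    by linarith
  obtain u where uc: "continuous_on UNIV u" and u0: "u 0 = x0" and ub: "\<And>y. norm (u y - x0) \<le> M * r"
    and ud: "\<And>y t. y \<in> cball 0 r \<Longrightarrow> t \<in> {0..1} \<Longrightarrow>
       ((\<lambda>t. u (t *\<^sub>R y)) has_vector_derivative \<omega> (\<pi> (u (t *\<^sub>R y))) y) (at t within {0..1})"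
  proof (rule radial_solution[of "\<lambda>x. \<omega> (\<pi> x)" M K r x0])
    show "linear (\<omega> (\<pi> x))" for x by (rule linB[OF \<pi>B])
    show "norm (\<omega> (\<pi> x) v) \<le> M * norm v" for x v by (rule M[OF \<pi>B])
    show "norm (\<omega> (\<pi> x) v - \<omega> (\<pi> y) v) \<le> K * norm (x - y) * norm v" for x y v by (rule KW)
    show "K \<ge> 0" "r > 0" "K * r \<le> 1 / 2" by (fact K0 r0 rK)+
  qed (rule that)
  have MrR: "M * r \<le> R" using rM mult_nonneg_nonneg[OF M0 less_imp_le[OF r0]] by simp
  have uB: "u y \<in> B" for y using ub[of y] MrR by (simp add: B_def dist_norm norm_minus_commute)
  have ud: "((\<lambda>t. u (t *\<^sub>R y)) has_vector_derivative \<omega> (u (t *\<^sub>R y)) y) (at t within {0..1})"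
    if "y \<in> cball 0 r" "t \<in> {0..1}" for y t using ud[OF that] \<pi>id[OF uB] by simp
  define E where "E = Q * M\<^sup>2 * r + K * M"
  have E0: "E \<ge> 0" using Q0 K0 M0 r0 by (simp add: E_def)
  have key: "norm (u z - u y - \<omega> (u y) (z - y)) \<le> 2 * (E * (norm (z - y))\<^sup>2)"
    if y: "y \<in> cball 0 r" and z: "z \<in> cball 0 r" for y z
  proof -
    define h where "h = z - y"
    define w where "w t = u (t *\<^sub>R z) - u (t *\<^sub>R y) - t *\<^sub>R \<omega> (u (t *\<^sub>R y)) h" for t
    define w' where "w' t = \<omega> (u (t *\<^sub>R z)) z - \<omega> (u (t *\<^sub>R y)) y
        - (t *\<^sub>R D (\<lambda>x. \<omega> x h) (u (t *\<^sub>R y)) (\<omega> (u (t *\<^sub>R y)) y) + 1 *\<^sub>R \<omega> (u (t *\<^sub>R y)) h)" for t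
    have "norm (w 1) \<le> 2 * (E * (norm h)\<^sup>2)"
    proof (rule vanishing_start_bound)
      show "w 0 = 0" by (simp add: w_def)
      fix t :: real assume t: "t \<in> {0..1}"
      define p where "p = u (t *\<^sub>R y)"
      have pB: "p \<in> B" and pS: "p \<in> S" using uB B by (auto simp: p_def)
      note du = ud[OF y t, folded p_def]
      have dw: "((\<lambda>t. \<omega> (u (t *\<^sub>R y)) h) has_vector_derivative D (\<lambda>x. \<omega> x h) p (\<omega> p y)) (at t within {0..1})"
        using has_derivative_compose[OF du[unfolded has_vector_derivative_def]
            Ck_on_has_derivative[OF \<omega>1 pS, unfolded p_def], of h] linear_D[OF \<omega>1 pS, of h]
        unfolding has_vector_derivative_def p_def by (simp add: linear_cmul)
      show "(w has_vector_derivative w' t) (at t within {0..1})"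
        unfolding w_def w'_def
        by (intro has_vector_derivative_diff ud z y t has_vector_derivative_scaleR DERIV_ident dw[unfolded p_def])
      define q where "q = p + t *\<^sub>R \<omega> p h"
      have hb: "norm h \<le> 2 * r" using norm_triangle_ineq4[of z y] y z by (simp add: h_def)
      have qp: "norm (q - p) \<le> M * norm h"
        using M[OF pB, of h] t mult_mono[of "\<bar>t\<bar>" 1 "norm (\<omega> p h)" "M * norm h"] M0 by (auto simp: q_def)
      have "norm (q - x0) \<le> norm (p - x0) + norm (q - p)"
        using norm_triangle_ineq[of "p - x0" "q - p"] by simp
      also have "\<dots> \<le> M * r + M * (2 * r)"
        using qp ub[of "t *\<^sub>R y"] mult_left_mono[OF hb M0] by (simp add: p_def)
      also have "\<dots> \<le> R" using rM by simp
      finally have qB: "q \<in> B" by (simp add: B_def dist_norm norm_minus_commute)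
      \<comment> \<open>commutativity exchanges the roles of \<open>y\<close> and \<open>h\<close>, so that this term is the first-order
        part of \<open>\<omega>(q) y - \<omega>(p) y\<close>\<close>
      have "D (\<lambda>x. \<omega> x h) p (\<omega> p y) = D (\<lambda>x. \<omega> x y) p (\<omega> p h)" by (rule comm[OF pS])
      then have "t *\<^sub>R D (\<lambda>x. \<omega> x h) p (\<omega> p y) = D (\<lambda>x. \<omega> x y) p (q - p)"
        using linear_D[OF \<omega>1 pS, of y] by (simp add: q_def linear_cmul)
      moreover have "\<omega> (u (t *\<^sub>R z)) z = \<omega> (u (t *\<^sub>R z)) z - \<omega> q z + \<omega> q h + \<omega> q y"
        using linear_add[OF linB[OF qB], of h y] by (simp add: h_def)
      ultimately have w'eq: "w' t = (\<omega> (u (t *\<^sub>R z)) z - \<omega> q z) + (\<omega> q y - \<omega> p y - D (\<lambda>x. \<omega> x y) p (q - p))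
          + (\<omega> q h - \<omega> p h)"
        unfolding w'_def p_def[symmetric] by (simp add: algebra_simps)
      have 1: "norm (\<omega> (u (t *\<^sub>R z)) z - \<omega> q z) \<le> 1 / 2 * norm (w t)"
      proof -
        have "norm (\<omega> (u (t *\<^sub>R z)) z - \<omega> q z) \<le> K * norm (w t) * norm z"
          using K[OF uB qB, of "t *\<^sub>R z" z] by (simp add: w_def q_def p_def algebra_simps)
        also have "\<dots> \<le> K * norm (w t) * r" using z K0 by (intro mult_left_mono) auto
        also have "\<dots> \<le> 1 / 2 * norm (w t)" using mult_right_mono[OF rK, of "norm (w t)"] by (simp add: mult_ac)
        finally show ?thesis .
      qed
      have 2: "norm (\<omega> q y - \<omega> p y - D (\<lambda>x. \<omega> x y) p (q - p)) \<le> Q * M\<^sup>2 * r * (norm h)\<^sup>2"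
      proof -
        have "norm (\<omega> q y - \<omega> p y - D (\<lambda>x. \<omega> x y) p (q - p)) \<le> Q * (norm (q - p))\<^sup>2 * norm y" by (rule Q[OF pB qB])
        also have "\<dots> \<le> Q * (M * norm h)\<^sup>2 * r"
          using y Q0 qp by (intro mult_mono mult_left_mono power_mono mult_nonneg_nonneg) auto
        finally show ?thesis by (simp add: power_mult_distrib mult_ac)
      qed
      have 3: "norm (\<omega> q h - \<omega> p h) \<le> K * M * (norm h)\<^sup>2"
      proof -
        have "norm (\<omega> q h - \<omega> p h) \<le> K * norm (q - p) * norm h" by (rule K[OF qB pB])
        also have "\<dots> \<le> K * (M * norm h) * norm h" using qp K0 by (intro mult_right_mono mult_left_mono) auto
        finally show ?thesis by (simp add: power2_eq_square mult_ac)
      qed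
      show "norm (w' t) \<le> 1 / 2 * norm (w t) + E * (norm h)\<^sup>2"
        unfolding w'eq E_def distrib_right using norm_triangle_mono[OF norm_triangle_mono[OF 1 2] 3] by linarith
    qed
    then show ?thesis by (simp add: w_def h_def)
  qed
  have der: "(u has_derivative \<omega> (u y)) (at y)" if y: "y \<in> ball 0 r" for y
    by (rule has_derivative_quadratic_bound[OF linB[OF uB] open_ball y, where C = "2 * E"])
      (use key y E0 in \<open>auto simp: mult_ac\<close>)
  have "Ck_on j (ball 0 r) u" for j
  proof (induction j)
    case 0 show ?case using uc continuous_on_subset by auto
  next
    case (Suc j)
    have "Ck_on j (ball 0 r) (\<lambda>y. \<omega> (u y) v)" for v
      by (rule Ck_on_compose[OF open_ball S(1) Suc sm]) (use uB B in auto)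
    then show ?case by (intro Ck_onI[OF open_ball der])
  qed
  then have "smooth_on (ball 0 r) u" by (simp add: smooth_on_def)
  moreover have "u ` ball 0 r \<subseteq> S" using uB B(3) by auto
  ultimately show ?thesis using r0 u0 der by (intro that[of r u])
qed

section \<open>Tangent vectors and vector fields in charts\<close>

lemma smooth_on_Ck: "smooth_on S f \<Longrightarrow> Ck_on k S f" by (simp add: smooth_on_def)

lemma smooth_on_imp_differentiable: "smooth_on S f \<Longrightarrow> x \<in> S \<Longrightarrow> f differentiable at x"
  using smooth_on_Ck[of S f "Suc 0"] by simp

lemma smooth_on_linear_D: "smooth_on S f \<Longrightarrow> x \<in> S \<Longrightarrow> linear (D f x)"
  using linear_D[OF smooth_on_Ck[of S f "Suc 0"]] by blast

text \<open>The product rule for a family of linear maps, without a topology on the space of linear maps.\<close>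

lemma has_derivative_apply:
  fixes L :: "'e::euclidean_space \<Rightarrow> 'm::euclidean_space \<Rightarrow> 'v::real_normed_vector"
  assumes S: "open S" "x \<in> S" and lin: "\<And>z. z \<in> S \<Longrightarrow> linear (L z)"
    and L: "\<And>v. (\<lambda>z. L z v) differentiable at x" and w: "(w has_derivative w') (at x)"
  shows "((\<lambda>z. L z (w z)) has_derivative (\<lambda>v. D (\<lambda>z. L z (w x)) x v + L x (w' v))) (at x)"
proof -
  have L': "((\<lambda>z. L z b) has_derivative D (\<lambda>z. L z b) x) (at x)" for b
    using L frechet_derivative_works by blast
  have eq: "L z u = (\<Sum>b\<in>Basis. (u \<bullet> b) *\<^sub>R L z b)" if "z \<in> S" for z u
    by (rule linear_eq_sum_Basis[OF lin[OF that]])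
  have d: "((\<lambda>z. \<Sum>b\<in>Basis. (w z \<bullet> b) *\<^sub>R L z b) has_derivative
     (\<lambda>v. \<Sum>b\<in>Basis. (w x \<bullet> b) *\<^sub>R D (\<lambda>z. L z b) x v + (w' v \<bullet> b) *\<^sub>R L x b)) (at x)"
    by (intro has_derivative_sum has_derivative_scaleR has_derivative_inner_left w L')
  have d2: "((\<lambda>z. \<Sum>b\<in>Basis. (w x \<bullet> b) *\<^sub>R L z b) has_derivative
     (\<lambda>v. \<Sum>b\<in>Basis. (w x \<bullet> b) *\<^sub>R D (\<lambda>z. L z b) x v)) (at x)"
    by (intro has_derivative_sum has_derivative_scaleR_right L')
  have "D (\<lambda>z. L z (w x)) x = (\<lambda>v. \<Sum>b\<in>Basis. (w x \<bullet> b) *\<^sub>R D (\<lambda>z. L z b) x v)"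
    by (rule D_eq, rule has_derivative_transform_within_open[OF d2 S]) (rule eq[symmetric])
  moreover have "((\<lambda>z. L z (w z)) has_derivative
     (\<lambda>v. \<Sum>b\<in>Basis. (w x \<bullet> b) *\<^sub>R D (\<lambda>z. L z b) x v + (w' v \<bullet> b) *\<^sub>R L x b)) (at x)"
    by (rule has_derivative_transform_within_open[OF d S]) (rule eq[symmetric])
  ultimately show ?thesis unfolding eq[OF S(2), of "w' _"] by (simp add: sum.distrib)
qed

text \<open>The Lie bracket is natural: the second derivatives of \<open>f\<close> cancel by symmetry.\<close>

lemma bracket_pushforward:
  fixes f :: "'e::euclidean_space \<Rightarrow> 'f::euclidean_space"
  assumes f: "Ck_on 2 S f" and S: "open S" "x \<in> S" and X: "X differentiable at x" and Y: "Y differentiable at x"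
  shows "D (\<lambda>z. D f z (Y z)) x (X x) - D (\<lambda>z. D f z (X z)) x (Y x) = D f x (D Y x (X x) - D X x (Y x))"
proof -
  have f1: "Ck_on (Suc (Suc 0)) S f" using f by (simp add: numeral_2_eq_2)
  have lin: "linear (D f z)" if "z \<in> S" for z using linear_D[OF f1 that] .
  have d: "(\<lambda>z. D f z v) differentiable at x" for v using f1 S by simp
  have *: "D (\<lambda>z. D f z (Z z)) x v = D (\<lambda>z. D f z (Z x)) x v + D f x (D Z x v)" if "Z differentiable at x" for Z v
    using D_eq[OF has_derivative_apply[of S x "D f", OF S lin d that[unfolded frechet_derivative_works]]] by simp
  show ?thesis unfolding *[OF X] *[OF Y] using D2_symmetric[OF f S, of "Y x" "X x"] linear_diff[OF lin[OF S(2)]]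
    by simp
qed

locale atlas =
  fixes A :: "('a::t2_space, 'e::euclidean_space) chart set"
  assumes atlas: "smooth_atlas A"
begin

abbreviation "ch q \<equiv> chart_at A q"
abbreviation "img c \<equiv> snd c ` fst c"

text \<open>The components of a tangent vector at \<open>q\<close> in the chart \<open>c\<close>.\<close>

abbreviation T :: "('a, 'e) chart \<Rightarrow> 'a \<Rightarrow> 'e \<Rightarrow> 'e" where
  "T c q \<equiv> dir_deriv A (snd c) q"

abbreviation rep :: "('a, 'e) chart \<Rightarrow> ('a \<Rightarrow> 'e) \<Rightarrow> 'e \<Rightarrow> 'e" where
  "rep c X \<equiv> field_in_chart A c X"

lemma chart_at_in: "ch q \<in> A" "q \<in> fst (ch q)"
proof -
  have "q \<in> (\<Union>c\<in>A. fst c)" using atlas by (simp add: smooth_atlas_def)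
  then have "\<exists>c. c \<in> A \<and> q \<in> fst c" by blast
  from someI_ex[OF this] show "ch q \<in> A" "q \<in> fst (ch q)" by (auto simp: chart_at_def)
qed

lemma chart:
  assumes "c \<in> A"
  shows "open (fst c)" "open (img c)" "continuous_on (fst c) (snd c)" "continuous_on (img c) (chart_inv c)"
    and chart_inv_chart: "\<And>q. q \<in> fst c \<Longrightarrow> chart_inv c (snd c q) = q"
  using atlas assms by (auto simp: smooth_atlas_def is_chart_def homeomorphism_def)

lemma chart_chart_inv: "c \<in> A \<Longrightarrow> x \<in> img c \<Longrightarrow> snd c (chart_inv c x) = x"
  using chart_inv_chart by fastforce

lemma chart_inv_in: "c \<in> A \<Longrightarrow> x \<in> img c \<Longrightarrow> chart_inv c x \<in> fst c"
  using chart_inv_chart by fastforce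

lemma open_chart_image:
  assumes "c \<in> A" "open U" shows "open (snd c ` (fst c \<inter> U))"
proof -
  have "snd c ` (fst c \<inter> U) = img c \<inter> chart_inv c -` U"
    using chart_inv_chart[OF assms(1)] by force
  then show ?thesis using continuous_open_preimage[OF chart(4)[OF assms(1)] chart(2)[OF assms(1)] assms(2)] by simp
qed

lemma transition_smooth:
  assumes "c \<in> A" "d \<in> A" shows "smooth_on (snd c ` (fst c \<inter> fst d)) (snd d \<circ> chart_inv c)"
  using atlas assms by (simp add: smooth_atlas_def)

lemma open_transition: "c \<in> A \<Longrightarrow> d \<in> A \<Longrightarrow> open (snd c ` (fst c \<inter> fst d))"
  by (rule open_chart_image[OF _ chart(1)])

lemma transition_differentiable:
  "c \<in> A \<Longrightarrow> d \<in> A \<Longrightarrow> q \<in> fst c \<Longrightarrow> q \<in> fst d \<Longrightarrow> (snd d \<circ> chart_inv c) differentiable at (snd c q)"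
  by (rule smooth_on_imp_differentiable[OF transition_smooth]) auto

lemma linear_T: "c \<in> A \<Longrightarrow> q \<in> fst c \<Longrightarrow> linear (T c q)"
  unfolding dir_deriv_def
  by (rule linear_frechet_derivative, rule transition_differentiable) (auto simp: chart_at_in)

text \<open>Directional derivatives are defined in the distinguished chart of each point; by the chain rule
  every other chart computes them as well.\<close>

lemma dir_deriv_chart:
  fixes f :: "'a \<Rightarrow> 'v::real_normed_vector"
  assumes c: "c \<in> A" "q \<in> fst c" and f: "(f \<circ> chart_inv c) differentiable at (snd c q)"
  shows "dir_deriv A f q v = D (f \<circ> chart_inv c) (snd c q) (T c q v)"
proof -
  let ?k = "ch q"
  note k = chart_at_in[of q]
  have q: "(snd c \<circ> chart_inv ?k) (snd ?k q) = snd c q" by (simp add: chart_inv_chart[OF k])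
  have "D (f \<circ> chart_inv ?k) (snd ?k q)
      = D (\<lambda>x. (f \<circ> chart_inv c) ((snd c \<circ> chart_inv ?k) x)) (snd ?k q)"
    by (rule D_cong[OF open_transition[OF k(1) c(1)]])
      (use k c chart_inv_chart[OF k(1)] chart_inv_chart[OF c(1)] in auto)
  then show ?thesis unfolding dir_deriv_def
    using D_compose[of "snd c \<circ> chart_inv ?k" "snd ?k q" "f \<circ> chart_inv c"] f
      transition_differentiable[OF k(1) c(1) k(2) c(2)] unfolding q by simp
qed

lemma T_self: "T (ch q) q v = v"
proof -
  note k = chart_at_in[of q]
  have "D (snd (ch q) \<circ> chart_inv (ch q)) (snd (ch q) q) = D (\<lambda>x. x) (snd (ch q) q)"
    by (rule D_cong[OF chart(2)[OF k(1)]]) (use k chart_inv_chart[OF k(1)] in auto)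
  then show ?thesis by (simp add: dir_deriv_def)
qed

lemma T_trans:
  assumes "c \<in> A" "d \<in> A" "q \<in> fst c" "q \<in> fst d"
  shows "T d q v = D (snd d \<circ> chart_inv c) (snd c q) (T c q v)"
  by (rule dir_deriv_chart) (use assms transition_differentiable in auto)

lemma inj_T: assumes "c \<in> A" "q \<in> fst c" shows "inj (T c q)"
proof (rule injI)
  fix v w assume "T c q v = T c q w"
  then have "T (ch q) q v = T (ch q) q w" by (simp add: T_trans[OF assms(1) chart_at_in(1) assms(2) chart_at_in(2)])
  then show "v = w" by (simp add: T_self)
qed

lemma bij_T: "c \<in> A \<Longrightarrow> q \<in> fst c \<Longrightarrow> bij (T c q)"
  unfolding bij_def using inj_T linear_inj_imp_surj[OF linear_T inj_T] by blast

lemma T_inv: "c \<in> A \<Longrightarrow> q \<in> fst c \<Longrightarrow> T c q (inv (T c q) v) = v"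
  by (rule surj_f_inv_f[OF bij_is_surj[OF bij_T]])

lemma inv_T: "c \<in> A \<Longrightarrow> q \<in> fst c \<Longrightarrow> inv (T c q) (T c q v) = v"
  by (rule inv_f_f[OF inj_T])

lemma rep_at: "c \<in> A \<Longrightarrow> q \<in> fst c \<Longrightarrow> rep c X (snd c q) = T c q (X q)"
  by (simp add: field_in_chart_def chart_inv_chart)

lemma rep_trans:
  assumes "c \<in> A" "d \<in> A" "q \<in> fst c" "q \<in> fst d"
  shows "rep d X (snd d q) = D (snd d \<circ> chart_inv c) (snd c q) (rep c X (snd c q))"
  using assms by (simp add: rep_at T_trans[OF assms])

lemma smooth_field_rep: "smooth_field A X \<Longrightarrow> c \<in> A \<Longrightarrow> smooth_on (img c) (rep c X)"
  by (simp add: smooth_field_def)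

lemma rep_differentiable:
  "smooth_field A X \<Longrightarrow> c \<in> A \<Longrightarrow> q \<in> fst c \<Longrightarrow> rep c X differentiable at (snd c q)"
  by (rule smooth_on_imp_differentiable[OF smooth_field_rep]) auto

lemma smooth_fun_chart: "smooth_fun A f \<Longrightarrow> c \<in> A \<Longrightarrow> smooth_on (img c) (f \<circ> chart_inv c)"
  by (simp add: smooth_fun_def)

lemma smooth_field_add:
  assumes "smooth_field A X" "smooth_field A Y" shows "smooth_field A (\<lambda>q. X q + Y q)"
  unfolding smooth_field_def smooth_on_def
proof (intro ballI allI)
  fix c k assume c: "c \<in> A"
  have "Ck_on k (img c) (\<lambda>x. rep c X x + rep c Y x)"
    using assms c chart(2)[OF c] by (intro Ck_on_add smooth_on_Ck smooth_field_rep)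
  then show "Ck_on k (img c) (rep c (\<lambda>q. X q + Y q))"
    by (rule Ck_on_congI[OF _ chart(2)[OF c]]) (auto simp: rep_at[OF c] linear_add[OF linear_T[OF c]])
qed

lemma smooth_field_cmul:
  assumes "smooth_field A X" shows "smooth_field A (\<lambda>q. r *\<^sub>R X q)"
  unfolding smooth_field_def smooth_on_def
proof (intro ballI allI)
  fix c k assume c: "c \<in> A"
  have "Ck_on k (img c) (\<lambda>x. r *\<^sub>R rep c X x)"
    using assms c chart(2)[OF c] by (intro Ck_on_scaleR Ck_on_const smooth_on_Ck smooth_field_rep)
  then show "Ck_on k (img c) (rep c (\<lambda>q. r *\<^sub>R X q))"
    by (rule Ck_on_congI[OF _ chart(2)[OF c]]) (auto simp: rep_at[OF c] linear_cmul[OF linear_T[OF c]])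
qed

lemma smooth_field_diff:
  assumes "smooth_field A X" "smooth_field A Y" shows "smooth_field A (\<lambda>q. X q - Y q)"
  using smooth_field_add[OF assms(1) smooth_field_cmul[OF assms(2), of "-1"]] by simp

text \<open>The distinguished chart varies with the point, so that statements about a neighbourhood need the
  bracket in one fixed chart.  The transition map relates the two expressions.\<close>

lemma lie_bracket_chart:
  assumes c: "c \<in> A" "q \<in> fst c" and X: "smooth_field A X" and Y: "smooth_field A Y"
  shows "T c q (lie_bracket A X Y q)
    = D (rep c Y) (snd c q) (rep c X (snd c q)) - D (rep c X) (snd c q) (rep c Y (snd c q))"
proof -
  let ?k = "ch q"
  note k = chart_at_in[of q]
  let ?f = "snd c \<circ> chart_inv ?k" and ?S = "snd ?k ` (fst ?k \<inter> fst c)" and ?x = "snd ?k q"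
  have S: "open ?S" "?x \<in> ?S" using open_transition[OF k(1) c(1)] k c by auto
  have f: "?f differentiable at ?x" using transition_differentiable[OF k(1) c(1) k(2) c(2)] .
  have fx: "?f ?x = snd c q" by (simp add: chart_inv_chart[OF k])
  have *: "D (\<lambda>z. D ?f z (rep ?k Z z)) ?x v = D (rep c Z) (snd c q) (D ?f ?x v)" if Z: "smooth_field A Z" for Z v
  proof -
    have "D (\<lambda>z. D ?f z (rep ?k Z z)) ?x = D (\<lambda>z. rep c Z (?f z)) ?x"
    proof (rule D_cong[OF S])
      fix z assume "z \<in> ?S"
      then obtain q' where q': "q' \<in> fst ?k" "q' \<in> fst c" "z = snd ?k q'" by auto
      then show "D ?f z (rep ?k Z z) = rep c Z (?f z)"
        using rep_trans[OF k(1) c(1) q'(1,2), of Z] chart_inv_chart[OF k(1) q'(1)] by simp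
    qed
    then show ?thesis using D_compose[OF f, of "rep c Z"] rep_differentiable[OF Z c] unfolding fx by simp
  qed
  have rk: "rep ?k Z ?x = Z q" for Z using rep_at[OF k] by (simp add: T_self)
  have "lie_bracket A X Y q = D (rep ?k Y) ?x (rep ?k X ?x) - D (rep ?k X) ?x (rep ?k Y ?x)"
    by (simp add: lie_bracket_def Let_def rk)
  then have "T c q (lie_bracket A X Y q)
     = D ?f ?x (D (rep ?k Y) ?x (rep ?k X ?x) - D (rep ?k X) ?x (rep ?k Y ?x))"
    by (simp add: T_trans[OF k(1) c(1) k(2) c(2)] T_self)
  also have "\<dots> = D (\<lambda>z. D ?f z (rep ?k Y z)) ?x (rep ?k X ?x) - D (\<lambda>z. D ?f z (rep ?k X z)) ?x (rep ?k Y ?x)"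
    by (rule bracket_pushforward[symmetric, OF smooth_on_Ck[OF transition_smooth[OF k(1) c(1)]] S
          rep_differentiable[OF X k] rep_differentiable[OF Y k]])
  also have "\<dots> = D (rep c Y) (snd c q) (rep c X (snd c q)) - D (rep c X) (snd c q) (rep c Y (snd c q))"
    using rep_trans[OF k(1) c(1) k(2) c(2)] by (simp add: *[OF X] *[OF Y])
  finally show ?thesis .
qed

text \<open>Local fields are cut off outside a compact ball of the chart; the ball is closed in the
  manifold because the latter is Hausdorff.\<close>

lemma extend_fields:
  fixes Z :: "'i \<Rightarrow> 'e \<Rightarrow> 'e"
  assumes c: "c \<in> A" and V: "open V" "x0 \<in> V" "V \<subseteq> img c" and Z: "\<And>i. smooth_on V (Z i)"
  obtains X N where "open N" "x0 \<in> N" "N \<subseteq> V" "\<And>i. smooth_field A (X i)"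
    "\<And>i x. x \<in> N \<Longrightarrow> rep c (X i) x = Z i x"
    "\<And>i q. X i q = 0 \<or> (q \<in> fst c \<and> snd c q \<in> V \<and> (\<exists>k. T c q (X i q) = k *\<^sub>R Z i (snd c q)))"
proof -
  obtain R where R: "R > 0" "cball x0 R \<subseteq> V" using V(1,2) by (meson open_contains_cball)
  obtain \<beta> where \<beta>: "smooth_on UNIV \<beta>" "\<And>x. x \<in> ball x0 (R / 2) \<Longrightarrow> \<beta> x = 1"
    "\<And>x. x \<notin> cball x0 (2 * (R / 2)) \<Longrightarrow> \<beta> x = (0::real)"
    using plateau_exists[of "R / 2" x0] R(1) by (metis half_gt_zero)
  define W where "W = {q \<in> fst c. snd c q \<in> V}"
  have W: "open W" unfolding W_def
    using continuous_open_preimage[OF chart(3)[OF c] chart(1)[OF c] V(1)] by (simp add: vimage_def Int_def)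
  define X where "X i q = (if q \<in> W then \<beta> (snd c q) *\<^sub>R inv (T c q) (Z i (snd c q)) else 0)" for i q
  define K where "K = chart_inv c ` cball x0 R"
  have "compact K" unfolding K_def
    by (rule compact_continuous_image[OF continuous_on_subset[OF chart(4)[OF c]] compact_cball]) (use R V in auto)
  then have K: "open (- K)" using compact_imp_closed by blast
  have TX: "T c q (X i q) = \<beta> (snd c q) *\<^sub>R Z i (snd c q)" if "q \<in> W" for q i
    using that c by (simp add: X_def W_def linear_cmul[OF linear_T] T_inv)
  have X0: "X i q = 0" if "q \<notin> K" for i q
  proof -
    have "snd c q \<notin> cball x0 R" if "q \<in> W"
      using \<open>q \<notin> K\<close> chart_inv_chart[OF c, of q] that by (force simp: K_def W_def)
    then show ?thesis using \<beta>(3) by (auto simp: X_def)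
  qed
  have KW: "K \<subseteq> W" using R V(3) chart_inv_in[OF c] chart_chart_inv[OF c] by (auto simp: K_def W_def subset_iff)
  have "smooth_field A (X i)" for i
    unfolding smooth_field_def smooth_on_def
  proof (intro ballI allI, rule Ck_on_local)
    fix d k x assume d: "d \<in> A" and "x \<in> img d"
    then obtain q where q: "q \<in> fst d" "x = snd d q" by auto
    show "\<exists>T. open T \<and> x \<in> T \<and> Ck_on k T (rep d (X i))"
    proof (cases "q \<in> W")
      case True
      let ?S = "snd d ` (fst d \<inter> W)" and ?S' = "snd c ` (fst c \<inter> fst d) \<inter> V"
      have S: "open ?S" by (rule open_chart_image[OF d W])
      have S': "open ?S'" using open_transition[OF c d] V(1) by auto
      have g: "Ck_on k ?S' (\<lambda>y. \<beta> y *\<^sub>R D (snd d \<circ> chart_inv c) y (Z i y))"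
      proof (rule Ck_on_scaleR[OF S' _ Ck_on_apply[OF S', of "\<lambda>y. D (snd d \<circ> chart_inv c) y"]])
        show "Ck_on k ?S' \<beta>" by (rule Ck_on_subset[OF smooth_on_Ck[OF \<beta>(1)]]) simp
        show "Ck_on k ?S' (Z i)" by (rule Ck_on_subset[OF smooth_on_Ck[OF Z]]) simp
        show "Ck_on k ?S' (\<lambda>y. D (snd d \<circ> chart_inv c) y v)" for v
          by (rule Ck_on_subset[OF Ck_on_D[OF smooth_on_Ck[OF transition_smooth[OF c d]]]]) simp
        show "linear (D (snd d \<circ> chart_inv c) y)" if "y \<in> ?S'" for y
          by (rule smooth_on_linear_D[OF transition_smooth[OF c d]]) (use that in simp)
      qed
      have f: "Ck_on k ?S (snd c \<circ> chart_inv d)"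
        by (rule Ck_on_subset[OF smooth_on_Ck[OF transition_smooth[OF d c]]]) (auto simp: W_def)
      have "Ck_on k ?S (\<lambda>x. (\<lambda>y. \<beta> y *\<^sub>R D (snd d \<circ> chart_inv c) y (Z i y)) ((snd c \<circ> chart_inv d) x))"
        by (rule Ck_on_compose[OF S S' f g]) (use chart_inv_chart[OF d] in \<open>auto simp: W_def\<close>)
      then have "Ck_on k ?S (rep d (X i))"
      proof (rule Ck_on_congI[OF _ S])
        fix x assume "x \<in> ?S"
        then obtain q where q: "q \<in> fst d" "q \<in> W" "x = snd d q" by auto
        have qc: "q \<in> fst c" using q by (simp add: W_def)
        have "rep d (X i) x = D (snd d \<circ> chart_inv c) (snd c q) (\<beta> (snd c q) *\<^sub>R Z i (snd c q))"
          unfolding q(3) rep_trans[OF c d qc q(1)] rep_at[OF c qc] TX[OF q(2)] ..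
        also have "\<dots> = \<beta> (snd c q) *\<^sub>R D (snd d \<circ> chart_inv c) (snd c q) (Z i (snd c q))"
          by (rule linear_cmul, rule smooth_on_linear_D[OF transition_smooth[OF c d]]) (use qc q in auto)
        finally show "(\<lambda>y. \<beta> y *\<^sub>R D (snd d \<circ> chart_inv c) y (Z i y)) ((snd c \<circ> chart_inv d) x) = rep d (X i) x"
          by (simp add: q(3) chart_inv_chart[OF d q(1)])
      qed
      then show ?thesis using S q True by auto
    next
      case False
      let ?S = "snd d ` (fst d \<inter> - K)"
      have S: "open ?S" by (rule open_chart_image[OF d K])
      have "Ck_on k ?S (rep d (X i))"
        by (rule Ck_on_congI[OF Ck_on_const[of _ _ 0] S]) (auto simp: rep_at[OF d] linear_0[OF linear_T[OF d]] X0)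
      then show ?thesis using S q False KW by blast
    qed
  qed
  moreover have "rep c (X i) x = Z i x" if "x \<in> ball x0 (R / 2)" for i x
  proof -
    have "x \<in> V" using that R by (auto simp: subset_iff)
    then obtain q where q: "q \<in> fst c" "x = snd c q" "q \<in> W" using V(3) by (auto simp: W_def)
    then show ?thesis using \<beta>(2)[OF that] by (simp add: rep_at[OF c] TX)
  qed
  moreover have "ball x0 (R / 2) \<subseteq> V" using R by (auto simp: subset_iff)
  moreover have "X i q = 0 \<or> (q \<in> fst c \<and> snd c q \<in> V \<and> (\<exists>k. T c q (X i q) = k *\<^sub>R Z i (snd c q)))" for i q
    using TX[of q i] by (cases "q \<in> W") (auto simp: X_def W_def)
  ultimately show ?thesis using R(1) by (intro that[of "ball x0 (R / 2)" X]) auto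
qed

lemma smooth_on_const: "smooth_on S (\<lambda>x. v)"
  by (simp add: smooth_on_def Ck_on_const)

text \<open>Every tangent vector extends to a smooth field, so tensors evaluated on extensions are not
  evaluated on arbitrary values of the choice operator.\<close>

lemma ext_field: "smooth_field A (ext_field A p v)" "ext_field A p v p = v"
proof -
  note k = chart_at_in[of p]
  have p: "snd (ch p) p \<in> img (ch p)" using k by auto
  obtain X N where X: "open N" "snd (ch p) p \<in> N" "N \<subseteq> img (ch p)" "\<And>i::unit. smooth_field A (X i)"
    "\<And>i x. x \<in> N \<Longrightarrow> rep (ch p) (X i) x = v"
    by (rule extend_fields[OF k(1) chart(2)[OF k(1)] p order_refl smooth_on_const[of _ v]]) (rule that)
  have "X () p = v" using X(5)[OF X(2), of "()"] rep_at[OF k, of "X ()"] by (simp add: T_self)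
  then have "\<exists>X. smooth_field A X \<and> X p = v" using X(4) by blast
  from someI_ex[OF this] show "smooth_field A (ext_field A p v)" "ext_field A p v p = v"
    unfolding ext_field_def by (simp_all only:)
qed

end

section \<open>Linear algebra of an inner product\<close>

locale inner_product_form =
  fixes b :: "'e::euclidean_space \<Rightarrow> 'e \<Rightarrow> real"
  assumes bil: "bilinear b" and sym: "b x y = b y x" and pos: "x \<noteq> 0 \<Longrightarrow> b x x > 0"
begin

lemma linear_form_right: "linear (b x)" and linear_form_left: "linear (\<lambda>y. b y x)"
  using bil by (auto simp: bilinear_def)

lemmas form_simps = bilinear_ladd[OF bil] bilinear_radd[OF bil] bilinear_lmul[OF bil] bilinear_rmul[OF bil]
  bilinear_lsub[OF bil] bilinear_rsub[OF bil] bilinear_lneg[OF bil] bilinear_rneg[OF bil]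
  bilinear_lzero[OF bil] bilinear_rzero[OF bil]

lemma form_sum_left: "b (\<Sum>i\<in>I. f i) y = (\<Sum>i\<in>I. b (f i) y)"
  using linear_sum[OF linear_form_left] by simp

lemma form_sum_right: "b y (\<Sum>i\<in>I. f i) = (\<Sum>i\<in>I. b y (f i))"
  using linear_sum[OF linear_form_right] by simp

lemma form_eq_0: "b x x = 0 \<longleftrightarrow> x = 0"
  using pos[of x] form_simps by (cases "x = 0") auto

lemma form_nonneg: "b x x \<ge> 0"
  using pos[of x] form_simps by (cases "x = 0") auto

lemma orthonormal_coeff:
  assumes "finite E" "\<And>x y. x \<in> E \<Longrightarrow> y \<in> E \<Longrightarrow> b x y = (if x = y then 1 else 0)" "e \<in> E"
  shows "b (\<Sum>x\<in>E. c x *\<^sub>R x) e = c e"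
proof -
  have "b (\<Sum>x\<in>E. c x *\<^sub>R x) e = (\<Sum>x\<in>E. if x = e then c x else 0)"
    unfolding form_sum_left by (rule sum.cong) (auto simp: form_simps assms)
  then show ?thesis using assms(1,3) by simp
qed

text \<open>Gram--Schmidt orthonormalisation, one vector at a time.\<close>

lemma orthonormal_basis_of_span:
  assumes "finite B" shows "\<exists>E. orthonormal_basis b (span B) E"
  using assms
proof (induction B)
  case empty
  show ?case by (intro exI[of _ "{}"]) (simp add: orthonormal_basis_def)
next
  case (insert a B)
  then obtain E where E: "finite E" "E \<subseteq> span B" "span E = span B"
    "\<And>x y. x \<in> E \<Longrightarrow> y \<in> E \<Longrightarrow> b x y = (if x = y then 1 else 0)"
    by (auto simp: orthonormal_basis_def)
  define p where "p = (\<Sum>x\<in>E. b a x *\<^sub>R x)"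
  define r where "r = a - p"
  have p: "p \<in> span B" unfolding p_def E(3)[symmetric] by (intro span_sum span_scale span_base)
  have r: "b r e = 0" if "e \<in> E" for e
    using orthonormal_coeff[OF E(1,4) that, of "b a"] by (simp add: r_def p_def form_simps)
  have span_ins: "span (insert a B) = span (insert r E)"
  proof -
    have "span (insert a B) = span (insert a E)" using span_breakdown_eq[of _ a] E(3) by blast
    also have "\<dots> = span (insert r E)"
    proof -
      have "a - r \<in> span E" using p by (simp add: r_def E(3))
      then show ?thesis by (rule eq_span_insert_eq)
    qed
    finally show ?thesis .
  qed
  show ?case
  proof (cases "r = 0")
    case True
    then have "span (insert a B) = span E" using span_ins span_insert_0 by simp
    then show ?thesis using E span_superset[of E]
      by (intro exI[of _ E]) (simp add: orthonormal_basis_def)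
  next
    case False
    define n where "n = sqrt (b r r)"
    have n: "n > 0" "n * n = b r r" using pos[OF False] by (auto simp: n_def)
    define e where "e = (1 / n) *\<^sub>R r"
    have ee: "b e e = 1" using n pos[OF False] by (simp add: e_def form_simps divide_simps)
    have eE: "b e x = 0" "b x e = 0" if "x \<in> E" for x using r[OF that] by (simp_all add: e_def form_simps sym[of x])
    have "span (insert e E) = span (insert r E)"
    proof -
      have "e \<in> span (insert r E)" unfolding e_def by (intro span_scale span_base) simp
      moreover have "r = n *\<^sub>R e" using n by (simp add: e_def)
      then have "r \<in> span (insert e E)" by (metis insertI1 span_base span_scale)
      ultimately show ?thesis
        by (intro subset_antisym span_minimal subspace_span) (auto intro: span_base)
    qed
    then have "span (insert e E) = span (insert a B)" using span_ins by simp
    moreover have "insert e E \<subseteq> span (insert e E)" by (rule span_superset)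
    moreover have "e \<notin> E" using eE(1)[of e] ee by auto
    ultimately show ?thesis using E(1,4) ee eE
      by (intro exI[of _ "insert e E"]) (auto simp: orthonormal_basis_def)
  qed
qed

lemma some_onb:
  assumes "subspace L" shows "orthonormal_basis b L (some_onb b L)"
proof -
  obtain B where "B \<subseteq> L" "independent B" "L \<subseteq> span B" "card B = dim L"
    using basis_exists by blast
  then have "finite B" "span B = L" using assms independent_imp_finite span_minimal by blast+
  then have "\<exists>E. orthonormal_basis b L E" using orthonormal_basis_of_span by blast
  then show ?thesis unfolding some_onb_def by (rule someI_ex)
qed

context
  fixes L E assumes onb: "orthonormal_basis b L E"
begin

lemma onb_finite: "finite E" and onb_in: "e \<in> E \<Longrightarrow> e \<in> L"
  and onb_orth: "x \<in> E \<Longrightarrow> y \<in> E \<Longrightarrow> b x y = (if x = y then 1 else 0)"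
  using onb by (auto simp: orthonormal_basis_def)

lemma onb_span: "span E = L"
  using onb by (simp add: orthonormal_basis_def)

lemma onb_combination_in: "(\<Sum>e\<in>E. c e *\<^sub>R e) \<in> L"
proof -
  have "(\<Sum>e\<in>E. c e *\<^sub>R e) \<in> span E" by (intro span_sum span_scale span_base)
  then show ?thesis by (simp only: onb_span)
qed

lemma onb_expand: assumes "x \<in> L" shows "(\<Sum>e\<in>E. b x e *\<^sub>R e) = x"
proof -
  have "x \<in> range (\<lambda>c. \<Sum>e\<in>E. c e *\<^sub>R e)"
    using assms onb_span span_finite[OF onb_finite] by simp
  then obtain c where c: "x = (\<Sum>e\<in>E. c e *\<^sub>R e)" by blast
  have "b x e = c e" if "e \<in> E" for e
    unfolding c by (rule orthonormal_coeff[OF onb_finite onb_orth that])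
  then show ?thesis using c by simp
qed

lemma onb_parseval: assumes "x \<in> L" shows "(\<Sum>e\<in>E. b x e * b y e) = b x y"
proof -
  have "b x y = b (\<Sum>e\<in>E. b x e *\<^sub>R e) y" by (simp add: onb_expand[OF assms])
  also have "\<dots> = (\<Sum>e\<in>E. b x e * b y e)" by (simp only: form_sum_left form_simps real_scaleR_def sym[of y])
  finally show ?thesis by simp
qed

lemma onb_norm2: "x \<in> L \<Longrightarrow> (\<Sum>e\<in>E. (b x e)\<^sup>2) = b x x"
  using onb_parseval[of x x] by (simp add: power2_eq_square)

lemma onb_card: "card E = dim L"
proof -
  have "independent E"
  proof (rule independent_if_scalars_zero[OF onb_finite])
    fix c e assume "(\<Sum>x\<in>E. c x *\<^sub>R x) = 0" "e \<in> E"
    then show "c e = 0" using orthonormal_coeff[OF onb_finite onb_orth, of e c] form_simps by simp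
  qed
  then have "dim (span E) = card E" by (simp add: dim_eq_card_independent)
  then show ?thesis by (simp only: onb_span)
qed

lemma onb_bessel: "(\<Sum>e\<in>E. (b x e)\<^sup>2) \<le> b x x"
proof -
  define p where "p = (\<Sum>e\<in>E. b x e *\<^sub>R e)"
  have pe: "b p e = b x e" if "e \<in> E" for e
    unfolding p_def by (rule orthonormal_coeff[OF onb_finite onb_orth that])
  have "b x p = (\<Sum>e\<in>E. (b x e)\<^sup>2)"
    unfolding p_def by (simp add: form_sum_right form_simps power2_eq_square)
  moreover have "b p p = (\<Sum>e\<in>E. (b x e)\<^sup>2)"
    using pe unfolding p_def form_sum_right by (simp add: form_simps power2_eq_square)
  moreover have "b (x - p) (x - p) \<ge> 0" by (rule form_nonneg)
  ultimately show ?thesis by (simp add: form_simps sym[of p x])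
qed

lemma onb_projection: "\<exists>u\<in>L. \<forall>w\<in>L. b (v - u) w = 0"
proof (intro bexI ballI)
  show "(\<Sum>e\<in>E. b v e *\<^sub>R e) \<in> L" by (rule onb_combination_in)
  fix w assume w: "w \<in> L"
  have "b (\<Sum>e\<in>E. b v e *\<^sub>R e) w = (\<Sum>e\<in>E. b w e * b v e)"
    by (simp add: form_sum_left form_simps mult.commute sym[of w])
  then show "b (v - (\<Sum>e\<in>E. b v e *\<^sub>R e)) w = 0"
    using onb_parseval[OF w, of v] by (simp add: form_simps sym[of v w])
qed

end

text \<open>Bessel's inequality for the vector that represents \<open>l\<close> on \<open>H\<close>.\<close>

lemma sum_squares_functional_le:
  assumes H: "orthonormal_basis b H E" and L: "orthonormal_basis b L E'" "L \<subseteq> H"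
    and l: "linear l"
  shows "(\<Sum>x\<in>E'. (l x)\<^sup>2) \<le> (\<Sum>x\<in>E. (l x :: real)\<^sup>2)"
proof -
  define v where "v = (\<Sum>e\<in>E. l e *\<^sub>R e)"
  have lv: "l x = b v x" if "x \<in> H" for x
  proof -
    have "l x = l (\<Sum>e\<in>E. b x e *\<^sub>R e)" by (simp add: onb_expand[OF H that])
    also have "\<dots> = b v x"
      by (simp add: linear_sum[OF l] linear_cmul[OF l] v_def form_sum_left form_simps sym[of x] mult.commute)
    finally show ?thesis .
  qed
  have "(\<Sum>x\<in>E'. (l x)\<^sup>2) = (\<Sum>x\<in>E'. (b v x)\<^sup>2)"
    using lv onb_in[OF L(1)] L(2) by (intro sum.cong) (auto simp: subset_iff)
  also have "\<dots> \<le> b v v" by (rule onb_bessel[OF L(1)])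
  also have "\<dots> = (\<Sum>x\<in>E. (b v x)\<^sup>2)"
  proof (rule onb_norm2[OF H, symmetric])
    show "v \<in> H" unfolding v_def by (rule onb_combination_in[OF H])
  qed
  also have "\<dots> = (\<Sum>x\<in>E. (l x)\<^sup>2)" using lv onb_in[OF H] by (intro sum.cong) auto
  finally show ?thesis .
qed

text \<open>The Hilbert--Schmidt norm decreases under restriction, one argument at a time.\<close>

lemma sum_squares_bilinear_le:
  assumes H: "orthonormal_basis b H E" and L: "orthonormal_basis b L E'" "L \<subseteq> H" and a: "bilinear a"
  shows "(\<Sum>x\<in>E'. \<Sum>y\<in>E'. (a x y)\<^sup>2) \<le> (\<Sum>x\<in>E. \<Sum>y\<in>E. (a x y :: real)\<^sup>2)"
proof -
  have lin: "linear (a x)" "linear (\<lambda>x. a x y)" for x y using a by (auto simp: bilinear_def)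
  have "(\<Sum>x\<in>E'. \<Sum>y\<in>E'. (a x y)\<^sup>2) \<le> (\<Sum>x\<in>E'. \<Sum>y\<in>E. (a x y)\<^sup>2)"
    by (intro sum_mono sum_squares_functional_le[OF H L] lin)
  also have "\<dots> = (\<Sum>y\<in>E. \<Sum>x\<in>E'. (a x y)\<^sup>2)" by (rule sum.swap)
  also have "\<dots> \<le> (\<Sum>y\<in>E. \<Sum>x\<in>E. (a x y)\<^sup>2)"
    by (intro sum_mono sum_squares_functional_le[OF H L] lin)
  also have "\<dots> = (\<Sum>x\<in>E. \<Sum>y\<in>E. (a x y)\<^sup>2)" by (rule sum.swap)
  finally show ?thesis .
qed

end

section \<open>Riemannian metrics in charts\<close>

locale metric_atlas = atlas A for A :: "('a::t2_space, 'e::euclidean_space) chart set" +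
  fixes g :: "'a \<Rightarrow> 'e \<Rightarrow> 'e \<Rightarrow> real"
  assumes metric: "riemannian_metric A g"
begin

sublocale inner_product_form "g p" for p
  using metric by unfold_locales (auto simp: riemannian_metric_def)

lemma smooth_fun_metric: "smooth_field A X \<Longrightarrow> smooth_field A Y \<Longrightarrow> smooth_fun A (\<lambda>p. g p (X p) (Y p))"
  using metric by (simp add: riemannian_metric_def)

definition chart_metric :: "('a, 'e) chart \<Rightarrow> 'e \<Rightarrow> 'e \<Rightarrow> 'e \<Rightarrow> real" where
  "chart_metric c x v w = (let q = chart_inv c x in g q (inv (T c q) v) (inv (T c q) w))"

lemma chart_metric_at:
  "c \<in> A \<Longrightarrow> q \<in> fst c \<Longrightarrow> chart_metric c (snd c q) (T c q v) (T c q w) = g q v w"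
  by (simp add: chart_metric_def chart_inv_chart inv_T Let_def)

lemma linear_inv_T: "c \<in> A \<Longrightarrow> q \<in> fst c \<Longrightarrow> linear (inv (T c q))"
  by (rule inj_linear_imp_inv_linear[OF linear_T inj_T])

lemma linear_chart_metric:
  assumes "c \<in> A" "x \<in> img c"
  shows "linear (chart_metric c x v)" "linear (\<lambda>v. chart_metric c x v w)"
proof -
  have l: "linear (inv (T c (chart_inv c x)))" using assms by (intro linear_inv_T chart_inv_in)
  show "linear (chart_metric c x v)" unfolding chart_metric_def Let_def
    using linear_compose[OF l linear_form_right] by (simp add: o_def)
  show "linear (\<lambda>v. chart_metric c x v w)" unfolding chart_metric_def Let_def
    using linear_compose[OF l linear_form_left] by (simp add: o_def)
qed

text \<open>Smoothness of a metric is a condition on global vector fields; the coordinate fields of a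
  chart become global ones after extension from a neighbourhood.\<close>

lemma Ck_on_chart_metric:
  assumes c: "c \<in> A" shows "Ck_on k (img c) (\<lambda>x. chart_metric c x v w)"
proof (rule Ck_on_local)
  fix x0 assume x0: "x0 \<in> img c"
  obtain X N where X: "open N" "x0 \<in> N" "N \<subseteq> img c" "\<And>v. smooth_field A (X v)"
    "\<And>v x. x \<in> N \<Longrightarrow> rep c (X v) x = v"
    by (rule extend_fields[OF c chart(2)[OF c] x0 order_refl smooth_on_const, of "\<lambda>v. v"]) (rule that)
  have "Ck_on k N ((\<lambda>p. g p (X v p) (X w p)) \<circ> chart_inv c)"
    by (rule Ck_on_subset[OF smooth_on_Ck[OF smooth_fun_chart[OF smooth_fun_metric[OF X(4) X(4)] c]] X(3)])
  then have "Ck_on k N (\<lambda>x. chart_metric c x v w)"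
  proof (rule Ck_on_congI[OF _ X(1)])
    fix x assume x: "x \<in> N"
    then obtain q where q: "q \<in> fst c" "x = snd c q" using X(3) by auto
    have "T c q (X u q) = u" for u using X(5)[OF x, of u] rep_at[OF c q(1)] q(2) by simp
    then have "chart_metric c x v w = g q (X v q) (X w q)"
      using chart_metric_at[OF c q(1), of "X v q" "X w q"] q(2) by simp
    then show "((\<lambda>p. g p (X v p) (X w p)) \<circ> chart_inv c) x = chart_metric c x v w"
      by (simp add: q chart_inv_chart[OF c q(1)])
  qed
  then show "\<exists>S. open S \<and> x0 \<in> S \<and> Ck_on k S (\<lambda>x. chart_metric c x v w)" using X(1,2) by blast
qed

lemma Ck_on_chart_metric_compose:
  fixes f :: "'d::euclidean_space \<Rightarrow> 'e"
  assumes c: "c \<in> A" and S: "open S" and f: "Ck_on k S f" "f ` S \<subseteq> img c" and a: "Ck_on k S a" and w: "Ck_on k S w"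
  shows "Ck_on k S (\<lambda>x. chart_metric c (f x) (a x) (w x))"
proof -
  have fx: "f x \<in> img c" if "x \<in> S" for x using f(2) that by auto
  have 1: "Ck_on k S (\<lambda>x. chart_metric c (f x) u v)" for u v
    by (rule Ck_on_compose[OF S chart(2)[OF c] f(1) Ck_on_chart_metric[OF c] f(2)])
  have 2: "Ck_on k S (\<lambda>x. chart_metric c (f x) (a x) v)" for v
    by (rule Ck_on_apply[OF S linear_chart_metric(2)[OF c fx] 1 a])
  show ?thesis by (rule Ck_on_apply[OF S linear_chart_metric(1)[OF c fx] 2 w])
qed

text \<open>The vector representing a smooth one-form is smooth, as it solves a linear system whose matrix is
  the Gram matrix of the metric.\<close>

lemma Ck_on_metric_dual:
  assumes c: "c \<in> A" and S: "open S" "S \<subseteq> img c"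
    and \<alpha>: "\<And>w. Ck_on k S (\<lambda>x. \<alpha> x w)" and y: "\<And>x w. x \<in> S \<Longrightarrow> chart_metric c x (y x) w = \<alpha> x w"
  shows "Ck_on k S y"
proof (rule Ck_on_solve[OF S(1), where L = "\<lambda>x v. \<Sum>b\<in>Basis. chart_metric c x v b *\<^sub>R b"])
  fix x assume x: "x \<in> S"
  then have xi: "x \<in> img c" using S by auto
  show lin: "linear (\<lambda>v. \<Sum>b\<in>Basis. chart_metric c x v b *\<^sub>R b)"
    by (rule linearI) (simp_all add: linear_add[OF linear_chart_metric(2)[OF c xi]]
        linear_cmul[OF linear_chart_metric(2)[OF c xi]] scaleR_left_distrib sum.distrib scaleR_sum_right)
  show "inj (\<lambda>v. \<Sum>b\<in>Basis. chart_metric c x v b *\<^sub>R b)"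
    unfolding linear_injective_0[OF lin]
  proof (intro allI impI)
    fix v assume 0: "(\<Sum>b\<in>Basis. chart_metric c x v b *\<^sub>R b) = 0"
    have "chart_metric c x v b = 0" if "b \<in> Basis" for b
      using 0 that inner_sum_left_Basis[OF that, of "chart_metric c x v"] by simp
    then have "chart_metric c x v v = 0"
      using linear_eq_sum_Basis[OF linear_chart_metric(1)[OF c xi], of v v] by simp
    then have "inv (T c (chart_inv c x)) v = 0" by (simp add: chart_metric_def Let_def form_eq_0)
    then show "v = 0"
      using T_inv[OF c chart_inv_in[OF c xi], of v] linear_0[OF linear_T[OF c chart_inv_in[OF c xi]]] by simp
  qed
  show "(\<Sum>b\<in>Basis. chart_metric c x (y x) b *\<^sub>R b) = (\<Sum>b\<in>Basis. \<alpha> x b *\<^sub>R b)" using y[OF x] by simp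
next
  show "Ck_on k S (\<lambda>x. \<Sum>b\<in>Basis. chart_metric c x v b *\<^sub>R b)" for v
    by (intro Ck_on_sum Ck_on_scaleR Ck_on_const S(1) Ck_on_subset[OF Ck_on_chart_metric[OF c] S(2)])
  show "Ck_on k S (\<lambda>x. \<Sum>b\<in>Basis. \<alpha> x b *\<^sub>R b)"
    by (intro Ck_on_sum Ck_on_scaleR Ck_on_const S(1) \<alpha>)
qed

end

section \<open>Riemannian submersions\<close>

locale submersion = M: metric_atlas A g + N: metric_atlas B h
  for A :: "('a::t2_space, 'e::euclidean_space) chart set" and g
    and B :: "('b::t2_space, 'f::euclidean_space) chart set" and h +
  fixes F :: "'a \<Rightarrow> 'b"
  assumes submersion: "riemannian_submersion A B g h F"
begin

abbreviation "dF \<equiv> differential A B F"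
abbreviation "V \<equiv> vertical A B F"
abbreviation "H \<equiv> horizontal A B g F"
abbreviation "hp \<equiv> hproj A B g F"
abbreviation "vp \<equiv> vproj A B g F"

text \<open>The submersion in charts \<open>c\<close> and \<open>d\<close>, and its domain.\<close>

abbreviation "loc c d \<equiv> snd d \<circ> F \<circ> chart_inv c"
abbreviation "ldom c d \<equiv> snd c ` (fst c \<inter> F -` fst d)"

lemma continuous_F: "continuous_on UNIV F"
  and loc_smooth: "c \<in> A \<Longrightarrow> d \<in> B \<Longrightarrow> smooth_on (ldom c d) (loc c d)"
  and surj_dF: "surj (dF p)"
  and dF_isometry: "x \<in> H p \<Longrightarrow> y \<in> H p \<Longrightarrow> h (F p) (dF p x) (dF p y) = g p x y"
  using submersion by (auto simp: riemannian_submersion_def smooth_map_def)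

lemma open_ldom: assumes "c \<in> A" "d \<in> B" shows "open (ldom c d)"
  using open_vimage[OF N.chart(1)[OF assms(2)] continuous_F] by (rule M.open_chart_image[OF assms(1)])

lemma loc_at: "c \<in> A \<Longrightarrow> q \<in> fst c \<Longrightarrow> loc c d (snd c q) = snd d (F q)"
  by (simp add: M.chart_inv_chart)

text \<open>The distinguished charts at \<open>q\<close> and at \<open>F q\<close>, in which the differential is defined, may be replaced
  by any charts.\<close>

lemma dF_chart:
  assumes c: "c \<in> A" "q \<in> fst c" and d: "d \<in> B" "F q \<in> fst d"
  shows "N.T d (F q) (dF q v) = D (loc c d) (snd c q) (M.T c q v)"
proof -
  let ?k = "N.ch (F q)"
  note k = N.chart_at_in[of "F q"]
  let ?x = "snd c q"
  have locd: "loc c ?k differentiable at ?x"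
    by (rule smooth_on_imp_differentiable[OF loc_smooth[OF c(1) k(1)]]) (use c k in auto)
  have dF: "dF q v = D (loc c ?k) ?x (M.T c q v)"
    unfolding differential_def using M.dir_deriv_chart[OF c, of "snd ?k \<circ> F"] locd by (simp add: o_assoc)
  have eq: "D (loc c d) ?x = D (\<lambda>x. (snd d \<circ> chart_inv ?k) (loc c ?k x)) ?x"
  proof (rule D_cong)
    have "open (F -` (fst d \<inter> fst ?k))"
      using open_vimage[OF open_Int[OF N.chart(1)[OF d(1)] N.chart(1)[OF k(1)]] continuous_F] .
    then show "open (snd c ` (fst c \<inter> F -` (fst d \<inter> fst ?k)))" by (rule M.open_chart_image[OF c(1)])
    show "?x \<in> snd c ` (fst c \<inter> F -` (fst d \<inter> fst ?k))" using c d k by auto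
    fix x assume "x \<in> snd c ` (fst c \<inter> F -` (fst d \<inter> fst ?k))"
    then show "loc c d x = (snd d \<circ> chart_inv ?k) (loc c ?k x)"
      using M.chart_inv_chart[OF c(1)] N.chart_inv_chart[OF k(1)] by auto
  qed
  have "D (loc c d) ?x (M.T c q v) = D (snd d \<circ> chart_inv ?k) (snd ?k (F q)) (dF q v)"
    unfolding eq
    using D_compose[OF locd, of "snd d \<circ> chart_inv ?k"] N.transition_differentiable[OF k(1) d(1) k(2) d(2)]
    unfolding loc_at[OF c] by (simp add: dF)
  then show ?thesis by (simp add: dir_deriv_def)
qed

lemma linear_dF: "linear (dF p)"
proof -
  note k = M.chart_at_in[of p] and l = N.chart_at_in[of "F p"]
  have "dF p v = D (loc (M.ch p) (N.ch (F p))) (snd (M.ch p) p) v" for v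
    using dF_chart[OF k l, of v] by (simp add: M.T_self N.T_self)
  moreover have "linear (D (loc (M.ch p) (N.ch (F p))) (snd (M.ch p) p))"
    by (rule smooth_on_linear_D[OF loc_smooth[OF k(1) l(1)]]) (use k l in auto)
  ultimately show ?thesis by (simp add: linear_iff)
qed

lemma V_iff: "u \<in> V p \<longleftrightarrow> dF p u = 0" by (simp add: vertical_def)

lemma H_iff: "x \<in> H p \<longleftrightarrow> (\<forall>u\<in>V p. g p x u = 0)" by (simp add: horizontal_def)

lemma HV: "x \<in> H p \<Longrightarrow> u \<in> V p \<Longrightarrow> g p x u = 0" by (simp add: horizontal_def)

lemma VH: "x \<in> H p \<Longrightarrow> u \<in> V p \<Longrightarrow> g p u x = 0" using HV M.sym by metis

lemma subspace_V: "subspace (V p)"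
  by (auto simp: subspace_def V_iff linear_0[OF linear_dF] linear_add[OF linear_dF] linear_cmul[OF linear_dF])

lemma subspace_H: "subspace (H p)"
  by (auto simp: subspace_def H_iff M.form_simps)

lemma HV_0: assumes "x \<in> H p" "x \<in> V p" shows "x = 0"
  using HV[OF assms] by (simp add: M.form_eq_0)

text \<open>Orthogonal projection to the vertical space leaves a horizontal remainder.\<close>

lemma HV_decomposition: "\<exists>y\<in>H p. v - y \<in> V p"
proof -
  obtain u where "u \<in> V p" "\<forall>w\<in>V p. g p (v - u) w = 0"
    using M.onb_projection[OF M.some_onb[OF subspace_V]] by blast
  then show ?thesis by (intro bexI[of _ "v - u"]) (auto simp: H_iff)
qed

lemma hp_eqI: assumes "y \<in> H p" "v - y \<in> V p" shows "hp p v = y"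
  unfolding hproj_def
proof (rule the_equality)
  fix z assume z: "z \<in> H p \<and> v - z \<in> V p"
  have "z - y \<in> H p" by (rule subspace_diff[OF subspace_H]) (use z assms in auto)
  moreover have "(v - y) - (v - z) \<in> V p" by (rule subspace_diff[OF subspace_V]) (use z assms in auto)
  ultimately show "z = y" using HV_0[of "z - y"] by simp
qed (use assms in simp)

lemma hp: "hp p v \<in> H p" "v - hp p v \<in> V p"
  using HV_decomposition[of p v] hp_eqI by blast+

lemma vp_eq: "vp p v = v - hp p v"
  unfolding vproj_def
proof (rule the_equality)
  fix u assume "u \<in> V p \<and> v - u \<in> H p"
  then show "u = v - hp p v" using hp_eqI[of "v - u" p v] by simp
qed (use hp in simp)

lemma hp_H: "x \<in> H p \<Longrightarrow> hp p x = x"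
  by (rule hp_eqI) (use subspace_0[OF subspace_V] in auto)

lemma hp_V: "u \<in> V p \<Longrightarrow> hp p u = 0"
  by (rule hp_eqI) (use subspace_0[OF subspace_H] in auto)

lemma linear_hp: "linear (hp p)"
proof (rule linearI)
  fix v w r
  have "v + w - (hp p v + hp p w) = (v - hp p v) + (w - hp p w)" by simp
  then show "hp p (v + w) = hp p v + hp p w"
    by (intro hp_eqI) (simp_all only: subspace_add[OF subspace_H] subspace_add[OF subspace_V] hp)
  have "r *\<^sub>R v - r *\<^sub>R hp p v = r *\<^sub>R (v - hp p v)" by (simp add: algebra_simps)
  then show "hp p (r *\<^sub>R v) = r *\<^sub>R hp p v"
    by (intro hp_eqI) (simp_all only: subspace_scale[OF subspace_H] subspace_scale[OF subspace_V] hp)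
qed

lemma dF_hp: "dF p (hp p v) = dF p v"
  using hp(2)[of v p] by (simp add: V_iff linear_diff[OF linear_dF])

lemma metric_hp: assumes "x \<in> H p" shows "g p x (hp p v) = g p x v" "g p (hp p v) x = g p v x"
proof -
  show "g p x (hp p v) = g p x v" using HV[OF assms hp(2)[of v p]] by (simp add: M.form_simps)
  then show "g p (hp p v) x = g p v x" by (simp add: M.sym)
qed

lemma metric_vp: "u \<in> V p \<Longrightarrow> g p (vp p v) u = g p v u"
  using HV[OF hp(1)] by (simp add: vp_eq M.form_simps)

text \<open>\<open>dF\<close> identifies the horizontal space with the tangent space of the base, so the pulled-back
  metric agrees with \<open>g\<close> as soon as one argument is horizontal.\<close>

lemma pullback_metric: assumes "x \<in> H p" shows "h (F p) (dF p v) (dF p x) = g p v x"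
  using dF_isometry[OF hp(1) assms, of v] by (simp add: dF_hp metric_hp[OF assms])

definition lift :: "'a \<Rightarrow> 'f \<Rightarrow> 'e" where "lift p k = hp p (inv (dF p) k)"

lemma dF_lift: "dF p (lift p k) = k"
  by (simp add: lift_def dF_hp surj_f_inv_f[OF surj_dF])

lemma lift_H: "lift p k \<in> H p" by (simp add: lift_def hp)

lemma H_eqI: assumes "x \<in> H p" "y \<in> H p" "dF p x = dF p y" shows "x = y"
proof -
  have "x - y \<in> V p" using assms(3) by (simp add: V_iff linear_diff[OF linear_dF])
  then show ?thesis using HV_0[of "x - y" p] subspace_diff[OF subspace_H assms(1,2)] by simp
qed

lemma lift_dF: "lift p (dF p v) = hp p v"
  by (rule H_eqI[OF lift_H hp(1)]) (simp add: dF_lift dF_hp)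

lemma linear_lift: "linear (lift p)"
proof (rule linearI)
  show "lift p (k + l) = lift p k + lift p l" for k l
    by (rule H_eqI[of _ p]) (simp_all add: lift_H subspace_add[OF subspace_H] dF_lift linear_add[OF linear_dF])
  show "lift p (r *\<^sub>R k) = r *\<^sub>R lift p k" for k r
    by (rule H_eqI[of _ p]) (simp_all add: lift_H subspace_scale[OF subspace_H] dF_lift linear_cmul[OF linear_dF])
qed

text \<open>The horizontal lifts of the constant fields in a chart \<open>d\<close> of the base, in the chart \<open>c\<close>.\<close>

definition clift :: "('a, 'e) chart \<Rightarrow> ('b, 'f) chart \<Rightarrow> 'e \<Rightarrow> 'f \<Rightarrow> 'e" where
  "clift c d x k = (let q = chart_inv c x in M.T c q (lift q (inv (N.T d (F q)) k)))"

context
  fixes c d assumes c: "c \<in> A" and d: "d \<in> B"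
begin

lemma clift_at: "q \<in> fst c \<Longrightarrow> clift c d (snd c q) k = M.T c q (lift q (inv (N.T d (F q)) k))"
  by (simp add: clift_def M.chart_inv_chart[OF c])

lemma clift_hp:
  assumes "q \<in> fst c" "F q \<in> fst d"
  shows "M.T c q (hp q v) = clift c d (snd c q) (D (loc c d) (snd c q) (M.T c q v))"
  unfolding clift_at[OF assms(1)] dF_chart[OF c assms(1) d assms(2), symmetric]
  by (simp add: N.inv_T[OF d assms(2)] lift_dF)

lemma linear_clift: assumes "x \<in> ldom c d" shows "linear (clift c d x)"
proof -
  obtain q where q: "q \<in> fst c" "F q \<in> fst d" "x = snd c q" using assms by auto
  have "linear (M.T c q \<circ> (lift q \<circ> inv (N.T d (F q))))"
    by (intro linear_compose M.linear_T[OF c q(1)] linear_lift N.linear_inv_T[OF d q(2)])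
  then show ?thesis using q by (simp add: linear_iff clift_at)
qed

lemma D_loc_clift: assumes "x \<in> ldom c d" shows "D (loc c d) x (clift c d x k) = k"
proof -
  obtain q where q: "q \<in> fst c" "F q \<in> fst d" "x = snd c q" using assms by auto
  then show ?thesis
    by (simp add: clift_at dF_chart[OF c q(1) d q(2), symmetric] dF_lift N.T_inv[OF d q(2)])
qed

text \<open>The lift of \<open>k\<close> is the vector that represents the one-form \<open>w \<mapsto> h(k, dF w)\<close> with respect to \<open>g\<close>,
  so it depends smoothly on the point.\<close>

lemma Ck_on_clift: "Ck_on k (ldom c d) (\<lambda>x. clift c d x v)"
proof (rule M.Ck_on_metric_dual[OF c open_ldom[OF c d]])
  show "ldom c d \<subseteq> M.img c" by auto
  show "Ck_on k (ldom c d) (\<lambda>x. N.chart_metric d (loc c d x) v (D (loc c d) x w))" for w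
    by (rule N.Ck_on_chart_metric_compose[OF d open_ldom[OF c d] smooth_on_Ck[OF loc_smooth[OF c d]] _
          Ck_on_const Ck_on_D[OF smooth_on_Ck[OF loc_smooth[OF c d]]]])
      (use M.chart_inv_chart[OF c] in auto)
  fix x w assume "x \<in> ldom c d"
  then obtain q where q: "q \<in> fst c" "F q \<in> fst d" "x = snd c q" by auto
  define w' where "w' = inv (M.T c q) w"
  have w: "w = M.T c q w'" by (simp add: w'_def M.T_inv[OF c q(1)])
  define v' where "v' = inv (N.T d (F q)) v"
  have v: "v = N.T d (F q) v'" by (simp add: v'_def N.T_inv[OF d q(2)])
  have "M.chart_metric c x (clift c d x v) w = g q (lift q v') w'"
    by (simp only: q(3) w clift_at[OF q(1)] M.chart_metric_at[OF c q(1)] v'_def)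
  also have "\<dots> = h (F q) v' (dF q w')"
    using pullback_metric[OF lift_H, of q w' v'] by (simp add: dF_lift M.sym[of _ w'] N.sym[of _ v'])
  also have "\<dots> = N.chart_metric d (loc c d x) v (D (loc c d) x w)"
    by (simp only: q(3) w v loc_at[OF c q(1)] dF_chart[OF c q(1) d q(2), symmetric] N.chart_metric_at[OF d q(2)])
  finally show "M.chart_metric c x (clift c d x v) w = N.chart_metric d (loc c d x) v (D (loc c d) x w)" .
qed

end

text \<open>The horizontal part of a vector is the lift of its image under \<open>dF\<close>, which reduces the smoothness
  of the projection to that of the lift.\<close>

lemma smooth_hp:
  assumes X: "smooth_field A X" shows "smooth_field A (\<lambda>q. hp q (X q))"
  unfolding smooth_field_def smooth_on_def
proof (intro ballI allI, rule Ck_on_local)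
  fix c k x assume c: "c \<in> A" and "x \<in> M.img c"
  then obtain p where p: "p \<in> fst c" "x = snd c p" by auto
  define d where "d = N.ch (F p)"
  have d: "d \<in> B" "F p \<in> fst d" using N.chart_at_in by (auto simp: d_def)
  note S = open_ldom[OF c d(1)]
  have sub: "ldom c d \<subseteq> M.img c" by auto
  have Xk: "Ck_on k (ldom c d) (M.rep c X)"
    by (rule Ck_on_subset[OF smooth_on_Ck[OF M.smooth_field_rep[OF X c]] sub])
  have 1: "Ck_on k (ldom c d) (\<lambda>x. D (loc c d) x (M.rep c X x))"
    by (rule Ck_on_apply[OF S smooth_on_linear_D[OF loc_smooth[OF c d(1)]]
          Ck_on_D[OF smooth_on_Ck[OF loc_smooth[OF c d(1)]]] Xk])
  have "Ck_on k (ldom c d) (\<lambda>x. clift c d x (D (loc c d) x (M.rep c X x)))"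
    by (rule Ck_on_apply[OF S linear_clift[OF c d(1)] Ck_on_clift[OF c d(1)] 1])
  then have "Ck_on k (ldom c d) (M.rep c (\<lambda>q. hp q (X q)))"
    by (rule Ck_on_congI[OF _ S]) (auto simp: M.rep_at[OF c] clift_hp[OF c d(1)])
  then show "\<exists>S. open S \<and> x \<in> S \<and> Ck_on k S (M.rep c (\<lambda>q. hp q (X q)))"
    using S p d(2) by blast
qed

lemma smooth_vp: assumes "smooth_field A X" shows "smooth_field A (\<lambda>q. vp q (X q))"
  unfolding vp_eq by (intro M.smooth_field_diff assms smooth_hp)

lemma vp_V: "vp p v \<in> V p" by (simp add: vp_eq hp)

end

section \<open>O'Neill's tensor\<close>

lemma dir_deriv_const: "dir_deriv A (\<lambda>q. c) p v = 0"
  by (simp add: dir_deriv_def o_def)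

locale submersion_connection = submersion A g B h F
  for A :: "('a::t2_space, 'e::euclidean_space) chart set" and g
    and B :: "('b::t2_space, 'f::euclidean_space) chart set" and h and F +
  fixes nabla :: "('a \<Rightarrow> 'e) \<Rightarrow> ('a \<Rightarrow> 'e) \<Rightarrow> 'a \<Rightarrow> 'e"
  assumes levi_civita: "levi_civita A g nabla"
begin

abbreviation "HF \<equiv> sections A H"
abbreviation "VF \<equiv> sections A V"
abbreviation "bracket \<equiv> lie_bracket A"

lemma HF: "X \<in> HF \<Longrightarrow> smooth_field A X" "X \<in> HF \<Longrightarrow> X p \<in> H p"
  and VF: "U \<in> VF \<Longrightarrow> smooth_field A U" "U \<in> VF \<Longrightarrow> U p \<in> V p"
  by (auto simp: sections_def)

lemma torsion_free:
  "smooth_field A X \<Longrightarrow> smooth_field A Y \<Longrightarrow> nabla X Y p - nabla Y X p = bracket X Y p"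
  using levi_civita by (simp add: levi_civita_def)

lemma metric_compatible:
  "smooth_field A X \<Longrightarrow> smooth_field A Y \<Longrightarrow> smooth_field A Z \<Longrightarrow>
    dir_deriv A (\<lambda>q. g q (Y q) (Z q)) p (X p) = g p (nabla X Y p) (Z p) + g p (Y p) (nabla X Z p)"
  using levi_civita by (simp add: levi_civita_def)

lemma orthogonal_compatible:
  assumes "smooth_field A X" "smooth_field A Y" "smooth_field A Z" "\<And>q. g q (Y q) (Z q) = 0"
  shows "g p (nabla X Y p) (Z p) = - g p (Y p) (nabla X Z p)"
  using metric_compatible[OF assms(1-3), of p] by (simp add: assms(4) dir_deriv_const)

text \<open>The flow of a vertical field preserves the fibres, hence the pulled-back metric, with which
  \<open>g\<close> agrees on horizontal vectors: infinitesimally, the Lie derivative of \<open>g\<close> along a vertical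
  field vanishes on horizontal vectors.\<close>

lemma lie_derivative_vertical:
  assumes X: "X \<in> HF" and Y: "Y \<in> HF" and U: "U \<in> VF"
  shows "dir_deriv A (\<lambda>q. g q (X q) (Y q)) p (U p)
    = g p (bracket U X p) (Y p) + g p (X p) (bracket U Y p)"
proof -
  define c where "c = M.ch p"
  define d where "d = N.ch (F p)"
  have c: "c \<in> A" "p \<in> fst c" and d: "d \<in> B" "F p \<in> fst d"
    using M.chart_at_in N.chart_at_in by (auto simp: c_def d_def)
  define x0 where "x0 = snd c p"
  define f where "f = loc c d"
  define S where "S = ldom c d"
  have S: "open S" "x0 \<in> S" unfolding S_def x0_def using open_ldom[OF c(1) d(1)] c d by auto
  have SE: "\<exists>q. q \<in> fst c \<and> F q \<in> fst d \<and> x = snd c q" if "x \<in> S" for x using that by (auto simp: S_def)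
  have f: "Ck_on k S f" for k unfolding f_def S_def by (rule smooth_on_Ck[OF loc_smooth[OF c(1) d(1)]])
  have fimg: "f ` S \<subseteq> N.img d" unfolding f_def S_def using M.chart_inv_chart[OF c(1)] by auto
  have linf: "linear (D f x)" if "x \<in> S" for x using linear_D[OF f[of "Suc 0"] that] .
  have fd: "f differentiable at x0" using f[of "Suc 0"] S by simp
  have Dr: "D f (snd c q) (M.rep c Z (snd c q)) = N.T d (F q) (dF q (Z q))"
    if "q \<in> fst c" "F q \<in> fst d" for q Z
    by (simp only: f_def dF_chart[OF c(1) that(1) d(1) that(2)] M.rep_at[OF c(1) that(1)])
  have rZ: "M.rep c Z x0 = Z p" for Z unfolding x0_def M.rep_at[OF c] by (simp add: c_def M.T_self)
  have sm: "Ck_on k S (\<lambda>z. D f z (M.rep c Z z))" if "smooth_field A Z" for Z k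
  proof (rule Ck_on_apply[OF S(1) linf])
    show "Ck_on k S (\<lambda>z. D f z v)" for v by (rule Ck_on_D[OF f])
    show "Ck_on k S (M.rep c Z)"
      by (rule Ck_on_subset[OF smooth_on_Ck[OF M.smooth_field_rep[OF that c(1)]]]) (auto simp: S_def)
  qed
  have repd: "M.rep c Z differentiable at x0" if "smooth_field A Z" for Z
    unfolding x0_def by (rule M.rep_differentiable[OF that c])
  have push: "D (\<lambda>z. D f z (M.rep c Z z)) x0 (U p) = D f x0 (bracket U Z p)" if Z: "smooth_field A Z" for Z
  proof -
    have "D (\<lambda>z. D f z (M.rep c U z)) x0 = D (\<lambda>z. 0) x0"
    proof (rule D_cong[OF S])
      fix z assume "z \<in> S"
      then obtain q where q: "q \<in> fst c" "F q \<in> fst d" "z = snd c q" using SE by blast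
      show "D f z (M.rep c U z) = 0" unfolding q(3) Dr[OF q(1,2)]
        using VF(2)[OF U, of q] linear_0[OF N.linear_T[OF d(1) q(2)]] by (simp add: V_iff)
    qed
    then have "D (\<lambda>z. D f z (M.rep c Z z)) x0 (U p)
        = D f x0 (D (M.rep c Z) x0 (U p) - D (M.rep c U) x0 (Z p))"
      using bracket_pushforward[OF f S repd[OF VF(1)[OF U]] repd[OF Z]] by (simp add: rZ)
    also have "D (M.rep c Z) x0 (U p) - D (M.rep c U) x0 (Z p) = bracket U Z p"
      using M.lie_bracket_chart[OF c VF(1)[OF U] Z]
      by (simp add: x0_def[symmetric] rZ) (simp add: c_def M.T_self)
    finally show ?thesis .
  qed
  define P where "P z v w = N.chart_metric d (f z) v w" for z v w
  define a where "a z = D f z (M.rep c X z)" for z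
  define b where "b z = D f z (M.rep c Y z)" for z
  have a: "Ck_on k S a" and b: "Ck_on k S b" for k unfolding a_def b_def by (intro sm HF X Y)+
  have Pk: "Ck_on k S (\<lambda>z. P z (v z) (w z))" if "Ck_on k S v" "Ck_on k S w" for k v w
    unfolding P_def by (rule N.Ck_on_chart_metric_compose[OF d(1) S(1) f fimg that])
  have diff: "k differentiable at x0" if "Ck_on (Suc 0) S k" for k :: "'e \<Rightarrow> real" using that S by simp
  have lP: "linear (P z v)" "linear (\<lambda>v. P z v w)" if "z \<in> S" for z v w
    unfolding P_def using N.linear_chart_metric[OF d(1)] fimg that by auto
  have Pat: "P (snd c q) (N.T d (F q) v) (N.T d (F q) w) = h (F q) v w" if "q \<in> fst c" "F q \<in> fst d" for q v w
    unfolding P_def f_def loc_at[OF c(1) that(1)] by (rule N.chart_metric_at[OF d(1) that(2)])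
  have Df: "D f x0 v = N.T d (F p) (dF p v)" for v
    unfolding f_def x0_def dF_chart[OF c d] by (simp add: c_def M.T_self)
  have P0: "P x0 (D f x0 v) (D f x0 w) = h (F p) (dF p v) (dF p w)" for v w
    unfolding Df unfolding x0_def by (rule Pat[OF c(2) d(2)])
  have "dir_deriv A (\<lambda>q. g q (X q) (Y q)) p (U p) = D ((\<lambda>q. g q (X q) (Y q)) \<circ> chart_inv c) x0 (U p)"
    by (simp add: dir_deriv_def c_def x0_def)
  also have "D ((\<lambda>q. g q (X q) (Y q)) \<circ> chart_inv c) x0 = D (\<lambda>z. P z (a z) (b z)) x0"
  proof (rule D_cong[OF S])
    fix z assume "z \<in> S"
    then obtain q where q: "q \<in> fst c" "F q \<in> fst d" "z = snd c q" using SE by blast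
    show "((\<lambda>q. g q (X q) (Y q)) \<circ> chart_inv c) z = P z (a z) (b z)"
      unfolding a_def b_def q(3) Dr[OF q(1,2)] Pat[OF q(1,2)] o_apply M.chart_inv_chart[OF c(1) q(1)]
      by (rule dF_isometry[OF HF(2)[OF X] HF(2)[OF Y], symmetric])
  qed
  also have "D (\<lambda>z. P z (a z) (b z)) x0 (U p) = D (\<lambda>z. P z (a z) (b x0)) x0 (U p) + P x0 (a x0) (D b x0 (U p))"
    by (rule fun_cong[OF D_eq[OF has_derivative_apply[OF S lP(1) diff[OF Pk[OF a Ck_on_const]]
            Ck_on_has_derivative[OF b S(2)]]]])
  also have "D (\<lambda>z. P z (a z) (b x0)) x0 (U p) = D (\<lambda>z. P z (a x0) (b x0)) x0 (U p) + P x0 (D a x0 (U p)) (b x0)"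
    by (rule fun_cong[OF D_eq[OF has_derivative_apply[OF S lP(2) diff[OF Pk[OF Ck_on_const Ck_on_const]]
            Ck_on_has_derivative[OF a S(2)]]]])
  also have "D (\<lambda>z. P z (a x0) (b x0)) x0 (U p) = 0"
  proof -
    have "f x0 \<in> N.img d" using fimg S by auto
    then have "(\<lambda>y. N.chart_metric d y (a x0) (b x0)) differentiable at (f x0)"
      by (rule differentiableI[OF Ck_on_has_derivative[OF N.Ck_on_chart_metric[OF d(1), of "Suc 0"]]])
    moreover have "D f x0 (U p) = 0"
      using Dr[OF c(2) d(2), of U] VF(2)[OF U, of p] linear_0[OF N.linear_T[OF d]]
      unfolding x0_def[symmetric] rZ by (simp add: V_iff)
    ultimately show ?thesis
      unfolding P_def using D_compose[OF fd, of "\<lambda>y. N.chart_metric d y (a x0) (b x0)"]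
        linear_0[OF linear_frechet_derivative] by simp
  qed
  also have "P x0 (D a x0 (U p)) (b x0) = g p (bracket U X p) (Y p)"
    unfolding a_def b_def push[OF HF(1)[OF X]] rZ P0 by (rule pullback_metric[OF HF(2)[OF Y]])
  also have "P x0 (a x0) (D b x0 (U p)) = g p (X p) (bracket U Y p)"
    unfolding a_def b_def push[OF HF(1)[OF Y]] rZ P0
    by (subst N.sym, subst M.sym) (rule pullback_metric[OF HF(2)[OF X]])
  finally show ?thesis by simp
qed

text \<open>The equation \<open>g(\<nabla>\<^sub>X U, Y) + g(X, \<nabla>\<^sub>Y U) = 0\<close> is the vanishing of the Lie derivative of \<open>g\<close> along
  \<open>U\<close>, rewritten with a metric and torsion-free connection; moving the derivative off \<open>U\<close> by orthogonality gives the claim.\<close>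

lemma nabla_skew:
  assumes X: "X \<in> HF" and Y: "Y \<in> HF" and U: "U \<in> VF"
  shows "g p (nabla X Y p) (U p) = - g p (nabla Y X p) (U p)"
proof -
  note s = HF(1)[OF X] HF(1)[OF Y] VF(1)[OF U]
  have 1: "g p (nabla X Y p) (U p) = - g p (Y p) (nabla X U p)"
    by (rule orthogonal_compatible[OF s(1,2,3)]) (simp add: HV HF(2)[OF Y] VF(2)[OF U])
  have 2: "g p (nabla Y X p) (U p) = - g p (X p) (nabla Y U p)"
    by (rule orthogonal_compatible[OF s(2,1,3)]) (simp add: HV HF(2)[OF X] VF(2)[OF U])
  have "g p (nabla U X p) (Y p) + g p (X p) (nabla U Y p)
      = g p (bracket U X p) (Y p) + g p (X p) (bracket U Y p)"
    using metric_compatible[OF s(3,1,2), of p] lie_derivative_vertical[OF X Y U, of p] by simp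
  then have "g p (nabla X U p) (Y p) + g p (X p) (nabla Y U p) = 0"
    unfolding torsion_free[OF s(3,1), symmetric] torsion_free[OF s(3,2), symmetric]
    by (simp add: M.form_simps)
  then show ?thesis unfolding 1 2 by (simp add: M.sym[of p "nabla X U p"])
qed

lemma V_eqI: assumes "v \<in> V p" "w \<in> V p" "\<And>u. u \<in> V p \<Longrightarrow> g p v u = g p w u" shows "v = w"
proof -
  have "v - w \<in> V p" by (rule subspace_diff[OF subspace_V assms(1,2)])
  then have "g p (v - w) (v - w) = 0"
    unfolding bilinear_lsub[OF M.bil, of p v w] using assms(3)[of "v - w"] by simp
  then show ?thesis by (simp add: M.form_eq_0)
qed

text \<open>Extensions of a tangent vector that stay inside one of the two distributions.\<close>

definition Hext :: "'a \<Rightarrow> 'e \<Rightarrow> 'a \<Rightarrow> 'e" where "Hext p x q = hp q (ext_field A p x q)"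
definition Vext :: "'a \<Rightarrow> 'e \<Rightarrow> 'a \<Rightarrow> 'e" where "Vext p x q = vp q (ext_field A p x q)"

lemma Hext: "Hext p x \<in> HF" "x \<in> H p \<Longrightarrow> Hext p x p = x"
proof -
  show "Hext p x \<in> HF"
    using smooth_hp[OF M.ext_field(1)] by (simp add: Hext_def[abs_def] sections_def hp)
  show "x \<in> H p \<Longrightarrow> Hext p x p = x" by (simp add: Hext_def M.ext_field(2) hp_H)
qed

lemma Vext: "Vext p u \<in> VF" "u \<in> V p \<Longrightarrow> Vext p u p = u"
proof -
  show "Vext p u \<in> VF"
    using smooth_vp[OF M.ext_field(1)] by (simp add: Vext_def[abs_def] sections_def vp_V)
  show "u \<in> V p \<Longrightarrow> Vext p u p = u" by (simp add: Vext_def M.ext_field(2) vp_eq hp_V)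
qed

text \<open>\<open>g(\<nabla>\<^sub>X Y, U) = - g(Y, \<nabla>\<^sub>X U)\<close> depends on \<open>Y\<close> through its value only, and by skew-symmetry
  the same holds for \<open>X\<close>.\<close>

lemma nabla_vertical_part:
  assumes X: "X \<in> HF" and Y: "Y \<in> HF" and u: "u \<in> V p"
  shows "g p (vp p (nabla X Y p)) u = - g p (Y p) (nabla X (Vext p u) p)"
proof -
  note U = Vext(1)[of p u] Vext(2)[OF u]
  have "g p (nabla X Y p) (Vext p u p) = - g p (Y p) (nabla X (Vext p u) p)"
    by (rule orthogonal_compatible[OF HF(1)[OF X] HF(1)[OF Y] VF(1)[OF U(1)]]) (simp add: HV HF(2)[OF Y] VF(2)[OF U(1)])
  then show ?thesis by (simp add: metric_vp[OF u] U(2))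
qed

lemma vp_nabla_skew:
  assumes X: "X \<in> HF" and Y: "Y \<in> HF" shows "vp p (nabla X Y p) = - vp p (nabla Y X p)"
proof (rule V_eqI)
  show "- vp p (nabla Y X p) \<in> V p" by (rule subspace_neg[OF subspace_V vp_V])
  fix u assume u: "u \<in> V p"
  show "g p (vp p (nabla X Y p)) u = g p (- vp p (nabla Y X p)) u"
    using nabla_skew[OF X Y Vext(1)[of p u], of p] by (simp add: M.form_simps metric_vp[OF u] Vext(2)[OF u])
qed (rule vp_V)

lemma vp_nabla_cong:
  assumes "X \<in> HF" "Y \<in> HF" "X' \<in> HF" "Y' \<in> HF" "X p = X' p" "Y p = Y' p"
  shows "vp p (nabla X Y p) = vp p (nabla X' Y' p)"
proof -
  have *: "vp p (nabla X Y p) = vp p (nabla X Y' p)" if "X \<in> HF" "Y \<in> HF" "Y' \<in> HF" "Y p = Y' p" for X Y Y'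
    by (rule V_eqI[OF vp_V vp_V]) (simp add: nabla_vertical_part that)
  have "vp p (nabla X Y p) = - vp p (nabla Y' X p)"
    using *[OF assms(1,2,4,6)] vp_nabla_skew[OF assms(1,4)] by simp
  also have "\<dots> = - vp p (nabla Y' X' p)" using *[OF assms(4,1,3,5)] by simp
  also have "\<dots> = vp p (nabla X' Y' p)" using vp_nabla_skew[OF assms(3,4), of p] by simp
  finally show ?thesis .
qed

text \<open>The second summand of O'Neill's tensor vanishes here: the vertical part of \<open>G\<close> is orthogonal to
  horizontal fields and zero at \<open>p\<close>, so the horizontal part of its derivative vanishes at \<open>p\<close>.\<close>

lemma oneill_A_horizontal:
  assumes E: "smooth_field A E" and G: "smooth_field A G" and GH: "G p \<in> H p"
  shows "oneill_A A B g F nabla E G p = vp p (nabla (\<lambda>q. hp q (E q)) (\<lambda>q. hp q (G q)) p)"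
proof -
  define n where "n = nabla (\<lambda>q. hp q (E q)) (\<lambda>q. vp q (G q)) p"
  define Z where "Z = Hext p (hp p n)"
  have Z: "Z \<in> HF" "Z p = hp p n" using Hext hp by (auto simp: Z_def)
  have "g p n (Z p) = - g p (vp p (G p)) (nabla (\<lambda>q. hp q (E q)) Z p)"
    unfolding n_def
    by (rule orthogonal_compatible[OF smooth_hp[OF E] smooth_vp[OF G] HF(1)[OF Z(1)]])
      (simp add: VH[OF HF(2)[OF Z(1)] vp_V])
  then have "g p (hp p n) (hp p n) = 0"
    by (simp add: vp_eq hp_H[OF GH] M.form_simps Z(2) metric_hp(2)[OF hp(1)])
  then have "hp p n = 0" by (simp add: M.form_eq_0)
  then show ?thesis by (simp add: oneill_A_def Let_def n_def)
qed

abbreviation "a p \<equiv> oneill_A_at A B g F nabla p"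

lemma oneill_A_sections:
  assumes X: "X \<in> HF" and Y: "Y \<in> HF"
  shows "oneill_A A B g F nabla X Y p = vp p (nabla X Y p)" "a p (X p) (Y p) = vp p (nabla X Y p)"
proof -
  have e: "(\<lambda>q. hp q (Z q)) = Z" if "Z \<in> HF" for Z using hp_H[OF HF(2)[OF that]] by (rule ext)
  show "oneill_A A B g F nabla X Y p = vp p (nabla X Y p)"
    using oneill_A_horizontal[OF HF(1)[OF X] HF(1)[OF Y] HF(2)[OF Y]] by (simp only: e[OF X] e[OF Y])
  have "a p (X p) (Y p) = vp p (nabla (Hext p (X p)) (Hext p (Y p)) p)"
    unfolding oneill_A_at_def Hext_def[abs_def]
    by (rule oneill_A_horizontal) (simp_all add: M.ext_field HF(2)[OF Y])
  also have "\<dots> = vp p (nabla X Y p)"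
    by (rule vp_nabla_cong[OF Hext(1) Hext(1) X Y]) (simp_all add: Hext(2) HF(2)[OF X] HF(2)[OF Y])
  finally show "a p (X p) (Y p) = vp p (nabla X Y p)" .
qed

lemma oneill_eq_nabla: "x \<in> H p \<Longrightarrow> y \<in> H p \<Longrightarrow> a p x y = vp p (nabla (Hext p x) (Hext p y) p)"
  using oneill_A_sections(2)[OF Hext(1)[of p x] Hext(1)[of p y], of p] by (simp add: Hext(2))

lemma oneill_vertical_valued: "x \<in> H p \<Longrightarrow> y \<in> H p \<Longrightarrow> a p x y \<in> V p"
  by (simp add: oneill_eq_nabla vp_V)

lemma oneill_skew: "x \<in> H p \<Longrightarrow> y \<in> H p \<Longrightarrow> a p x y = - a p y x"
  unfolding oneill_eq_nabla by (rule vp_nabla_skew[OF Hext(1) Hext(1)])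

lemma oneill_component:
  "x \<in> H p \<Longrightarrow> y \<in> H p \<Longrightarrow> u \<in> V p \<Longrightarrow> g p (a p x y) u = - g p y (nabla (Hext p x) (Vext p u) p)"
  using nabla_vertical_part[OF Hext(1)[of p x] Hext(1)[of p y], of u p] by (simp add: oneill_eq_nabla Hext(2))

lemma oneill_bracket:
  assumes X: "X \<in> HF" and Y: "Y \<in> HF" shows "2 *\<^sub>R a p (X p) (Y p) = vp p (bracket X Y p)"
proof -
  have "vp p (bracket X Y p) = vp p (nabla X Y p) - vp p (nabla Y X p)"
    unfolding torsion_free[OF HF(1)[OF X] HF(1)[OF Y], symmetric] vp_eq
    by (simp add: linear_diff[OF linear_hp])
  then show ?thesis using vp_nabla_skew[OF X Y, of p] oneill_A_sections(2)[OF X Y, of p]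
    by (simp add: scaleR_2)
qed

text \<open>Inserting the horizontal projection turns the components of the tensor into bilinear forms on the
  whole tangent space.\<close>

lemma bilinear_oneill: assumes u: "u \<in> V p" shows "bilinear (\<lambda>x y. g p (a p (hp p x) (hp p y)) u)"
proof -
  have 1: "linear (\<lambda>y. g p (a p (hp p x) (hp p y)) u)" for x
    unfolding oneill_component[OF hp(1) hp(1) u]
    by (rule linearI) (simp_all add: linear_add[OF linear_hp] linear_cmul[OF linear_hp] M.form_simps)
  have "g p (a p (hp p x) (hp p y)) u = - g p (a p (hp p y) (hp p x)) u" for x y
    by (subst oneill_skew[OF hp(1) hp(1)]) (rule bilinear_lneg[OF M.bil])
  then have e: "(\<lambda>x. g p (a p (hp p x) (hp p y)) u) = (\<lambda>x. - g p (a p (hp p y) (hp p x)) u)" for y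
    by (rule ext)
  have "linear (\<lambda>x. g p (a p (hp p x) (hp p y)) u)" for y
    by (subst e) (rule linear_compose_neg[OF 1])
  with 1 show ?thesis by (simp add: bilinear_def)
qed

text \<open>The tensor on sections is determined by its pointwise values, and every horizontal vector is the
  value of a horizontal section.\<close>

lemma A_zero_iff:
  "(\<forall>X\<in>HF. \<forall>Y\<in>HF. \<forall>p. oneill_A A B g F nabla X Y p = 0) \<longleftrightarrow> (\<forall>p. \<forall>x\<in>H p. \<forall>y\<in>H p. a p x y = 0)"
proof
  assume L: "\<forall>X\<in>HF. \<forall>Y\<in>HF. \<forall>p. oneill_A A B g F nabla X Y p = 0"
  show "\<forall>p. \<forall>x\<in>H p. \<forall>y\<in>H p. a p x y = 0"
  proof (intro allI ballI)
    fix p x y assume "x \<in> H p" "y \<in> H p"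
    then have "a p x y = oneill_A A B g F nabla (Hext p x) (Hext p y) p"
      by (simp only: oneill_eq_nabla oneill_A_sections(1)[OF Hext(1) Hext(1)])
    then show "a p x y = 0" using L Hext(1) by simp
  qed
next
  assume R: "\<forall>p. \<forall>x\<in>H p. \<forall>y\<in>H p. a p x y = 0"
  show "\<forall>X\<in>HF. \<forall>Y\<in>HF. \<forall>p. oneill_A A B g F nabla X Y p = 0"
  proof (intro ballI allI)
    fix X Y p assume X: "X \<in> HF" and Y: "Y \<in> HF"
    have "oneill_A A B g F nabla X Y p = a p (X p) (Y p)"
      by (simp only: oneill_A_sections[OF X Y])
    then show "oneill_A A B g F nabla X Y p = 0" using R HF(2)[OF X] HF(2)[OF Y] by simp
  qed
qed

end

section \<open>Casorati curvatures\<close>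

context submersion_connection
begin

text \<open>For an orthonormal basis \<open>E\<close> of a subspace of the horizontal space this is the squared
  Hilbert--Schmidt norm of \<open>A\<close> restricted to that subspace.\<close>

definition tensor_norm2 :: "'a \<Rightarrow> 'e set \<Rightarrow> real" where
  "tensor_norm2 p E = (\<Sum>u\<in>some_onb (g p) (V p). \<Sum>x\<in>E. \<Sum>y\<in>E. (g p (a p x y) u)\<^sup>2)"

abbreviation "onbH p \<equiv> some_onb (g p) (H p)"
abbreviation "onbV p \<equiv> some_onb (g p) (V p)"

lemma onbH: "orthonormal_basis (g p) (H p) (onbH p)" and onbV: "orthonormal_basis (g p) (V p) (onbV p)"
  by (rule M.some_onb[OF subspace_H], rule M.some_onb[OF subspace_V])

lemma casorati_eq: "casorati A B g F nabla p L = tensor_norm2 p (some_onb (g p) L) / real (dim L)"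
  by (simp add: casorati_def tensor_norm2_def Let_def)

lemma tensor_norm2_nonneg: "tensor_norm2 p E \<ge> 0"
  unfolding tensor_norm2_def by (intro sum_nonneg) simp

lemma tensor_norm2_hp:
  assumes "E \<subseteq> H p"
  shows "tensor_norm2 p E = (\<Sum>u\<in>onbV p. \<Sum>x\<in>E. \<Sum>y\<in>E. (g p (a p (hp p x) (hp p y)) u)\<^sup>2)"
  unfolding tensor_norm2_def using assms by (intro sum.cong) (auto simp: hp_H subset_iff)

lemma tensor_norm2_le:
  assumes "subspace L" "L \<subseteq> H p"
  shows "tensor_norm2 p (some_onb (g p) L) \<le> tensor_norm2 p (onbH p)"
proof -
  have L: "orthonormal_basis (g p) L (some_onb (g p) L)" by (rule M.some_onb[OF assms(1)])
  have sub: "some_onb (g p) L \<subseteq> H p" "onbH p \<subseteq> H p"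
    using M.onb_in[OF L] M.onb_in[OF onbH] assms(2) by auto
  show ?thesis unfolding tensor_norm2_hp[OF sub(1)] tensor_norm2_hp[OF sub(2)]
    by (intro sum_mono M.sum_squares_bilinear_le[OF onbH L assms(2)] bilinear_oneill M.onb_in[OF onbV])
qed

lemma tensor_norm2_eq: "tensor_norm2 p (onbH p) = (\<Sum>x\<in>onbH p. \<Sum>y\<in>onbH p. g p (a p x y) (a p x y))"
proof -
  have "tensor_norm2 p (onbH p) = (\<Sum>x\<in>onbH p. \<Sum>u\<in>onbV p. \<Sum>y\<in>onbH p. (g p (a p x y) u)\<^sup>2)"
    unfolding tensor_norm2_def by (rule sum.swap)
  also have "\<dots> = (\<Sum>x\<in>onbH p. \<Sum>y\<in>onbH p. \<Sum>u\<in>onbV p. (g p (a p x y) u)\<^sup>2)"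
    by (rule sum.cong[OF refl sum.swap])
  also have "\<dots> = (\<Sum>x\<in>onbH p. \<Sum>y\<in>onbH p. g p (a p x y) (a p x y))"
    by (intro sum.cong refl M.onb_norm2[OF onbV] oneill_vertical_valued M.onb_in[OF onbH])
  finally show ?thesis .
qed

lemma tensor_norm2_eq_0_iff: "tensor_norm2 p (onbH p) = 0 \<longleftrightarrow> (\<forall>x\<in>H p. \<forall>y\<in>H p. a p x y = 0)"
proof
  assume 0: "tensor_norm2 p (onbH p) = 0"
  have fin: "finite (onbH p)" by (rule M.onb_finite[OF onbH])
  have zero: "a p x y = 0" if "x \<in> onbH p" "y \<in> onbH p" for x y
  proof -
    have "(\<Sum>y\<in>onbH p. g p (a p x y) (a p x y)) = 0"
      using 0 that(1) unfolding tensor_norm2_eq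
      by (subst (asm) sum_nonneg_eq_0_iff[OF fin]) (auto intro!: sum_nonneg M.form_nonneg)
    then have "g p (a p x y) (a p x y) = 0"
      using that(2) by (subst (asm) sum_nonneg_eq_0_iff[OF fin]) (auto intro!: M.form_nonneg)
    then show ?thesis by (simp add: M.form_eq_0)
  qed
  show "\<forall>x\<in>H p. \<forall>y\<in>H p. a p x y = 0"
  proof (intro ballI)
    fix x y assume xy: "x \<in> H p" "y \<in> H p"
    have xs: "x \<in> span (onbH p)" and ys: "y \<in> span (onbH p)" using xy M.onb_span[OF onbH] by simp_all
    show "a p x y = 0"
    proof (rule V_eqI[OF oneill_vertical_valued[OF xy] subspace_0[OF subspace_V]])
      fix u assume u: "u \<in> V p"
      have lin: "linear (\<lambda>y. g p (a p (hp p x) (hp p y)) u)" "linear (\<lambda>x. g p (a p (hp p x) (hp p y)) u)" for x y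
        using bilinear_oneill[OF u] by (auto simp: bilinear_def)
      have eq: "hp p z = z" if "z \<in> onbH p" for z by (rule hp_H[OF M.onb_in[OF onbH that]])
      have "g p (a p (hp p z) (hp p y)) u = 0" if z: "z \<in> onbH p" for z
        by (rule linear_eq_0_on_span[OF lin(1) _ ys]) (simp add: eq z zero M.form_simps)
      then have "g p (a p (hp p x) (hp p y)) u = 0"
        by (rule linear_eq_0_on_span[OF lin(2) _ xs])
      then show "g p (a p x y) u = g p 0 u" by (simp add: hp_H xy M.form_simps)
    qed
  qed
next
  assume "\<forall>x\<in>H p. \<forall>y\<in>H p. a p x y = 0"
  then have "(\<Sum>x\<in>onbH p. \<Sum>y\<in>onbH p. g p (a p x y) (a p x y)) = 0"
    using M.onb_in[OF onbH] by (intro sum.neutral ballI) (simp add: M.form_simps)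
  then show "tensor_norm2 p (onbH p) = 0" by (simp add: tensor_norm2_eq)
qed

text \<open>As \<open>A\<close> is skew-symmetric, the terms in \<open>A\<close> of the horizontal curvature add up to
  \<open>- 3 \<parallel>A\<parallel>\<^sup>2\<close>.\<close>

lemma horizontal_scalar_curvature_eq:
  "horizontal_scalar_curvature A B g F nabla p = 1 / (real (dim (H p)) * (real (dim (H p)) - 1)) *
    ((\<Sum>x\<in>onbH p. \<Sum>y\<in>onbH p. g p (curvature_at A nabla p x y y) x) - 3 * tensor_norm2 p (onbH p))"
proof -
  have "horizontal_curvature A B g F nabla p x y y x = g p (curvature_at A nabla p x y y) x - 3 * g p (a p x y) (a p x y)"
    if "x \<in> onbH p" "y \<in> onbH p" for x y
  proof -
    note H = M.onb_in[OF onbH that(1)] M.onb_in[OF onbH that(2)]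
    have yx: "a p y x = - a p x y" by (rule oneill_skew[OF H(2,1)])
    have diag: "a p z z = 0" if "z \<in> H p" for z
      using oneill_skew[OF that that] by (simp add: eq_neg_iff_add_eq_0 scaleR_2[symmetric])
    show ?thesis unfolding horizontal_curvature_def Let_def yx diag[OF H(1)] diag[OF H(2)]
      by (simp add: M.form_simps)
  qed
  then have "(\<Sum>x\<in>onbH p. \<Sum>y\<in>onbH p. horizontal_curvature A B g F nabla p x y y x)
     = (\<Sum>x\<in>onbH p. \<Sum>y\<in>onbH p. g p (curvature_at A nabla p x y y) x - 3 * g p (a p x y) (a p x y))"
    by (intro sum.cong refl) simp
  also have "\<dots> = (\<Sum>x\<in>onbH p. \<Sum>y\<in>onbH p. g p (curvature_at A nabla p x y y) x) - 3 * tensor_norm2 p (onbH p)"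
    by (simp add: tensor_norm2_eq sum_subtractf sum_distrib_left)
  finally show ?thesis unfolding horizontal_scalar_curvature_def Let_def by simp
qed

lemma hyperplanes_nonempty: "hyperplanes (H p) \<noteq> {}"
proof -
  obtain L where "subspace L" "L \<subseteq> span (H p)" "dim L = dim (H p) - 1"
    using choose_subspace_of_subspace[of "dim (H p) - 1" "H p"] by auto
  moreover have "span (H p) = H p" using subspace_H span_eq_iff by blast
  ultimately show ?thesis by (auto simp: hyperplanes_def)
qed

text \<open>With \<open>T = \<parallel>A\<parallel>\<^sup>2\<close> and \<open>s = dim \<H>\<close>, every hyperplane \<open>L\<close> satisfies \<open>0 \<le> C(L) \<le> T / (s - 1)\<close>.
  Hence both Casorati curvatures exceed \<open>- 3 T / (s (s - 1))\<close> by at least a positive multiple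
  of \<open>T\<close>.\<close>

lemma casorati_delta_bounds:
  fixes p defines "T \<equiv> tensor_norm2 p (onbH p)" and "s \<equiv> real (dim (H p))"
  assumes s: "dim (H p) \<ge> 3"
  shows "casorati_delta A B g F nabla p \<ge> T / (2 * s)"
    and "casorati_delta_hat A B g F nabla p \<ge> - 3 * T / (s * (s - 1)) + T / s"
    and "T = 0 \<Longrightarrow> casorati_delta A B g F nabla p = 0"
    and "T = 0 \<Longrightarrow> casorati_delta_hat A B g F nabla p = 0"
proof -
  let ?C = "casorati A B g F nabla p"
  have s3: "s \<ge> 3" using s by (simp add: s_def)
  have dimL: "real (dim L) = s - 1" if "L \<in> hyperplanes (H p)" for L
    using that s by (simp add: hyperplanes_def s_def of_nat_diff)
  have C: "0 \<le> ?C L" "?C L \<le> T / (s - 1)" if "L \<in> hyperplanes (H p)" for L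
  proof -
    have L: "subspace L" "L \<subseteq> H p" using that by (auto simp: hyperplanes_def)
    show "0 \<le> ?C L" using tensor_norm2_nonneg s3 by (simp add: casorati_eq dimL[OF that])
    show "?C L \<le> T / (s - 1)" unfolding casorati_eq dimL[OF that] T_def
      using s3 by (intro divide_right_mono tensor_norm2_le L) simp
  qed
  have T0: "T \<ge> 0" by (simp add: T_def tensor_norm2_nonneg)
  have CH: "?C (H p) = T / s" by (simp add: casorati_eq T_def s_def)
  have inf: "(INF L\<in>hyperplanes (H p). ?C L) \<ge> 0" by (rule cINF_greatest[OF hyperplanes_nonempty C(1)])
  have sup: "(SUP L\<in>hyperplanes (H p). ?C L) \<le> T / (s - 1)" by (rule cSUP_least[OF hyperplanes_nonempty C(2)])
  have \<delta>: "casorati_delta A B g F nabla p = 1 / 2 * (T / s) + (s + 1) / (2 * s) * (INF L\<in>hyperplanes (H p). ?C L)"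
    by (simp add: casorati_delta_def Let_def CH s_def)
  have \<delta>': "casorati_delta_hat A B g F nabla p = 2 * (T / s) - (2 * s - 1) / (2 * s) * (SUP L\<in>hyperplanes (H p). ?C L)"
    by (simp add: casorati_delta_hat_def Let_def CH s_def)
  have "(s + 1) / (2 * s) * (INF L\<in>hyperplanes (H p). ?C L) \<ge> 0" using inf s3 by (intro mult_nonneg_nonneg) auto
  then show "casorati_delta A B g F nabla p \<ge> T / (2 * s)" unfolding \<delta> by simp
  have "(2 * s - 1) / (2 * s) * (SUP L\<in>hyperplanes (H p). ?C L) \<le> (2 * s - 1) / (2 * s) * (T / (s - 1))"
    using sup s3 by (intro mult_left_mono) auto
  moreover have "2 * (T / s) - (2 * s - 1) / (2 * s) * (T / (s - 1)) \<ge> - 3 * T / (s * (s - 1)) + T / s"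
  proof -
    have eq: "2 * (T / s) - (2 * s - 1) / (2 * s) * (T / (s - 1)) - (- 3 * T / (s * (s - 1)) + T / s)
        = T * 5 / (2 * s * (s - 1))" using s3 by (simp add: divide_simps) (simp add: algebra_simps)
    have "0 \<le> T * 5 / (2 * s * (s - 1))" using s3 T0 by (intro divide_nonneg_nonneg mult_nonneg_nonneg) auto
    then show ?thesis unfolding eq[symmetric] by (simp only: diff_ge_0_iff_ge)
  qed
  ultimately show "casorati_delta_hat A B g F nabla p \<ge> - 3 * T / (s * (s - 1)) + T / s"
    unfolding \<delta>' by linarith
  assume "T = 0"
  then have "?C L = 0" if "L \<in> hyperplanes (H p)" for L using C[OF that] by simp
  then have img: "?C ` hyperplanes (H p) = {0}" using hyperplanes_nonempty by force
  show "casorati_delta A B g F nabla p = 0" "casorati_delta_hat A B g F nabla p = 0"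
    unfolding \<delta> \<delta>' img using \<open>T = 0\<close> by simp_all
qed

text \<open>The part of the normalised horizontal scalar curvature that does not involve \<open>A\<close>.\<close>

definition mean_sectional_curvature :: "'a \<Rightarrow> real" where
  "mean_sectional_curvature p = (\<Sum>x\<in>onbH p. \<Sum>y\<in>onbH p. g p (curvature_at A nabla p x y y) x)
     / (real (dim (H p)) * (real (dim (H p)) - 1))"

lemma casorati_inequalities:
  assumes s: "dim (H p) \<ge> 3"
    and \<delta>: "\<delta> = casorati_delta A B g F nabla p \<or> \<delta> = casorati_delta_hat A B g F nabla p"
  shows "horizontal_scalar_curvature A B g F nabla p \<le> \<delta> + mean_sectional_curvature p"
    and "horizontal_scalar_curvature A B g F nabla p = \<delta> + mean_sectional_curvature p
      \<longleftrightarrow> (\<forall>x\<in>H p. \<forall>y\<in>H p. a p x y = 0)"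
proof -
  define s where "s = real (dim (H p))"
  let ?K = "mean_sectional_curvature p"
  define T where "T = tensor_norm2 p (onbH p)"
  note b = casorati_delta_bounds[OF s, folded T_def s_def]
  have s3: "s \<ge> 3" using s by (simp add: s_def)
  have T0: "T \<ge> 0" by (simp add: T_def tensor_norm2_nonneg)
  have \<rho>: "horizontal_scalar_curvature A B g F nabla p = ?K - 3 * T / (s * (s - 1))"
    unfolding horizontal_scalar_curvature_eq mean_sectional_curvature_def T_def s_def by (simp add: diff_divide_distrib)
  have gap: "\<delta> \<ge> - 3 * T / (s * (s - 1)) + T / (2 * s)"
  proof -
    have "3 * T / (s * (s - 1)) \<ge> 0" using s3 T0 by (intro divide_nonneg_nonneg mult_nonneg_nonneg) auto
    moreover have "T / (2 * s) \<le> T / s" using s3 T0 by (intro divide_left_mono) auto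
    ultimately show ?thesis using \<delta> b(1,2) by auto
  qed
  have "T / (2 * s) \<ge> 0" using s3 T0 by simp
  then show "horizontal_scalar_curvature A B g F nabla p \<le> \<delta> + ?K" unfolding \<rho> using gap by simp
  have "horizontal_scalar_curvature A B g F nabla p = \<delta> + ?K \<longleftrightarrow> T = 0"
  proof
    assume "horizontal_scalar_curvature A B g F nabla p = \<delta> + ?K"
    then have "T / (2 * s) \<le> 0" unfolding \<rho> using gap by simp
    then show "T = 0" using s3 T0 by (simp add: divide_le_0_iff)
  next
    assume "T = 0"
    then show "horizontal_scalar_curvature A B g F nabla p = \<delta> + ?K" unfolding \<rho> using \<delta> b(3,4) by auto
  qed
  then show "horizontal_scalar_curvature A B g F nabla p = \<delta> + ?K \<longleftrightarrow> (\<forall>x\<in>H p. \<forall>y\<in>H p. a p x y = 0)"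
    unfolding T_def tensor_norm2_eq_0_iff .
qed

end

section \<open>The curvature of generalized Sasakian space forms\<close>

locale sasakian_submersion = submersion_connection A g B h F nabla
  for A :: "('a::t2_space, 'e::euclidean_space) chart set" and g
    and B :: "('b::t2_space, 'f::euclidean_space) chart set" and h and F and nabla +
  fixes phi :: "'a \<Rightarrow> 'e \<Rightarrow> 'e" and xi :: "'a \<Rightarrow> 'e" and eta :: "'a \<Rightarrow> 'e \<Rightarrow> real" and c1 c2 c3 \<theta> :: "'a \<Rightarrow> real"
  assumes space_form: "generalized_sasakian_space_form A phi xi eta g nabla c1 c2 c3"
    and slant: "horizontally_slant A B g F phi eta \<theta>"
begin

lemma contact: "linear (phi p)" "linear (eta p)" "phi p (phi p x) = - x + eta p x *\<^sub>R xi p"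
    "eta p (xi p) = 1" "phi p (xi p) = 0" "g p (phi p x) (phi p y) = g p x y - eta p x * eta p y"
  using space_form by (simp_all add: generalized_sasakian_space_form_def almost_contact_metric_def)

lemma eta_eq: "g p x (xi p) = eta p x" "g p (xi p) x = eta p x"
proof -
  show "g p x (xi p) = eta p x" using contact(6)[of p x "xi p"] by (simp add: contact(4,5) M.form_simps)
  then show "g p (xi p) x = eta p x" by (simp add: M.sym)
qed

lemma eta_phi: "eta p (phi p y) = 0"
proof -
  have "phi p (phi p (phi p y)) = - phi p y"
    by (simp add: contact(3)[of p y] contact(5) linear_diff[OF contact(1)] linear_cmul[OF contact(1)])
  then have "eta p (phi p y) *\<^sub>R xi p = 0" using contact(3)[of p "phi p y"] by simp
  moreover have "xi p \<noteq> 0" using contact(4)[of p] linear_0[OF contact(2)] by auto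
  ultimately show ?thesis by simp
qed

lemma phi_skew: "g p (phi p x) y = - g p x (phi p y)"
  using contact(6)[of p x "phi p y"] by (simp add: contact(3) eta_phi M.form_simps eta_eq)

text \<open>Since \<open>\<phi>\<close> is skew-symmetric, the three terms with the coefficient \<open>c2\<close> combine to a square.\<close>

lemma curvature_sectional:
  "g p (curvature_at A nabla p x y y) x = c1 p * (g p x x * g p y y - (g p x y)\<^sup>2) + 3 * c2 p * (g p (phi p y) x)\<^sup>2
    + c3 p * (2 * g p x y * eta p x * eta p y - (eta p y)\<^sup>2 * g p x x - (eta p x)\<^sup>2 * g p y y)"
proof -
  have 0: "g p y (phi p y) = 0" using phi_skew[of p y y] by (simp add: M.sym[of p y "phi p y"])
  have R: "curvature_at A nabla p x y y =
          c1 p *\<^sub>R (g p y y *\<^sub>R x - g p x y *\<^sub>R y)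
        + c2 p *\<^sub>R (g p x (phi p y) *\<^sub>R phi p y - g p y (phi p y) *\<^sub>R phi p x + (2 * g p x (phi p y)) *\<^sub>R phi p y)
        + c3 p *\<^sub>R ((eta p x * eta p y) *\<^sub>R y - (eta p y * eta p y) *\<^sub>R x
                  + (g p x y * eta p y) *\<^sub>R xi p - (g p y y * eta p x) *\<^sub>R xi p)"
    using space_form M.ext_field
    by (simp add: generalized_sasakian_space_form_def curvature_at_def)
  show ?thesis unfolding R
    by (simp add: M.form_simps 0 eta_eq M.sym[of p y x] M.sym[of p x "phi p y"] power2_eq_square algebra_simps)
qed

text \<open>On an orthonormal basis \<open>\<Sum> g(\<phi> y, x)\<^sup>2\<close> over \<open>x\<close> is the squared length of the horizontal part of
  \<open>\<phi> y\<close>, which the slant condition evaluates below.\<close>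

lemma sum_curvature:
  fixes p defines "s \<equiv> real (dim (H p))"
  shows "(\<Sum>x\<in>onbH p. \<Sum>y\<in>onbH p. g p (curvature_at A nabla p x y y) x)
    = c1 p * (s * (s - 1)) + 3 * c2 p * (\<Sum>y\<in>onbH p. g p (hp p (phi p y)) (hp p (phi p y)))
      - c3 p * (2 * (s - 1) * (\<Sum>y\<in>onbH p. (eta p y)\<^sup>2))"
proof -
  let ?E = "onbH p"
  have fin: "finite ?E" and card: "real (card ?E) = s"
    using M.onb_finite[OF onbH] M.onb_card[OF onbH] by (auto simp: s_def)
  have orth: "g p x y = (if x = y then 1 else 0)" if "x \<in> ?E" "y \<in> ?E" for x y using M.onb_orth[OF onbH that] .
  have phi: "(\<Sum>x\<in>?E. (g p (phi p y) x)\<^sup>2) = g p (hp p (phi p y)) (hp p (phi p y))" for y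
  proof -
    have "(\<Sum>x\<in>?E. (g p (phi p y) x)\<^sup>2) = (\<Sum>x\<in>?E. (g p (hp p (phi p y)) x)\<^sup>2)"
      by (intro sum.cong refl) (simp add: metric_hp(2) M.onb_in[OF onbH])
    then show ?thesis by (simp add: M.onb_norm2[OF onbH hp(1)])
  qed
  have "(\<Sum>x\<in>?E. \<Sum>y\<in>?E. 1 - (if x = y then 1 else 0)) = (\<Sum>x\<in>?E. s - 1)"
    by (intro sum.cong refl) (simp add: sum_subtractf fin card)
  then have d1: "(\<Sum>x\<in>?E. \<Sum>y\<in>?E. 1 - (if x = y then 1 else 0)) = s * s - s"
    by (simp add: card algebra_simps)
  define e where "e = (\<Sum>y\<in>?E. (eta p y)\<^sup>2)"
  have "(\<Sum>x\<in>?E. \<Sum>y\<in>?E. (if x = y then 2 * (eta p x)\<^sup>2 else 0) - (eta p y)\<^sup>2 - (eta p x)\<^sup>2)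
      = (\<Sum>x\<in>?E. 2 * (eta p x)\<^sup>2 - e - s * (eta p x)\<^sup>2)"
    by (intro sum.cong refl) (simp add: sum_subtractf fin card e_def)
  also have "\<dots> = 2 * e - s * e - s * e"
    by (simp add: sum_subtractf sum_distrib_left[symmetric] card e_def)
  finally have d2: "(\<Sum>x\<in>?E. \<Sum>y\<in>?E. (if x = y then 2 * (eta p x)\<^sup>2 else 0) - (eta p y)\<^sup>2 - (eta p x)\<^sup>2)
      = 2 * (\<Sum>y\<in>?E. (eta p y)\<^sup>2) - 2 * s * (\<Sum>y\<in>?E. (eta p y)\<^sup>2)" by (simp add: e_def)
  have "(\<Sum>x\<in>?E. \<Sum>y\<in>?E. g p (curvature_at A nabla p x y y) x)
    = (\<Sum>x\<in>?E. \<Sum>y\<in>?E. c1 p * (1 - (if x = y then 1 else 0)) + 3 * c2 p * (g p (phi p y) x)\<^sup>2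
        + c3 p * ((if x = y then 2 * (eta p x)\<^sup>2 else 0) - (eta p y)\<^sup>2 - (eta p x)\<^sup>2))"
    unfolding curvature_sectional by (intro sum.cong refl) (simp add: orth power2_eq_square)
  also have "\<dots> = c1 p * (s * s - s) + 3 * c2 p * (\<Sum>x\<in>?E. \<Sum>y\<in>?E. (g p (phi p y) x)\<^sup>2)
      + c3 p * (2 * (\<Sum>y\<in>?E. (eta p y)\<^sup>2) - 2 * s * (\<Sum>y\<in>?E. (eta p y)\<^sup>2))"
    by (simp only: sum.distrib sum_distrib_left[symmetric] d1 d2)
  also have "(\<Sum>x\<in>?E. \<Sum>y\<in>?E. (g p (phi p y) x)\<^sup>2) = (\<Sum>y\<in>?E. g p (hp p (phi p y)) (hp p (phi p y)))"
    by (subst sum.swap) (simp add: phi)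
  finally show ?thesis by (simp add: algebra_simps)
qed

lemma hp_phi_norm2:
  assumes "y \<in> H p" shows "g p (hp p (phi p y)) (hp p (phi p y)) = - g p (hp p (phi p (hp p (phi p y)))) y"
  by (simp add: metric_hp(1)[OF hp(1)] metric_hp(2)[OF assms] phi_skew)

lemma slant_eq: "x \<in> H p \<Longrightarrow> eta p x = 0 \<Longrightarrow> hp p (phi p (hp p (phi p x))) = - (cos (\<theta> p))\<^sup>2 *\<^sub>R x"
  using slant by (simp add: horizontally_slant_def)

text \<open>If \<open>\<xi>\<close> is vertical, \<open>\<eta>\<close> vanishes on horizontal vectors and the slant identity applies to every
  basis vector.\<close>

lemma mean_curvature_vertical:
  fixes p defines "s \<equiv> real (dim (H p))"
  assumes xi: "xi p \<in> V p" and s: "dim (H p) \<ge> 3"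
  shows "mean_sectional_curvature p = c1 p + 3 * c2 p / (s - 1) * (cos (\<theta> p))\<^sup>2"
proof -
  have eta0: "eta p y = 0" if "y \<in> H p" for y using HV[OF that xi] by (simp add: eta_eq)
  have "g p (hp p (phi p y)) (hp p (phi p y)) = (cos (\<theta> p))\<^sup>2" if "y \<in> onbH p" for y
    using M.onb_in[OF onbH that] M.onb_orth[OF onbH that that]
    by (simp add: hp_phi_norm2 slant_eq eta0 M.form_simps)
  then have 1: "(\<Sum>y\<in>onbH p. g p (hp p (phi p y)) (hp p (phi p y))) = s * (cos (\<theta> p))\<^sup>2"
    using M.onb_card[OF onbH, of p] by (simp add: s_def)
  have 2: "(\<Sum>y\<in>onbH p. (eta p y)\<^sup>2) = 0" using M.onb_in[OF onbH] by (intro sum.neutral) (simp add: eta0)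
  have s3: "s \<ge> 3" using s by (simp add: s_def)
  have "c1 p * (s * (s - 1)) + 3 * c2 p * (s * (cos (\<theta> p))\<^sup>2) - c3 p * (2 * (s - 1) * 0)
      = s * (c1 p * (s - 1) + 3 * c2 p * (cos (\<theta> p))\<^sup>2)" by (simp add: algebra_simps)
  moreover have "(c1 p * (s - 1) + 3 * c2 p * (cos (\<theta> p))\<^sup>2) / (s - 1)
      = c1 p + 3 * c2 p / (s - 1) * (cos (\<theta> p))\<^sup>2"
    using s3 by (simp add: add_divide_distrib)
  ultimately show ?thesis unfolding mean_sectional_curvature_def sum_curvature s_def[symmetric] 1 2 using s3 by simp
qed

text \<open>If \<open>\<xi>\<close> is horizontal, the slant identity applies to \<open>y - \<eta>(y) \<xi>\<close>, which has the same image under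
  \<open>\<phi>\<close> as \<open>y\<close>; the sum of the \<open>\<eta>(y)\<^sup>2\<close> over an orthonormal basis is \<open>\<parallel>\<xi>\<parallel>\<^sup>2 = 1\<close>.\<close>

lemma mean_curvature_horizontal:
  fixes p defines "s \<equiv> real (dim (H p))"
  assumes xi: "xi p \<in> H p" and s: "dim (H p) \<ge> 3"
  shows "mean_sectional_curvature p = c1 p + 3 * c2 p / s * (cos (\<theta> p))\<^sup>2 - 2 / s * c3 p"
proof -
  have "g p (hp p (phi p y)) (hp p (phi p y)) = (cos (\<theta> p))\<^sup>2 * (1 - (eta p y)\<^sup>2)" if "y \<in> onbH p" for y
  proof -
    have y: "y \<in> H p" "g p y y = 1" using M.onb_in[OF onbH that] M.onb_orth[OF onbH that that] by auto
    define z where "z = y - eta p y *\<^sub>R xi p"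
    have z: "z \<in> H p" unfolding z_def by (intro subspace_diff[OF subspace_H] subspace_scale[OF subspace_H] xi y)
    have "eta p z = 0" by (simp add: z_def linear_diff[OF contact(2)] linear_cmul[OF contact(2)] contact(4))
    moreover have "phi p y = phi p z"
      by (simp add: z_def linear_diff[OF contact(1)] linear_cmul[OF contact(1)] contact(5))
    ultimately have "hp p (phi p (hp p (phi p y))) = - (cos (\<theta> p))\<^sup>2 *\<^sub>R z" using slant_eq[OF z] by simp
    moreover have "g p z y = 1 - (eta p y)\<^sup>2" by (simp add: z_def M.form_simps y(2) eta_eq power2_eq_square)
    ultimately show ?thesis by (simp add: hp_phi_norm2[OF y(1)] M.form_simps)
  qed
  then have "(\<Sum>y\<in>onbH p. g p (hp p (phi p y)) (hp p (phi p y))) = (\<Sum>y\<in>onbH p. (cos (\<theta> p))\<^sup>2 * (1 - (eta p y)\<^sup>2))"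
    by (rule sum.cong[OF refl])
  also have "\<dots> = (cos (\<theta> p))\<^sup>2 * (s - (\<Sum>y\<in>onbH p. (eta p y)\<^sup>2))"
    using M.onb_card[OF onbH, of p] by (simp add: s_def sum_distrib_left[symmetric] sum_subtractf)
  also have 2: "(\<Sum>y\<in>onbH p. (eta p y)\<^sup>2) = 1"
    using M.onb_norm2[OF onbH xi] by (simp add: eta_eq contact(4))
  finally have 1: "(\<Sum>y\<in>onbH p. g p (hp p (phi p y)) (hp p (phi p y))) = (cos (\<theta> p))\<^sup>2 * (s - 1)" .
  have s3: "s \<ge> 3" using s by (simp add: s_def)
  have "c1 p * (s * (s - 1)) + 3 * c2 p * ((cos (\<theta> p))\<^sup>2 * (s - 1)) - c3 p * (2 * (s - 1) * 1)
      = (c1 p * s + 3 * c2 p * (cos (\<theta> p))\<^sup>2 - 2 * c3 p) * (s - 1)" by (simp add: algebra_simps)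
  moreover have "(c1 p * s + 3 * c2 p * (cos (\<theta> p))\<^sup>2 - 2 * c3 p) / s
      = c1 p + 3 * c2 p / s * (cos (\<theta> p))\<^sup>2 - 2 / s * c3 p"
    using s3 by (simp add: add_divide_distrib diff_divide_distrib)
  ultimately show ?thesis unfolding mean_sectional_curvature_def sum_curvature s_def[symmetric] 1 2 using s3 by simp
qed

end

section \<open>Integrability of the horizontal distribution\<close>

context submersion_connection
begin

text \<open>\<open>A\<close> measures the failure of the horizontal lifts of coordinate fields to commute: their
  bracket is vertical, because it projects to the bracket of coordinate fields, and equals \<open>2 A\<close>.\<close>

lemma tensor_zero_iff_clifts_commute:
  assumes c: "c \<in> A" "q \<in> fst c" and d: "d \<in> B" "F q \<in> fst d"
  shows "(\<forall>x\<in>H q. \<forall>y\<in>H q. a q x y = 0) \<longleftrightarrow> (\<forall>k l. D (\<lambda>x. clift c d x l) (snd c q) (clift c d (snd c q) k)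
      = D (\<lambda>x. clift c d x k) (snd c q) (clift c d (snd c q) l))"
proof -
  define x0 where "x0 = snd c q"
  define \<omega> where "\<omega> = clift c d"
  define f where "f = loc c d"
  define S where "S = ldom c d"
  have S: "open S" "x0 \<in> S" "S \<subseteq> M.img c" unfolding S_def x0_def using open_ldom[OF c(1) d(1)] c d by auto
  have smooth\<omega>: "smooth_on S (\<lambda>x. \<omega> x k)" for k
    unfolding \<omega>_def S_def smooth_on_def using Ck_on_clift[OF c(1) d(1)] by blast
  obtain X N where N: "open N" "x0 \<in> N" "N \<subseteq> S" and smoothX: "\<And>k. smooth_field A (X k)"
    and rep: "\<And>k x. x \<in> N \<Longrightarrow> M.rep c (X k) x = \<omega> x k"
    and Xq: "\<And>k q. X k q = 0 \<or> (q \<in> fst c \<and> snd c q \<in> S \<and> (\<exists>r. M.T c q (X k q) = r *\<^sub>R \<omega> (snd c q) k))"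
    by (rule M.extend_fields[OF c(1) S smooth\<omega>]) (rule that)
  have XH: "X k \<in> HF" for k
  proof -
    have "X k q' \<in> H q'" for q'
    proof (cases "X k q' = 0")
      case False
      then obtain r where q': "q' \<in> fst c" "snd c q' \<in> S" "M.T c q' (X k q') = r *\<^sub>R \<omega> (snd c q') k"
        using Xq by blast
      have "M.T c q' (X k q') = M.T c q' (r *\<^sub>R lift q' (inv (N.T d (F q')) k))"
        by (simp only: q'(3) \<omega>_def clift_at[OF c(1) d(1) q'(1)] linear_cmul[OF M.linear_T[OF c(1) q'(1)]])
      then have "X k q' = r *\<^sub>R lift q' (inv (N.T d (F q')) k)" by (rule injD[OF M.inj_T[OF c(1) q'(1)]])
      then show ?thesis by (simp add: subspace_scale[OF subspace_H lift_H])
    qed (simp add: subspace_0[OF subspace_H])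
    then show ?thesis using smoothX by (simp add: sections_def)
  qed
  have br: "M.T c q (bracket (X k) (X l) q) = D (\<lambda>x. \<omega> x l) x0 (\<omega> x0 k) - D (\<lambda>x. \<omega> x k) x0 (\<omega> x0 l)" for k l
  proof -
    have "D (M.rep c (X k)) x0 = D (\<lambda>x. \<omega> x k) x0" for k by (rule D_cong[OF N(1,2) rep])
    then show ?thesis using M.lie_bracket_chart[OF c smoothX smoothX, of k l]
      by (simp add: x0_def[symmetric] rep[OF N(2)])
  qed
  have brV: "bracket (X k) (X l) q \<in> V q" for k l
  proof -
    have f: "Ck_on 2 S f" unfolding f_def S_def by (rule smooth_on_Ck[OF loc_smooth[OF c(1) d(1)]])
    have const: "D (\<lambda>z. D f z (\<omega> z k)) x0 = D (\<lambda>z. k) x0" for k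
      by (rule D_cong[OF S(1,2)]) (simp add: f_def \<omega>_def S_def D_loc_clift[OF c(1) d(1)])
    have "N.T d (F q) (dF q (bracket (X k) (X l) q)) = D f x0 (M.T c q (bracket (X k) (X l) q))"
      unfolding f_def x0_def by (rule dF_chart[OF c d])
    also have "\<dots> = D (\<lambda>z. D f z (\<omega> z l)) x0 (\<omega> x0 k) - D (\<lambda>z. D f z (\<omega> z k)) x0 (\<omega> x0 l)"
      unfolding br
      by (rule bracket_pushforward[OF f S(1,2), symmetric])
        (rule smooth_on_imp_differentiable[OF smooth\<omega> S(2)])+
    also have "\<dots> = N.T d (F q) 0" by (simp add: const linear_0[OF N.linear_T[OF d]])
    finally have "dF q (bracket (X k) (X l) q) = 0" by (rule injD[OF N.inj_T[OF d]])
    then show ?thesis by (simp add: V_iff)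
  qed
  have Xval: "X k q = lift q (inv (N.T d (F q)) k)" for k
  proof -
    have "M.T c q (X k q) = M.T c q (lift q (inv (N.T d (F q)) k))"
      using rep[OF N(2), of k] unfolding x0_def \<omega>_def M.rep_at[OF c] clift_at[OF c(1) d(1) c(2)] .
    then show ?thesis by (rule injD[OF M.inj_T[OF c]])
  qed
  have a: "2 *\<^sub>R a q (X k q) (X l q) = bracket (X k) (X l) q" for k l
    unfolding oneill_bracket[OF XH XH] vp_eq hp_V[OF brV] by simp
  have Ta: "M.T c q (2 *\<^sub>R a q (X k q) (X l q)) = D (\<lambda>x. \<omega> x l) x0 (\<omega> x0 k) - D (\<lambda>x. \<omega> x k) x0 (\<omega> x0 l)" for k l
    unfolding a br ..
  have "(\<forall>x\<in>H q. \<forall>y\<in>H q. a q x y = 0) \<longleftrightarrow> (\<forall>k l. D (\<lambda>x. \<omega> x l) x0 (\<omega> x0 k) = D (\<lambda>x. \<omega> x k) x0 (\<omega> x0 l))"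
  proof
    assume zero: "\<forall>x\<in>H q. \<forall>y\<in>H q. a q x y = 0"
    show "\<forall>k l. D (\<lambda>x. \<omega> x l) x0 (\<omega> x0 k) = D (\<lambda>x. \<omega> x k) x0 (\<omega> x0 l)"
    proof (intro allI)
      fix k l
      have "a q (X k q) (X l q) = 0" using zero HF(2)[OF XH] by blast
      then show "D (\<lambda>x. \<omega> x l) x0 (\<omega> x0 k) = D (\<lambda>x. \<omega> x k) x0 (\<omega> x0 l)"
        using Ta[of k l] linear_0[OF M.linear_T[OF c]] by simp
    qed
  next
    assume comm: "\<forall>k l. D (\<lambda>x. \<omega> x l) x0 (\<omega> x0 k) = D (\<lambda>x. \<omega> x k) x0 (\<omega> x0 l)"
    show "\<forall>x\<in>H q. \<forall>y\<in>H q. a q x y = 0"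
    proof (intro ballI)
      fix x y assume xy: "x \<in> H q" "y \<in> H q"
      have Xx: "X (N.T d (F q) (dF q z)) q = z" if "z \<in> H q" for z
        by (simp add: Xval N.inv_T[OF d] lift_dF hp_H[OF that])
      have "M.T c q (2 *\<^sub>R a q x y) = M.T c q 0"
        using Ta[of "N.T d (F q) (dF q x)" "N.T d (F q) (dF q y)"] comm linear_0[OF M.linear_T[OF c]]
        unfolding Xx[OF xy(1)] Xx[OF xy(2)] by simp
      then have "2 *\<^sub>R a q x y = 0" by (rule injD[OF M.inj_T[OF c]])
      then show "a q x y = 0" by simp
    qed
  qed
  then show ?thesis unfolding x0_def \<omega>_def .
qed

text \<open>The differential of such a \<open>u\<close> is the horizontal lift, which gives the tangent spaces.  Injectivity
  follows from the base: \<open>f \<circ> u\<close> has the identity as derivative, so it is a translation.\<close>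

lemma integral_manifold_of_clift_solution:
  assumes c: "c \<in> A" and d: "d \<in> B"
    and u: "u ` ball 0 r \<subseteq> ldom c d" "smooth_on (ball 0 r) u"
    and du: "\<And>y. y \<in> ball 0 r \<Longrightarrow> (u has_derivative clift c d (u y)) (at y)"
  shows "integral_manifold A H (ball 0 r) (\<lambda>y. chart_inv c (u y))"
  unfolding integral_manifold_def
proof (intro conjI ballI)
  let ?W = "ball (0 :: 'f) r"
  let ?i = "\<lambda>y. chart_inv c (u y)"
  have uimg: "u y \<in> M.img c" "u y \<in> ldom c d" if "y \<in> ?W" for y
  proof -
    show "u y \<in> ldom c d" using u(1) that by blast
    then show "u y \<in> M.img c" by blast
  qed
  have iq: "?i y \<in> fst c" "F (?i y) \<in> fst d" "snd c (?i y) = u y" if y: "y \<in> ?W" for y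
  proof -
    obtain q where q: "q \<in> fst c" "F q \<in> fst d" "u y = snd c q" using uimg(2)[OF y] by blast
    then show "?i y \<in> fst c" "F (?i y) \<in> fst d" "snd c (?i y) = u y"
      by (simp_all add: M.chart_inv_chart[OF c])
  qed
  show "open ?W" by simp
  show "inj_on ?i ?W"
  proof (rule inj_onI)
    fix y z assume y: "y \<in> ?W" and z: "z \<in> ?W" and "?i y = ?i z"
    then have uyz: "u y = u z" using iq(3) by metis
    have der: "((\<lambda>y. loc c d (u y) - y) has_derivative (\<lambda>h. 0)) (at y within ?W)" if "y \<in> ?W" for y
    proof -
      have "(loc c d has_derivative D (loc c d) (u y)) (at (u y))"
        using smooth_on_imp_differentiable[OF loc_smooth[OF c d] uimg(2)[OF that]] frechet_derivative_works by blast
      from has_derivative_diff[OF has_derivative_compose[OF du[OF that] this] has_derivative_ident]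
      have "((\<lambda>y. loc c d (u y) - y) has_derivative (\<lambda>h. 0)) (at y)"
        by (simp only: D_loc_clift[OF c d uimg(2)[OF that]] diff_self)
      then show ?thesis by (rule has_derivative_at_withinI)
    qed
    obtain k where "\<And>y. y \<in> ?W \<Longrightarrow> loc c d (u y) - y = k"
      using has_derivative_zero_constant[OF convex_ball der] by blast
    then have "loc c d (u y) - y = loc c d (u z) - z" using y z by simp
    then show "y = z" unfolding uyz by simp
  qed
  show cont: "continuous_on ?W ?i"
    by (rule continuous_on_compose2[OF M.chart(4)[OF c] Ck_on_continuous[OF smooth_on_Ck[OF u(2)]]])
      (use uimg in auto)
  show "smooth_on (?W \<inter> ?i -` fst c') (snd c' \<circ> ?i)" if c': "c' \<in> A" for c'
    unfolding smooth_on_def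
  proof
    fix k
    have op: "open (?W \<inter> ?i -` fst c')" by (rule continuous_open_preimage[OF cont open_ball M.chart(1)[OF c']])
    have "Ck_on k (?W \<inter> ?i -` fst c') (\<lambda>y. (snd c' \<circ> chart_inv c) (u y))"
    proof (rule Ck_on_compose[OF op M.open_transition[OF c c'] Ck_on_subset[OF smooth_on_Ck[OF u(2)]]
          smooth_on_Ck[OF M.transition_smooth[OF c c']]])
      show "u ` (?W \<inter> ?i -` fst c') \<subseteq> snd c ` (fst c \<inter> fst c')"
      proof
        fix x assume "x \<in> u ` (?W \<inter> ?i -` fst c')"
        then obtain y where y: "y \<in> ?W" "?i y \<in> fst c'" "x = u y" by auto
        then have "x = snd c (?i y)" "?i y \<in> fst c \<inter> fst c'" using iq[OF y(1)] by auto
        then show "x \<in> snd c ` (fst c \<inter> fst c')" by blast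
      qed
    qed auto
    then show "Ck_on k (?W \<inter> ?i -` fst c') (snd c' \<circ> ?i)" by (simp add: o_def)
  qed
  fix w assume w: "w \<in> ?W"
  define q where "q = ?i w"
  let ?k = "M.ch q"
  note k = M.chart_at_in[of q]
  note q = iq[OF w, folded q_def]
  have di: "D (snd ?k \<circ> ?i) w v = lift q (inv (N.T d (F q)) v)" for v
  proof -
    have t: "((snd ?k \<circ> chart_inv c) has_derivative D (snd ?k \<circ> chart_inv c) (u w)) (at (u w))"
      using M.transition_differentiable[OF c k(1) q(1) k(2)] unfolding q(3) frechet_derivative_works .
    have "D (snd ?k \<circ> ?i) w = (\<lambda>v. D (snd ?k \<circ> chart_inv c) (u w) (clift c d (u w) v))"
      using D_eq[OF has_derivative_compose[OF du[OF w] t]] by (simp add: o_def)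
    then show ?thesis
      using M.T_trans[OF c k(1) q(1) k(2)] unfolding q(3)[symmetric] clift_at[OF c d q(1)] by (simp add: M.T_self)
  qed
  have "inj (D (snd ?k \<circ> ?i) w)"
  proof (rule injI)
    fix v v' assume "D (snd ?k \<circ> ?i) w v = D (snd ?k \<circ> ?i) w v'"
    then have "inv (N.T d (F q)) v = inv (N.T d (F q)) v'" unfolding di by (metis dF_lift)
    then show "v = v'" by (metis N.T_inv[OF d q(2)])
  qed
  moreover have "range (D (snd ?k \<circ> ?i) w) = H q"
  proof (intro subset_antisym subsetI)
    fix x assume "x \<in> range (D (snd ?k \<circ> ?i) w)"
    then show "x \<in> H q" by (auto simp: di lift_H)
  next
    fix x assume "x \<in> H q"
    then have "x = D (snd ?k \<circ> ?i) w (N.T d (F q) (dF q x))" by (simp add: di N.inv_T[OF d q(2)] lift_dF hp_H)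
    then show "x \<in> range (D (snd ?k \<circ> ?i) w)" by blast
  qed
  ultimately show "let di = D (snd (M.ch (?i w)) \<circ> ?i) w in inj di \<and> range di = H (?i w)"
    by (simp add: q_def Let_def)
qed

text \<open>An integral manifold \<open>i\<close>, read in charts as \<open>j\<close>, satisfies \<open>dj(w) = \<omega>(j(w)) dm(w)\<close> where
  \<open>m = f \<circ> j\<close> and \<open>\<omega>\<close> is the horizontal lift.  Differentiating once more, the symmetry of the second
  derivatives of \<open>j\<close> and \<open>m\<close> forces the lifts to commute.\<close>

lemma clifts_commute_on_integral_manifold:
  fixes i :: "'f \<Rightarrow> 'a"
  assumes im: "integral_manifold A H W i" and w0: "w0 \<in> W"
    and c: "c \<in> A" "i w0 \<in> fst c" and d: "d \<in> B" "F (i w0) \<in> fst d"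
  shows "D (\<lambda>x. clift c d x l) (snd c (i w0)) (clift c d (snd c (i w0)) k)
      = D (\<lambda>x. clift c d x k) (snd c (i w0)) (clift c d (snd c (i w0)) l)"
proof -
  have W: "open W" and cont: "continuous_on W i"
    and sm: "\<And>c. c \<in> A \<Longrightarrow> smooth_on (W \<inter> i -` fst c) (snd c \<circ> i)"
    and rangeH: "\<And>w. w \<in> W \<Longrightarrow> range (D (snd (M.ch (i w)) \<circ> i) w) = H (i w)"
    using im by (auto simp: integral_manifold_def Let_def)
  define W' where "W' = W \<inter> i -` (fst c \<inter> F -` fst d)"
  have opU: "open (fst c \<inter> F -` fst d)"
    by (rule open_Int[OF M.chart(1)[OF c(1)] open_vimage[OF N.chart(1)[OF d(1)] continuous_F]])
  have W': "open W'" "w0 \<in> W'" unfolding W'_def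
    using continuous_open_preimage[OF cont W opU] w0 c d by auto
  define j where "j = snd c \<circ> i"
  have j: "Ck_on k W' j" for k
    unfolding j_def by (rule Ck_on_subset[OF smooth_on_Ck[OF sm[OF c(1)]]]) (auto simp: W'_def)
  define f where "f = loc c d"
  have jS: "j w \<in> ldom c d" if "w \<in> W'" for w using that by (auto simp: j_def W'_def)
  define m where "m w = f (j w)" for w
  have f: "Ck_on k (ldom c d) f" for k unfolding f_def by (rule smooth_on_Ck[OF loc_smooth[OF c(1) d(1)]])
  have m: "Ck_on k W' m" for k unfolding m_def
    by (rule Ck_on_compose[OF W'(1) open_ldom[OF c(1) d(1)] j f]) (use jS in auto)
  have jd: "(j has_derivative D j w) (at w)" if "w \<in> W'" for w using Ck_on_has_derivative[OF j that] .
  have Dm: "D m w v = D f (j w) (D j w v)" if "w \<in> W'" for w v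
    using D_eq[OF has_derivative_compose[OF jd[OF that] Ck_on_has_derivative[OF f[of "Suc 0"] jS[OF that]]]]
    by (simp add: m_def[abs_def])
  have Dj: "D j w v = M.T c (i w) (D (snd (M.ch (i w)) \<circ> i) w v)" if w: "w \<in> W'" for w v
  proof -
    let ?q = "i w" and ?k = "M.ch (i w)"
    note k = M.chart_at_in[of ?q]
    have wW: "w \<in> W" and qc: "?q \<in> fst c" using w by (auto simp: W'_def)
    have op: "open (W' \<inter> i -` fst ?k)"
    proof -
      have "open (W \<inter> i -` fst ?k)" by (rule continuous_open_preimage[OF cont W M.chart(1)[OF k(1)]])
      moreover have "W' \<inter> i -` fst ?k = W' \<inter> (W \<inter> i -` fst ?k)" by (auto simp: W'_def)
      ultimately show ?thesis using W'(1) by auto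
    qed
    have ikd: "(snd ?k \<circ> i) differentiable at w"
      by (rule smooth_on_imp_differentiable[OF sm[OF k(1)]]) (use wW k in auto)
    have "D j w = D (\<lambda>y. (snd c \<circ> chart_inv ?k) ((snd ?k \<circ> i) y)) w"
      by (rule D_cong[OF op]) (use w k M.chart_inv_chart[OF k(1)] in \<open>auto simp: j_def\<close>)
    then show ?thesis
      using D_compose[OF ikd, of "snd c \<circ> chart_inv ?k" v] M.transition_differentiable[OF k(1) c(1) k(2) qc]
      by (simp add: dir_deriv_def)
  qed
  have Dj\<omega>: "D j w v = clift c d (j w) (D m w v)" if w: "w \<in> W'" for w v
  proof -
    let ?v = "D (snd (M.ch (i w)) \<circ> i) w v"
    have q: "w \<in> W" "i w \<in> fst c" "F (i w) \<in> fst d" using w by (auto simp: W'_def)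
    have "?v \<in> H (i w)" using rangeH[OF q(1)] by blast
    then show ?thesis
      using clift_hp[OF c(1) d(1) q(2,3), of ?v] Dj[OF w, of v] Dm[OF w, of v]
      by (simp add: hp_H f_def j_def)
  qed
  have surj: "\<exists>v. D m w0 v = k" for k
  proof -
    let ?q = "i w0"
    have "lift ?q (inv (N.T d (F ?q)) k) \<in> range (D (snd (M.ch ?q) \<circ> i) w0)"
      using rangeH[OF w0] lift_H by blast
    then obtain v where v: "D (snd (M.ch ?q) \<circ> i) w0 v = lift ?q (inv (N.T d (F ?q)) k)" by (metis rangeE)
    have "D m w0 v = k"
      unfolding Dm[OF W'(2)] Dj[OF W'(2)] v
      using clift_at[OF c(1) d(1) c(2), of k] D_loc_clift[OF c(1) d(1) jS[OF W'(2)], of k]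
      by (simp add: f_def j_def)
    then show ?thesis by blast
  qed
  have \<omega>d: "((\<lambda>x. clift c d x v) has_derivative D (\<lambda>x. clift c d x v) (j w0)) (at (j w0))" for v
    by (rule Ck_on_has_derivative[OF Ck_on_clift[OF c(1) d(1)] jS[OF W'(2)]])
  have D\<omega>: "D (\<lambda>w. clift c d (j w) v) w0 = (\<lambda>h. D (\<lambda>x. clift c d x v) (j w0) (D j w0 h))" for v
    by (rule D_eq[OF has_derivative_compose[OF jd[OF W'(2)] \<omega>d]])
  have D2: "D (\<lambda>w. D j w v) w0 v'
      = D (\<lambda>x. clift c d x (D m w0 v)) (j w0) (clift c d (j w0) (D m w0 v')) + clift c d (j w0) (D (\<lambda>w. D m w v) w0 v')" for v v'
  proof -
    have "D (\<lambda>w. D j w v) w0 = D (\<lambda>w. clift c d (j w) (D m w v)) w0"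
      by (rule D_cong[OF W' Dj\<omega>])
    also have "\<dots> = (\<lambda>h. D (\<lambda>w. clift c d (j w) (D m w0 v)) w0 h + clift c d (j w0) (D (\<lambda>w. D m w v) w0 h))"
    proof (rule D_eq[OF has_derivative_apply[OF W']])
      show "linear (clift c d (j w))" if "w \<in> W'" for w by (rule linear_clift[OF c(1) d(1) jS[OF that]])
      show "(\<lambda>w. clift c d (j w) v) differentiable at w0" for v
        by (rule differentiableI[OF has_derivative_compose[OF jd[OF W'(2)] \<omega>d]])
      show "((\<lambda>w. D m w v) has_derivative D (\<lambda>w. D m w v) w0) (at w0)"
        by (rule Ck_on_has_derivative[OF Ck_on_D[OF m] W'(2)])
    qed
    finally show ?thesis by (simp add: D\<omega> Dj\<omega>[OF W'(2)])
  qed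
  obtain v v' where v: "D m w0 v = k" "D m w0 v' = l" using surj by metis
  have "D (\<lambda>w. D j w v') w0 v = D (\<lambda>w. D j w v) w0 v'" by (rule D2_symmetric[OF j W'])
  moreover have "D (\<lambda>w. D m w v') w0 v = D (\<lambda>w. D m w v) w0 v'" by (rule D2_symmetric[OF m W'])
  ultimately show ?thesis unfolding D2 v by (simp add: j_def)
qed

text \<open>Frobenius' theorem for the horizontal distribution: leaves are local sections of \<open>F\<close> with horizontal
  tangent spaces, so both directions amount to the commutativity of the lifts.\<close>

theorem tensor_zero_iff_completely_integrable:
  "(\<forall>p. \<forall>x\<in>H p. \<forall>y\<in>H p. a p x y = 0) \<longleftrightarrow> completely_integrable TYPE('f) A H"
proof
  assume zero: "\<forall>p. \<forall>x\<in>H p. \<forall>y\<in>H p. a p x y = 0"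
  show "completely_integrable TYPE('f) A H"
    unfolding completely_integrable_def
  proof
    fix p
    define c where "c = M.ch p"
    define d where "d = N.ch (F p)"
    have c: "c \<in> A" "p \<in> fst c" and d: "d \<in> B" "F p \<in> fst d"
      using M.chart_at_in N.chart_at_in by (auto simp: c_def d_def)
    have x0: "snd c p \<in> ldom c d" using c d by auto
    have comm: "D (\<lambda>x. clift c d x l) x (clift c d x k) = D (\<lambda>x. clift c d x k) x (clift c d x l)"
      if x: "x \<in> ldom c d" for x k l
    proof -
      obtain q where q: "q \<in> fst c" "F q \<in> fst d" "x = snd c q" using x by auto
      show ?thesis unfolding q(3)
        using iffD1[OF tensor_zero_iff_clifts_commute[OF c(1) q(1) d(1) q(2)]] zero by blast
    qed
    obtain r u where u: "r > 0" "u 0 = snd c p" "u ` ball 0 r \<subseteq> ldom c d" "smooth_on (ball 0 r) u"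
      "\<And>y. y \<in> ball 0 r \<Longrightarrow> (u has_derivative clift c d (u y)) (at y)"
      by (rule commuting_lifts_integrable[OF open_ldom[OF c(1) d(1)] x0 linear_clift[OF c(1) d(1)]
            Ck_on_clift[OF c(1) d(1)] comm]) (assumption | rule that)+
    have "p = chart_inv c (u 0)" by (simp add: u(2) M.chart_inv_chart[OF c])
    then have "p \<in> (\<lambda>y. chart_inv c (u y)) ` ball 0 r" using u(1) by (intro image_eqI[of _ _ 0]) auto
    then show "\<exists>(W :: 'f set) i. integral_manifold A H W i \<and> p \<in> i ` W"
      using integral_manifold_of_clift_solution[OF c(1) d(1) u(3-5)] by blast
  qed
next
  assume int: "completely_integrable TYPE('f) A H"
  show "\<forall>p. \<forall>x\<in>H p. \<forall>y\<in>H p. a p x y = 0"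
  proof
    fix p
    obtain W :: "'f set" and i where im: "integral_manifold A H W i" and "p \<in> i ` W"
      using int unfolding completely_integrable_def by blast
    then obtain w0 where w0: "w0 \<in> W" "p = i w0" by blast
    show "\<forall>x\<in>H p. \<forall>y\<in>H p. a p x y = 0"
      unfolding w0(2) tensor_zero_iff_clifts_commute[OF M.chart_at_in N.chart_at_in]
      using clifts_commute_on_integral_manifold[OF im w0(1) M.chart_at_in N.chart_at_in] by blast
  qed
qed

end

theorem theorem5p2:
  fixes A1 :: "('a::{t2_space, second_countable_topology}, 'e::euclidean_space) chart set"
    and A2 :: "('b::{t2_space, second_countable_topology}, 'f::euclidean_space) chart set"
    and g1 :: "'a \<Rightarrow> 'e \<Rightarrow> 'e \<Rightarrow> real" and g2 :: "'b \<Rightarrow> 'f \<Rightarrow> 'f \<Rightarrow> real"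
    and nabla :: "('a \<Rightarrow> 'e) \<Rightarrow> ('a \<Rightarrow> 'e) \<Rightarrow> 'a \<Rightarrow> 'e"
    and phi :: "'a \<Rightarrow> 'e \<Rightarrow> 'e" and xi :: "'a \<Rightarrow> 'e" and eta :: "'a \<Rightarrow> 'e \<Rightarrow> real"
    and c1 c2 c3 \<theta> :: "'a \<Rightarrow> real" and F :: "'a \<Rightarrow> 'b" and s :: nat
  assumes "riemannian_manifold A1 g1" and "riemannian_manifold A2 g2"
    and "levi_civita A1 g1 nabla"
    and "generalized_sasakian_space_form A1 phi xi eta g1 nabla c1 c2 c3"
    and "riemannian_submersion A1 A2 g1 g2 F"
    and "pointwise_slant A1 A2 g1 F phi xi \<theta>"
    and "horizontally_slant A1 A2 g1 F phi eta \<theta>"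
    and "\<forall>p. dim (horizontal A1 A2 g1 F p) = s" and "s \<ge> 3"
  shows
    "let H = horizontal A1 A2 g1 F;
         \<rho> = horizontal_scalar_curvature A1 A2 g1 F nabla;
         \<delta> = casorati_delta A1 A2 g1 F nabla;
         \<delta>' = casorati_delta_hat A1 A2 g1 F nabla;
         A_zero = (\<forall>X\<in>sections A1 H. \<forall>Y\<in>sections A1 H. \<forall>p. oneill_A A1 A2 g1 F nabla X Y p = 0);
         Bh = (\<lambda>p. c1 p + 3 * c2 p / real s * (cos (\<theta> p))\<^sup>2 - 2 / real s * c3 p);
         Bv = (\<lambda>p. c1 p + 3 * c2 p / (real s - 1) * (cos (\<theta> p))\<^sup>2)
     in
       (xi \<in> sections A1 H \<longrightarrow>
          (\<forall>p. \<rho> p \<le> \<delta> p + Bh p) \<and> (\<forall>p. \<rho> p \<le> \<delta>' p + Bh p) \<and>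
          ((\<forall>p. \<rho> p = \<delta> p + Bh p) \<longleftrightarrow> A_zero) \<and>
          ((\<forall>p. \<rho> p = \<delta>' p + Bh p) \<longleftrightarrow> A_zero)) \<and>
       (xi \<in> sections A1 (vertical A1 A2 F) \<longrightarrow>
          (\<forall>p. \<rho> p \<le> \<delta> p + Bv p) \<and> (\<forall>p. \<rho> p \<le> \<delta>' p + Bv p) \<and>
          ((\<forall>p. \<rho> p = \<delta> p + Bv p) \<longleftrightarrow> A_zero) \<and>
          ((\<forall>p. \<rho> p = \<delta>' p + Bv p) \<longleftrightarrow> A_zero)) \<and>
       (A_zero \<longleftrightarrow> completely_integrable TYPE('f) A1 H)"
proof -
  have manifolds: "smooth_atlas A1" "riemannian_metric A1 g1" "smooth_atlas A2" "riemannian_metric A2 g2"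
    using assms(1,2) by (simp_all add: riemannian_manifold_def smooth_manifold_def)
  interpret S: sasakian_submersion A1 g1 A2 g2 F nabla phi xi eta c1 c2 c3 \<theta>
    by unfold_locales (fact manifolds assms)+
  have dim: "dim (horizontal A1 A2 g1 F p) = s" for p using assms(8) by simp
  have dim3: "dim (horizontal A1 A2 g1 F p) \<ge> 3" for p using assms(9) by (simp add: dim)
  note ineq = S.casorati_inequalities[OF dim3]
  have cases: "(\<forall>p. horizontal_scalar_curvature A1 A2 g1 F nabla p \<le> casorati_delta A1 A2 g1 F nabla p + b p) \<and>
      (\<forall>p. horizontal_scalar_curvature A1 A2 g1 F nabla p \<le> casorati_delta_hat A1 A2 g1 F nabla p + b p) \<and>
      ((\<forall>p. horizontal_scalar_curvature A1 A2 g1 F nabla p = casorati_delta A1 A2 g1 F nabla p + b p)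
        \<longleftrightarrow> (\<forall>p. \<forall>x\<in>horizontal A1 A2 g1 F p. \<forall>y\<in>horizontal A1 A2 g1 F p. S.a p x y = 0)) \<and>
      ((\<forall>p. horizontal_scalar_curvature A1 A2 g1 F nabla p = casorati_delta_hat A1 A2 g1 F nabla p + b p)
        \<longleftrightarrow> (\<forall>p. \<forall>x\<in>horizontal A1 A2 g1 F p. \<forall>y\<in>horizontal A1 A2 g1 F p. S.a p x y = 0))"
    if "\<And>p. S.mean_sectional_curvature p = b p" for b
    using ineq(1)[OF disjI1[OF refl]] ineq(1)[OF disjI2[OF refl]]
    by (simp only: that[symmetric] ineq(2)[OF disjI1[OF refl]] ineq(2)[OF disjI2[OF refl]] simp_thms)
  have horizontal: "S.mean_sectional_curvature p = c1 p + 3 * c2 p / real s * (cos (\<theta> p))\<^sup>2 - 2 / real s * c3 p"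
    if "xi \<in> S.HF" for p
    by (rule S.mean_curvature_horizontal[OF S.HF(2)[OF that] dim3, unfolded dim])
  have vertical: "S.mean_sectional_curvature p = c1 p + 3 * c2 p / (real s - 1) * (cos (\<theta> p))\<^sup>2"
    if "xi \<in> S.VF" for p
    by (rule S.mean_curvature_vertical[OF S.VF(2)[OF that] dim3, unfolded dim])
  show ?thesis
    unfolding Let_def S.A_zero_iff
    by (rule conjI[OF impI conjI[OF impI S.tensor_zero_iff_completely_integrable]],
        rule cases[OF horizontal], assumption, rule cases[OF vertical], assumption)
qed

end
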